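(* For each $n$, let $\mathrm{CW}_{\mathrm{depth},\dim}(n)$ be the set of all pairs $(\mathrm{depth}(G),\dim(G))$ where $G$ ranges over the Cameron--Walker graphs on $n$ vertices, and let $\mathrm{Graph}_{\mathrm{depth},\dim}(n)$ be the set of all pairs $(\mathrm{depth}(G),\dim(G))$ where $G$ ranges over all finite simple graphs on $n$ vertices. Suppose that the limit $$\lim_{n\to\infty}\frac{|\mathrm{CW}_{\mathrm{depth},\dim}(n)|}{|\mathrm{Graph}_{\mathrm{depth},\dim}(n)|}$$ exists. Then $$\frac13\le \lim_{n\to\infty}\frac{|\mathrm{CW}_{\mathrm{depth},\dim}(n)|}{|\mathrm{Graph}_{\mathrm{depth},\dim}(n)|}\le\frac49 .$$
   Context: All graphs are finite and simple. For a graph $G$ with vertices $x_1,\dots,x_n$, let $R=K[x_1,\dots,x_n]$ be the polynomial ring over a field $K$, and let the edge ideal $I(G)\subset R$ be the ideal generated by the monomials $x_ix_j$ with $\{x_i,x_j\}$ an edge of $G$. Put $\mathrm{depth}(G)=\mathrm{depth}(R/I(G))$ and $\dim(G)=\dim(R/I(G))$ (Krull dimension). A matching is a set of pairwise disjoint edges; an induced matching is a matching such that no two of its edges are joined by an edge of $G$. Let $\mathrm{m}(G)$ and $\mathrm{im}(G)$ be the maximum sizes of a matching and of an induced matching of $G$. A star is a complete bipartite graph $K_{1,r}$. A star triangle is a graph consisting of a set of triangles whose pairwise intersections are one single common vertex. A Cameron--Walker graph is a finite connected simple graph $G$ with $\mathrm{m}(G)=\mathrm{im}(G)$ that is neither a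 star nor a star triangle. Equivalently (Cameron--Walker), $G$ consists of a connected bipartite graph with nonempty vertex parts $\{u_1,\dots,u_m\}$ and $\{v_1,\dots,v_p\}$, with at least one leaf edge attached to each $u_i$ and possibly some pendant triangles attached to the $v_j$, where $G$ is not a star or a star triangle. *)

theory Defs
  imports
    Complex_Main
    "HOL-Library.Extended_Nat"
    "HOL-Library.Poly_Mapping"
    "HOL-Algebra.QuotRing"
    "HOL-Algebra.Module"
begin

section \<open>Finite simple graphs\<close>

text \<open>A graph is given by its vertex set and its set of edges, the edges being
  two-element sets of vertices.\<close>

definition simple_graph :: "'v set \<Rightarrow> 'v set set \<Rightarrow> bool" where
  "simple_graph V E \<longleftrightarrow> finite V \<and> (\<forall>e\<in>E. e \<subseteq> V \<and> card e = 2)"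

definition connected_graph :: "'v set \<Rightarrow> 'v set set \<Rightarrow> bool" where
  "connected_graph V E \<longleftrightarrow>
     V \<noteq> {} \<and> (\<forall>u\<in>V. \<forall>v\<in>V. (u, v) \<in> {(x, y). {x, y} \<in> E}\<^sup>*)"

definition matching :: "'v set set \<Rightarrow> 'v set set \<Rightarrow> bool" where
  "matching E M \<longleftrightarrow> M \<subseteq> E \<and> (\<forall>e\<in>M. \<forall>f\<in>M. e \<noteq> f \<longrightarrow> e \<inter> f = {})"

definition induced_matching :: "'v set set \<Rightarrow> 'v set set \<Rightarrow> bool" where
  "induced_matching E M \<longleftrightarrow> matching E M \<and>
     (\<forall>e\<in>M. \<forall>f\<in>M. e \<noteq> f \<longrightarrow> (\<forall>g\<in>E. \<not> (g \<inter> e \<noteq> {} \<and> g \<inter> f \<noteq> {})))"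

definition matching_number :: "'v set set \<Rightarrow> nat" where
  "matching_number E = Max {card M | M. matching E M}"

definition induced_matching_number :: "'v set set \<Rightarrow> nat" where
  "induced_matching_number E = Max {card M | M. induced_matching E M}"

text \<open>The star \<open>K\<^bsub>1,r\<^esub>\<close> with centre \<open>c\<close>. The case \<open>r = 0\<close> of a single vertex is
  included, so that a single vertex is not a Cameron--Walker graph.\<close>

definition is_star :: "'v set \<Rightarrow> 'v set set \<Rightarrow> bool" where
  "is_star V E \<longleftrightarrow> (\<exists>c\<in>V. E = {{c, v} | v. v \<in> V - {c}})"

text \<open>Here \<open>T\<close> is the set of the vertex sets of the triangles, and \<open>c\<close> the common vertex.\<close>

definition is_star_triangle :: "'v set \<Rightarrow> 'v set set \<Rightarrow> bool" where
  "is_star_triangle V E \<longleftrightarrow> (\<exists>c T. T \<noteq> {} \<and>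
     (\<forall>t\<in>T. card t = 3 \<and> c \<in> t) \<and>
     (\<forall>s\<in>T. \<forall>t\<in>T. s \<noteq> t \<longrightarrow> s \<inter> t = {c}) \<and>
     V = \<Union>T \<and>
     E = {e. card e = 2 \<and> (\<exists>t\<in>T. e \<subseteq> t)})"

definition cameron_walker :: "'v set \<Rightarrow> 'v set set \<Rightarrow> bool" where
  "cameron_walker V E \<longleftrightarrow>
     simple_graph V E \<and> connected_graph V E \<and>
     matching_number E = induced_matching_number E \<and>
     \<not> is_star V E \<and> \<not> is_star_triangle V E"


section \<open>Krull dimension and depth\<close>

text \<open>The zero ring, which has no prime ideals, gets dimension 0 here.\<close>

definition krull_dim :: "('a, 'b) ring_scheme \<Rightarrow> enat" where
  "krull_dim R = Sup {enat n | n. \<exists>P :: nat \<Rightarrow> 'a set.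
     (\<forall>i\<le>n. primeideal (P i) R) \<and> (\<forall>i<n. P i \<subset> P (Suc i))}"

text \<open>The submodule \<open>(f\<^sub>1, \<dots>, f\<^sub>r) M\<close> of \<open>M\<close>.\<close>

definition list_times_module :: "'a list \<Rightarrow> ('a, 'b, 'c) module_scheme \<Rightarrow> 'b set" where
  "list_times_module fs M =
     {(\<Oplus>\<^bsub>M\<^esub>i\<in>{..<length fs}. (fs ! i) \<odot>\<^bsub>M\<^esub> z i) | z. z \<in> {..<length fs} \<rightarrow> carrier M}"

text \<open>A list \<open>f\<^sub>1, \<dots>, f\<^sub>r\<close> is \<open>M\<close>-regular if each \<open>f\<^sub>i\<close> is a nonzerodivisor on
  \<open>M / (f\<^sub>1, \<dots>, f\<^bsub>i-1\<^esub>) M\<close> and \<open>M \<noteq> (f\<^sub>1, \<dots>, f\<^sub>r) M\<close>.\<close>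

definition regular_sequence ::
  "('a, 'd) ring_scheme \<Rightarrow> ('a, 'b, 'c) module_scheme \<Rightarrow> 'a list \<Rightarrow> bool" where
  "regular_sequence R M fs \<longleftrightarrow>
     set fs \<subseteq> carrier R \<and>
     (\<forall>i<length fs. \<forall>z\<in>carrier M.
        (fs ! i) \<odot>\<^bsub>M\<^esub> z \<in> list_times_module (take i fs) M \<longrightarrow>
        z \<in> list_times_module (take i fs) M) \<and>
     list_times_module fs M \<noteq> carrier M"

definition module_depth ::
  "('a, 'd) ring_scheme \<Rightarrow> 'a set \<Rightarrow> ('a, 'b, 'c) module_scheme \<Rightarrow> enat" where
  "module_depth R I M =
     Sup {enat (length fs) | fs. set fs \<subseteq> I \<and> regular_sequence R M fs}"

definition quotient_module :: "('a, 'd) ring_scheme \<Rightarrow> 'a set \<Rightarrow> ('a, 'a set) module" where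
  "quotient_module R I =
     ring.extend (R Quot I) (module.fields (\<lambda>r X. (I +>\<^bsub>R\<^esub> r) \<otimes>\<^bsub>R Quot I\<^esub> X))"


section \<open>Edge ideals\<close>

text \<open>\<open>K[x\<^sub>v | v \<in> V]\<close>: a polynomial maps exponent vectors to coefficients, and only
  the variables indexed by \<open>V\<close> may occur.\<close>

definition poly_ring :: "'v set \<Rightarrow> (('v \<Rightarrow>\<^sub>0 nat) \<Rightarrow>\<^sub>0 'k::field) ring" where
  "poly_ring V =
     \<lparr>carrier = {p. \<forall>m\<in>Poly_Mapping.keys p. Poly_Mapping.keys m \<subseteq> V},
      mult = (*), one = 1, zero = 0, add = (+)\<rparr>"

definition pvar :: "'v \<Rightarrow> (('v \<Rightarrow>\<^sub>0 nat) \<Rightarrow>\<^sub>0 'k::field)" where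
  "pvar v = Poly_Mapping.single (Poly_Mapping.single v 1) 1"

definition edge_ideal :: "'v set \<Rightarrow> 'v set set \<Rightarrow> (('v \<Rightarrow>\<^sub>0 nat) \<Rightarrow>\<^sub>0 'k::field) set" where
  "edge_ideal V E = Idl\<^bsub>poly_ring V\<^esub> {pvar u * pvar v | u v. {u, v} \<in> E}"

definition irrelevant_ideal :: "'v set \<Rightarrow> (('v \<Rightarrow>\<^sub>0 nat) \<Rightarrow>\<^sub>0 'k::field) set" where
  "irrelevant_ideal V = Idl\<^bsub>poly_ring V\<^esub> (pvar ` V)"

text \<open>The coefficient field enters only as a type. The depth of the graded module
  \<open>R / I(G)\<close> is taken with respect to the graded maximal ideal of \<open>R\<close>.\<close>

definition graph_depth :: "'k::field itself \<Rightarrow> 'v set \<Rightarrow> 'v set set \<Rightarrow> enat" where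
  "graph_depth K V E =
     (let R = poly_ring V :: (('v \<Rightarrow>\<^sub>0 nat) \<Rightarrow>\<^sub>0 'k) ring
      in module_depth R (irrelevant_ideal V) (quotient_module R (edge_ideal V E)))"

definition graph_dim :: "'k::field itself \<Rightarrow> 'v set \<Rightarrow> 'v set set \<Rightarrow> enat" where
  "graph_dim K V E =
     (let R = poly_ring V :: (('v \<Rightarrow>\<^sub>0 nat) \<Rightarrow>\<^sub>0 'k) ring
      in krull_dim (R Quot edge_ideal V E))"


section \<open>Pairs of depth and dimension\<close>

text \<open>Every finite graph is isomorphic to one whose vertices are natural numbers.\<close>

definition Graph_depth_dim :: "'k::field itself \<Rightarrow> nat \<Rightarrow> (enat \<times> enat) set" where
  "Graph_depth_dim K n =
     {(graph_depth K V E, graph_dim K V E) | (V :: nat set) E.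
        simple_graph V E \<and> card V = n}"

definition CW_depth_dim :: "'k::field itself \<Rightarrow> nat \<Rightarrow> (enat \<times> enat) set" where
  "CW_depth_dim K n =
     {(graph_depth K V E, graph_dim K V E) | (V :: nat set) E.
        cameron_walker V E \<and> card V = n}"

end

theory Submission
  imports Defs "HOL-Library.Countable"
begin

text \<open>The depth of \<open>R / I(G)\<close> is at most the size of any maximal independent set and at least the size of
  any set of vertices with pairwise disjoint closed neighbourhoods; the dimension is the independence number.
  If \<open>G\<close> is Cameron--Walker with matching number \<open>\<mu>\<close>, a maximum induced matching yields a maximal
  independent set of size \<open>\<mu>\<close>, and the unmatched vertices are independent. So \<open>a \<le> b\<close>, \<open>a + b \<le> n\<close> and
  \<open>n \<le> 3 b\<close> for every pair \<open>(a, b)\<close> of depth and dimension, which leaves about \<open>7 n\<^sup>2 / 36\<close> pairs.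
  Conversely an explicit family of Cameron--Walker graphs attains the pairs with \<open>n - 2 b \<le> a \<le> min b (n - b)\<close>
  up to a bounded distance from the boundary, which are about \<open>n\<^sup>2 / 6\<close> many. All graphs together attain about
  \<open>n\<^sup>2 / 2\<close> pairs.\<close>

section \<open>Weakly regular sequences\<close>

text \<open>Depth is a supremum over all sequences in the irrelevant ideal and Krull dimension one
  over all chains of primes, so both upper bounds must handle arbitrary polynomials. One elementary
  fact serves both: more polynomials than variables satisfy an algebraic relation, because their
  products with bounded exponents outnumber the available monomials. Splitting off lowest terms
  gives the relation the form \<open>nest\<close>; regularity (for the depth) or a strict chain of
  primes (for the dimension) peels it layer by layer down to the constant 1. The lower bound for the
  depth rests on colon ideals of monomial ideals, which are computed on supports. The leading
  coefficients 7/36 and 1/2 have quotient 7/18, strictly below 4/9, so the upper estimate has room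
  for lower-order terms. In the lower estimate 1/6 against 1/2 is exactly 1/3, and an error of order
  1/n must be carried along. Since the limit is assumed to exist, only n = 6k is counted, which
  makes the corners n/3 and n/2 of the region integral.\<close>

definition subring_set :: "'a::comm_ring_1 set \<Rightarrow> bool" where
  "subring_set C \<longleftrightarrow> 1 \<in> C \<and> (\<forall>x\<in>C. \<forall>y\<in>C. x - y \<in> C \<and> x * y \<in> C)"

definition ideal_in :: "'a::comm_ring_1 set \<Rightarrow> 'a set \<Rightarrow> bool" where
  "ideal_in C I \<longleftrightarrow> I \<subseteq> C \<and> 0 \<in> I \<and> (\<forall>x\<in>I. \<forall>y\<in>I. x + y \<in> I) \<and> (\<forall>x\<in>I. \<forall>r\<in>C. x * r \<in> I)"

definition add_gen :: "'a::comm_ring_1 set \<Rightarrow> 'a set \<Rightarrow> 'a \<Rightarrow> 'a set" where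
  "add_gen C I f = {i + f * h | i h. i \<in> I \<and> h \<in> C}"

definition colon :: "'a::comm_ring_1 set \<Rightarrow> 'a set \<Rightarrow> 'a \<Rightarrow> 'a set" where
  "colon C I x = {z \<in> C. x * z \<in> I}"

fun add_gens :: "'a::comm_ring_1 set \<Rightarrow> 'a set \<Rightarrow> 'a list \<Rightarrow> 'a set" where
  "add_gens C I [] = I"
| "add_gens C I (f # fs) = add_gens C (add_gen C I f) fs"

text \<open>Unlike in a regular sequence, the ideal may become the whole ring. This lets the
  property pass to colon ideals and to powers, where the unit ideal occurs; properness is checked
  separately.\<close>

fun weakly_regular :: "'a::comm_ring_1 set \<Rightarrow> 'a set \<Rightarrow> 'a list \<Rightarrow> bool" where
  "weakly_regular C I [] \<longleftrightarrow> True"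
| "weakly_regular C I (f # fs) \<longleftrightarrow>
     (\<forall>z\<in>C. f * z \<in> I \<longrightarrow> z \<in> I) \<and> weakly_regular C (add_gen C I f) fs"

lemma add_genI:
  assumes "z = i + f * h" "i \<in> I" "h \<in> C"
  shows "z \<in> add_gen C I f"
  using assms unfolding add_gen_def by blast

lemma subring_setD:
  assumes "subring_set C"
  shows "1 \<in> C" "0 \<in> C" "x \<in> C \<Longrightarrow> y \<in> C \<Longrightarrow> x - y \<in> C" "x \<in> C \<Longrightarrow> y \<in> C \<Longrightarrow> x * y \<in> C"
    "x \<in> C \<Longrightarrow> - x \<in> C" "x \<in> C \<Longrightarrow> y \<in> C \<Longrightarrow> x + y \<in> C" "x \<in> C \<Longrightarrow> x ^ k \<in> C"
proof -
  show 1: "1 \<in> C" and d: "\<And>x y. x \<in> C \<Longrightarrow> y \<in> C \<Longrightarrow> x - y \<in> C"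
    and m: "\<And>x y. x \<in> C \<Longrightarrow> y \<in> C \<Longrightarrow> x * y \<in> C"
    using assms by (auto simp: subring_set_def)
  show z: "0 \<in> C"
    using d[OF 1 1] by simp
  show n: "- x \<in> C" if "x \<in> C" for x
    using d[OF z that] by simp
  show "x + y \<in> C" if "x \<in> C" "y \<in> C"
    using d[OF that(1) n[OF that(2)]] by simp
  show "x ^ k \<in> C" if "x \<in> C"
    by (induction k) (auto simp: 1 m that)
qed

lemma ideal_inD:
  assumes "ideal_in C I"
  shows "x \<in> I \<Longrightarrow> x \<in> C" "0 \<in> I" "x \<in> I \<Longrightarrow> y \<in> I \<Longrightarrow> x + y \<in> I"
    "x \<in> I \<Longrightarrow> r \<in> C \<Longrightarrow> x * r \<in> I" "x \<in> I \<Longrightarrow> r \<in> C \<Longrightarrow> r * x \<in> I"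
  using assms by (auto simp: ideal_in_def mult.commute)

lemma ideal_in_diff:
  assumes "subring_set C" "ideal_in C I" "x \<in> I" "y \<in> I"
  shows "x - y \<in> I"
proof -
  have "- 1 \<in> C"
    using subring_setD[OF assms(1)] by simp
  hence "y * (- 1) \<in> I"
    using ideal_inD(4)[OF assms(2,4)] by blast
  thus ?thesis
    using ideal_inD(3)[OF assms(2,3)] by fastforce
qed

lemma ideal_in_add_gen:
  assumes C: "subring_set C" and I: "ideal_in C I" and f: "f \<in> C"
  shows "ideal_in C (add_gen C I f)"
  unfolding ideal_in_def
proof (intro conjI ballI)
  show "add_gen C I f \<subseteq> C"
    using subring_setD[OF C] ideal_inD[OF I] f by (auto simp: add_gen_def)
  have "0 = 0 + f * 0" by simp
  thus "0 \<in> add_gen C I f"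
    using subring_setD(2)[OF C] ideal_inD(2)[OF I] unfolding add_gen_def by blast
next
  fix x y assume "x \<in> add_gen C I f" "y \<in> add_gen C I f"
  then obtain i h j k where "x = i + f * h" "y = j + f * k" "i \<in> I" "j \<in> I" "h \<in> C" "k \<in> C"
    unfolding add_gen_def by blast
  moreover from this have "x + y = (i + j) + f * (h + k)"
    by (simp add: algebra_simps)
  ultimately show "x + y \<in> add_gen C I f"
    using subring_setD(6)[OF C] ideal_inD(3)[OF I] unfolding add_gen_def by blast
next
  fix x r assume "x \<in> add_gen C I f" "r \<in> C"
  then obtain i h where "x = i + f * h" "i \<in> I" "h \<in> C"
    unfolding add_gen_def by blast
  moreover from this have "x * r = i * r + f * (h * r)"
    by (simp add: algebra_simps)
  ultimately show "x * r \<in> add_gen C I f"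
    using subring_setD(4)[OF C] ideal_inD(4)[OF I] \<open>r \<in> C\<close> unfolding add_gen_def by blast
qed

lemma add_gen_superset:
  assumes "subring_set C" "i \<in> I"
  shows "i \<in> add_gen C I f"
proof -
  have "i = i + f * 0" by simp
  thus ?thesis
    using assms subring_setD(2) unfolding add_gen_def by blast
qed

lemma add_gen_minimal:
  assumes "ideal_in C J" "I \<subseteq> J" "f \<in> J"
  shows "add_gen C I f \<subseteq> J"
  using assms ideal_inD[OF assms(1)] by (auto simp: add_gen_def)

lemma mem_add_gen_self:
  assumes "subring_set C" "ideal_in C I" "h \<in> C"
  shows "f * h \<in> add_gen C I f"
  using assms ideal_inD(2)[OF assms(2)] unfolding add_gen_def by force

lemma add_gen_commute: "add_gen C (add_gen C I f) g = add_gen C (add_gen C I g) f"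
proof -
  have "add_gen C (add_gen C I f) g \<subseteq> add_gen C (add_gen C I g) f" for f g
  proof
    fix z assume "z \<in> add_gen C (add_gen C I f) g"
    then obtain i h k where z: "z = (i + f * h) + g * k" "i \<in> I" "h \<in> C" "k \<in> C"
      unfolding add_gen_def by blast
    have "z = (i + g * k) + f * h" by (simp add: z)
    from this add_genI[OF refl z(2,4)] z(3) show "z \<in> add_gen C (add_gen C I g) f"
      by (rule add_genI)
  qed
  thus ?thesis by blast
qed

lemma add_gens_minimal:
  assumes "ideal_in C J" "I \<subseteq> J" "set fs \<subseteq> J"
  shows "add_gens C I fs \<subseteq> J"
  using assms(2,3)
proof (induction fs arbitrary: I)
  case (Cons f fs)
  thus ?case
    using add_gen_minimal[OF assms(1), of I f] by simp
qed simp

text \<open>This is the horseshoe argument for \<open>0 \<rightarrow> R/(I : x) \<rightarrow> R/I \<rightarrow> R/(I + (x)) \<rightarrow> 0\<close>: the first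
  element of the sequence is regular on both ends, so dividing by it keeps the sequence exact.\<close>

lemma weakly_regular_colon:
  assumes "subring_set C" "ideal_in C I" "x \<in> C" "set fs \<subseteq> C"
    and "weakly_regular C (colon C I x) fs" "weakly_regular C (add_gen C I x) fs"
  shows "weakly_regular C I fs"
  using assms(2,4-6)
proof (induction fs arbitrary: I)
  case (Cons f fs)
  note C = subring_setD[OF \<open>subring_set C\<close>] and I = ideal_inD[OF \<open>ideal_in C I\<close>]
  have f: "f \<in> C"
    using Cons.prems by simp
  have reg: "z \<in> I" if z: "z \<in> C" "f * z \<in> I" for z
  proof -
    have "z \<in> add_gen C I x"
      using Cons.prems(4) z add_gen_superset[OF \<open>subring_set C\<close> z(2)] by simp
    then obtain i z' where z': "z = i + x * z'" "i \<in> I" "z' \<in> C"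
      unfolding add_gen_def by blast
    have "x * (f * z') = f * z - f * i"
      by (simp add: z' algebra_simps)
    also have "\<dots> \<in> I"
      by (rule ideal_in_diff[OF \<open>subring_set C\<close> \<open>ideal_in C I\<close> z(2) I(5)[OF z'(2) f]])
    finally have "f * z' \<in> colon C I x"
      using C(4)[OF f z'(3)] by (simp add: colon_def)
    hence "x * z' \<in> I"
      using Cons.prems(3) z'(3) by (simp add: colon_def)
    thus ?thesis
      using z' I by blast
  qed
  \<comment> \<open>The two operations commute, so the hypotheses on \<open>I\<close> pass to
    \<open>add_gen C I f\<close>. From left to right, regularity of \<open>f\<close> modulo
    \<open>add_gen C I x\<close> makes \<open>w\<close> a multiple of \<open>x\<close> modulo
    \<open>I\<close>.\<close>
  have "colon C (add_gen C I f) x = add_gen C (colon C I x) f"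
  proof (intro equalityI subsetI)
    fix z assume "z \<in> colon C (add_gen C I f) x"
    then obtain i w where z: "z \<in> C" "x * z = i + f * w" "i \<in> I" "w \<in> C"
      unfolding colon_def add_gen_def by blast
    have "f * w = - i + x * z" by (simp add: z)
    moreover have "- i \<in> I"
      using ideal_in_diff[OF \<open>subring_set C\<close> \<open>ideal_in C I\<close> I(2) z(3)] by simp
    ultimately have "w \<in> add_gen C I x"
      using Cons.prems(4) z unfolding weakly_regular.simps add_gen_def by blast
    then obtain i' w' where w: "w = i' + x * w'" "i' \<in> I" "w' \<in> C"
      unfolding add_gen_def by blast
    have "x * (z - f * w') = i + f * i'"
      using z(2) w(1) by (simp add: algebra_simps)
    hence "z - f * w' \<in> colon C I x"
      using z w I f C by (simp add: colon_def)
    moreover have "z = (z - f * w') + f * w'" by simp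
    ultimately show "z \<in> add_gen C (colon C I x) f"
      using w unfolding add_gen_def by blast
  next
    fix z assume "z \<in> add_gen C (colon C I x) f"
    then obtain i w where z: "z = i + f * w" "i \<in> C" "x * i \<in> I" "w \<in> C"
      unfolding colon_def add_gen_def by blast
    have "x * z = x * i + f * (x * w)"
      by (simp add: z algebra_simps)
    from add_genI[OF this z(3)] show "z \<in> colon C (add_gen C I f) x"
      using f C \<open>x \<in> C\<close> z by (simp add: colon_def)
  qed
  hence "weakly_regular C (add_gen C I f) fs"
    using Cons.prems Cons.IH[of "add_gen C I f"] ideal_in_add_gen[OF \<open>subring_set C\<close> Cons.prems(1) f]
    by (simp add: add_gen_commute[of C I f x])
  with reg show ?case by simp
qed simp

lemma ideal_in_whole: "subring_set C \<Longrightarrow> ideal_in C C"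
  using subring_setD[of C] by (auto simp: ideal_in_def)

lemma ideal_in_eq_whole: "subring_set C \<Longrightarrow> ideal_in C I \<Longrightarrow> 1 \<in> I \<Longrightarrow> I = C"
  using ideal_inD[of C I] by (metis mult_1 subsetI subset_antisym)

lemma weakly_regular_whole:
  assumes "subring_set C" "set fs \<subseteq> C"
  shows "weakly_regular C C fs"
  using assms(2)
proof (induction fs)
  case (Cons f fs)
  have "add_gen C C f = C"
    using ideal_in_eq_whole[OF assms(1) ideal_in_add_gen[OF assms(1) ideal_in_whole[OF assms(1)]]]
      Cons.prems add_gen_superset[OF assms(1)] subring_setD(1)[OF assms(1)] by simp
  with Cons show ?case by simp
qed simp

text \<open>Induction on \<open>k\<close> through \<open>weakly_regular_colon\<close> with
  \<open>x = f\<close>: for J = I + (f^(k+1)) the colon J : f is I + (f^k), because \<open>f\<close>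
  is regular modulo \<open>I\<close>, and J + (f) is I + (f).\<close>

lemma weakly_regular_power_step:
  assumes "subring_set C" "ideal_in C I" "f \<in> C" "set fs \<subseteq> C"
    and "\<And>z. z \<in> C \<Longrightarrow> f * z \<in> I \<Longrightarrow> z \<in> I" "weakly_regular C (add_gen C I f) fs"
  shows "weakly_regular C (add_gen C I (f ^ k)) fs"
proof (induction k)
  case 0
  \<comment> \<open>For exponent 0 the ideal is the unit ideal, modulo which every sequence is
    weakly regular.\<close>
  have "add_gen C I (f ^ 0) = C"
    using ideal_in_eq_whole[OF assms(1) ideal_in_add_gen[OF assms(1,2)], of 1]
      mem_add_gen_self[OF assms(1,2), of 1 1] subring_setD(1)[OF assms(1)] by simp
  thus ?case
    using weakly_regular_whole[OF assms(1,4)] by simp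
next
  case (Suc k)
  note C = subring_setD[OF assms(1)] and I = ideal_inD[OF assms(2)]
  let ?J = "add_gen C I (f ^ Suc k)"
  have J: "ideal_in C ?J"
    using ideal_in_add_gen[OF assms(1,2) C(7)[OF assms(3)]] .
  have "colon C ?J f = add_gen C I (f ^ k)"
  proof (intro equalityI subsetI)
    fix z assume "z \<in> colon C ?J f"
    then obtain i h where z: "z \<in> C" "f * z = i + f ^ Suc k * h" "i \<in> I" "h \<in> C"
      unfolding colon_def add_gen_def by blast
    have "f * (z - f ^ k * h) = i"
      using z(2) by (simp add: algebra_simps)
    hence "z - f ^ k * h \<in> I"
      using assms(5)[of "z - f ^ k * h"] z C assms(3) by simp
    moreover have "z = (z - f ^ k * h) + f ^ k * h" by simp
    ultimately show "z \<in> add_gen C I (f ^ k)"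
      using z(4) unfolding add_gen_def by blast
  next
    fix z assume "z \<in> add_gen C I (f ^ k)"
    then obtain i h where z: "z = i + f ^ k * h" "i \<in> I" "h \<in> C"
      unfolding add_gen_def by blast
    moreover from this have "f * z = f * i + f ^ Suc k * h"
      by (simp add: algebra_simps)
    moreover have "z \<in> C"
      using z C(4,6,7) I(1) assms(3) by simp
    ultimately show "z \<in> colon C ?J f"
      using add_genI[of "f * z" "f * i" "f ^ Suc k" h I C] I assms(3) by (simp add: colon_def)
  qed
  moreover have "add_gen C ?J f = add_gen C I f"
  proof
    have *: "f ^ Suc k \<in> add_gen C I f"
      using mem_add_gen_self[OF assms(1,2) C(7)[OF assms(3)], of f k] by simp
    have **: "f \<in> add_gen C I f"
      using mem_add_gen_self[OF assms(1,2) C(1), of f] by simp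
    show "add_gen C ?J f \<subseteq> add_gen C I f"
      using ideal_in_add_gen[OF assms(1,2,3)] * ** add_gen_superset[OF assms(1)]
      by (meson add_gen_minimal subsetI)
    show "add_gen C I f \<subseteq> add_gen C ?J f"
      using add_gen_superset[OF assms(1)] unfolding add_gen_def by blast
  qed
  ultimately show ?case
    using weakly_regular_colon[OF assms(1) J assms(3,4)] Suc assms(6) by simp
qed

lemma power_cancel:
  assumes "subring_set C" "f \<in> C" "\<And>z. z \<in> C \<Longrightarrow> f * z \<in> I \<Longrightarrow> z \<in> I"
    and "z \<in> C" "f ^ k * z \<in> I"
  shows "z \<in> I"
  using assms(5)
proof (induction k)
  case (Suc k)
  have "f ^ k * z \<in> C"
    using subring_setD(4,7)[OF assms(1)] assms by simp
  from assms(3)[OF this] Suc show ?case by (simp add: mult.assoc)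
qed simp

text \<open>Powers are wanted because their monomials have high degree, on which the final
  comparison in the depth bound relies. The power step exchanges the head while the tail stays
  regular.\<close>

lemma weakly_regular_powers:
  assumes "subring_set C" "ideal_in C I" "set fs \<subseteq> C" "weakly_regular C I fs"
  shows "weakly_regular C I (map (\<lambda>f. f ^ k) fs)"
  using assms(2-4)
proof (induction fs arbitrary: I)
  case (Cons f fs)
  have f: "f \<in> C" "f ^ k \<in> C"
    using Cons.prems subring_setD(7)[OF assms(1)] by simp_all
  have reg: "z \<in> I" if "z \<in> C" "f * z \<in> I" for z
    using that Cons.prems by simp
  have regk: "z \<in> I" if "z \<in> C" "f ^ k * z \<in> I" for z
    using power_cancel[OF assms(1) f(1) reg that] .
  have "weakly_regular C (add_gen C I (f ^ k)) fs"
    using weakly_regular_power_step[OF assms(1) Cons.prems(1) f(1)] reg Cons.prems by simp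
  hence "weakly_regular C (add_gen C I (f ^ k)) (map (\<lambda>f. f ^ k) fs)"
    using Cons.IH ideal_in_add_gen[OF assms(1) Cons.prems(1) f(2)] Cons.prems by simp
  with regk show ?case by simp
qed simp

text \<open>The elements \<open>f\<^sub>1\<^sup>a(f\<^sub>2\<^sup>b(\<dots>(f\<^sub>r\<^sup>c(1 + f\<^sub>r h\<^sub>r) \<dots>) + f\<^sub>2 h\<^sub>2) + f\<^sub>1 h\<^sub>1)\<close>: an algebraic relation between the
  \<open>f\<^sub>i\<close> takes this shape (up to a unit) when its lexicographically lowest term is split off.\<close>

fun nest :: "'a::comm_ring_1 set \<Rightarrow> 'a list \<Rightarrow> 'a set" where
  "nest C [] = {1}"
| "nest C (f # fs) = {f ^ a * (g + f * h) | a g h. g \<in> nest C fs \<and> h \<in> C}"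

lemma nest_subset:
  assumes "subring_set C" "set fs \<subseteq> C"
  shows "nest C fs \<subseteq> C"
  using assms(2)
proof (induction fs)
  case (Cons f fs)
  note C = subring_setD[OF assms(1)]
  from Cons have f: "f \<in> C" and IH: "nest C fs \<subseteq> C" by auto
  have "f ^ a * (g + f * h) \<in> C" if "g \<in> nest C fs" "h \<in> C" for a g h
    using C(4)[OF C(7)[OF f] C(6)[OF subsetD[OF IH that(1)] C(4)[OF f that(2)]]] .
  thus ?case by auto
qed (use subring_setD[OF assms(1)] in simp)

text \<open>One layer of the nested form is removed at a time: f^a cancels because \<open>f\<close>
  is regular modulo \<open>I\<close>, and the summand \<open>f * h\<close> disappears once
  \<open>f\<close> is put into the ideal. The innermost element is 1, which leaves \<open>w\<close>
  itself.\<close>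

lemma nest_collapse:
  assumes "subring_set C" "ideal_in C I" "set fs \<subseteq> C" "weakly_regular C I fs"
    and "w \<in> C" "g \<in> nest C fs" "w * g \<in> I"
  shows "w \<in> add_gens C I fs"
  using assms(2-4,6-7)
proof (induction fs arbitrary: I g)
  case (Cons f fs)
  note C = subring_setD[OF assms(1)]
  have f: "f \<in> C" using Cons.prems by simp
  obtain a g' h where g: "g = f ^ a * (g' + f * h)" "g' \<in> nest C fs" "h \<in> C"
    using Cons.prems by auto
  have g'C: "g' \<in> C"
    using nest_subset[OF assms(1), of fs] g Cons.prems by auto
  have "z \<in> I" if "z \<in> C" "f ^ a * z \<in> I" for z
    using power_cancel[OF assms(1) f _ that] Cons.prems(3) by simp
  note this[of "w * (g' + f * h)"]
  moreover have "w * (g' + f * h) \<in> C"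
    by (intro C(4,6) \<open>w \<in> C\<close> g'C f g)
  moreover have "w * g = f ^ a * (w * (g' + f * h))"
    by (simp add: g(1) mult_ac)
  ultimately have "w * (g' + f * h) \<in> I"
    using Cons.prems(5) by simp
  moreover have "w * g' = w * (g' + f * h) + f * (- (w * h))"
    by (simp add: algebra_simps)
  moreover have "- (w * h) \<in> C"
    by (intro C(4,5) \<open>w \<in> C\<close> g(3))
  ultimately have "w * g' \<in> add_gen C I f"
    using add_genI by blast
  thus ?case
    using Cons.IH[OF ideal_in_add_gen[OF assms(1) Cons.prems(1) f]] Cons.prems g by simp
qed simp

section \<open>Ideals spanned by monomials\<close>

abbreviation "keys \<equiv> Poly_Mapping.keys"
abbreviation "lookup \<equiv> Poly_Mapping.lookup"
abbreviation "single \<equiv> Poly_Mapping.single"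

definition polys :: "'v set \<Rightarrow> (('v \<Rightarrow>\<^sub>0 nat) \<Rightarrow>\<^sub>0 'k::field) set" where
  "polys V = {p. \<forall>m\<in>keys p. keys m \<subseteq> V}"

text \<open>The Stanley-Reisner ideal with nonfaces \<open>N\<close>, described by supports of
  monomials and not by generators. When \<open>N\<close> is an upset this is an ideal, and colons
  and sums with variables become operations on \<open>N\<close>.\<close>

definition face_ideal :: "'v set \<Rightarrow> 'v set set \<Rightarrow> (('v \<Rightarrow>\<^sub>0 nat) \<Rightarrow>\<^sub>0 'k::field) set" where
  "face_ideal V N = {p. \<forall>m\<in>keys p. keys m \<subseteq> V \<and> keys m \<in> N}"

definition upset :: "'v set set \<Rightarrow> bool" where
  "upset N \<longleftrightarrow> (\<forall>s t. s \<in> N \<longrightarrow> s \<subseteq> t \<longrightarrow> t \<in> N)"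

lemma keys_add_nat: "keys (m + n :: 'v \<Rightarrow>\<^sub>0 nat) = keys m \<union> keys n"
  by (auto simp: in_keys_iff lookup_add)

lemma keys_minus_poly: "keys (p - q :: 'a \<Rightarrow>\<^sub>0 'k::field) \<subseteq> keys p \<union> keys q"
  by (auto simp: in_keys_iff lookup_minus)

lemma sum_single_lookup:
  "(\<Sum>m\<in>keys p. single m (lookup p m)) = (p :: 'a \<Rightarrow>\<^sub>0 'b::comm_monoid_add)"
  by (rule poly_mapping_eqI) (auto simp: lookup_sum lookup_single when_def in_keys_iff sum.delta')

lemma mem_by_monomials:
  fixes p :: "'a \<Rightarrow>\<^sub>0 'b::comm_monoid_add"
  assumes "0 \<in> Q" "\<And>p q. p \<in> Q \<Longrightarrow> q \<in> Q \<Longrightarrow> p + q \<in> Q"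
    and "\<And>m. m \<in> keys p \<Longrightarrow> single m (lookup p m) \<in> Q"
  shows "p \<in> Q"
proof -
  have "(\<Sum>m\<in>A. single m (lookup p m)) \<in> Q" if "finite A" "A \<subseteq> keys p" for A
    using that by (induction A) (auto simp: assms)
  from this[of "keys p"] show ?thesis by (simp add: sum_single_lookup)
qed

lemma subring_polys: "subring_set (polys V)"
proof -
  have "x * y \<in> polys V" if "x \<in> polys V" "y \<in> polys V" for x y :: "('a \<Rightarrow>\<^sub>0 nat) \<Rightarrow>\<^sub>0 'k::field"
    unfolding polys_def
  proof (intro CollectI ballI)
    fix m assume "m \<in> keys (x * y)"
    then obtain a b where "m = a + b" "a \<in> keys x" "b \<in> keys y"
      using keys_mult[of x y] by blast
    thus "keys m \<subseteq> V"
      using that by (auto simp: polys_def keys_add_nat)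
  qed
  moreover have "x - y \<in> polys V" if "x \<in> polys V" "y \<in> polys V" for x y :: "('a \<Rightarrow>\<^sub>0 nat) \<Rightarrow>\<^sub>0 'k::field"
    using that keys_minus_poly[of x y] by (auto simp: polys_def)
  moreover have "1 \<in> (polys V :: (('a \<Rightarrow>\<^sub>0 nat) \<Rightarrow>\<^sub>0 'k::field) set)"
    by (simp add: polys_def)
  ultimately show ?thesis
    unfolding subring_set_def by blast
qed

lemmas polys_closed = subring_setD[OF subring_polys]

lemma single_in_polys: "keys m \<subseteq> V \<Longrightarrow> single m c \<in> polys V"
  by (auto simp: polys_def)

lemma const_in_polys: "single 0 c \<in> polys V"
  by (auto simp: polys_def)

lemma pvar_in_polys: "v \<in> V \<Longrightarrow> pvar v \<in> polys V"
  by (auto simp: polys_def pvar_def)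

lemma sum_in_polys: "(\<And>i. i \<in> A \<Longrightarrow> f i \<in> polys V) \<Longrightarrow> (\<Sum>i\<in>A. f i) \<in> polys V"
  by (induction A rule: infinite_finite_induct) (auto intro: polys_closed)

lemma prod_in_polys: "(\<And>i. i \<in> A \<Longrightarrow> f i \<in> polys V) \<Longrightarrow> (\<Prod>i\<in>A. f i) \<in> polys V"
  by (induction A rule: infinite_finite_induct) (auto intro: polys_closed)

lemma ideal_in_sum:
  "ideal_in C I \<Longrightarrow> (\<And>i. i \<in> A \<Longrightarrow> f i \<in> I) \<Longrightarrow> (\<Sum>i\<in>A. f i) \<in> I"
  by (induction A rule: infinite_finite_induct) (auto intro: ideal_inD)

lemma ideal_in_face_ideal:
  assumes "upset N"
  shows "ideal_in (polys V) (face_ideal V N)"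
  unfolding ideal_in_def
proof (intro conjI ballI)
  show "face_ideal V N \<subseteq> polys V" by (auto simp: face_ideal_def polys_def)
  show "0 \<in> face_ideal V N" by (simp add: face_ideal_def)
next
  fix x y :: "('a \<Rightarrow>\<^sub>0 nat) \<Rightarrow>\<^sub>0 'b"
  assume "x \<in> face_ideal V N" "y \<in> face_ideal V N"
  thus "x + y \<in> face_ideal V N"
    using keys_add[of x y] by (auto simp: face_ideal_def)
next
  fix x r :: "('a \<Rightarrow>\<^sub>0 nat) \<Rightarrow>\<^sub>0 'b"
  assume x: "x \<in> face_ideal V N" and r: "r \<in> polys V"
  show "x * r \<in> face_ideal V N"
    unfolding face_ideal_def
  proof (intro CollectI ballI)
    fix m assume "m \<in> keys (x * r)"
    then obtain a b where "m = a + b" "a \<in> keys x" "b \<in> keys r"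
      using keys_mult[of x r] by blast
    thus "keys m \<subseteq> V \<and> keys m \<in> N"
      using x r assms by (auto simp: face_ideal_def polys_def keys_add_nat upset_def)
  qed
qed

lemma pvar_power: "(pvar v :: ('v \<Rightarrow>\<^sub>0 nat) \<Rightarrow>\<^sub>0 'k::field) ^ k = single (single v k) 1"
  by (induction k) (auto simp: pvar_def mult_single single_add[symmetric])

lemma prod_single_one:
  "finite A \<Longrightarrow> (\<Prod>i\<in>A. single (g i) (1::'k::field)) = single (\<Sum>i\<in>A. g i) 1"
  by (induction A rule: finite_induct) (auto simp: mult_single)

lemma single_eq_prod_pvar:
  "single m (1::'k::field) = (\<Prod>v\<in>keys m. pvar v ^ lookup m v)"
  by (simp add: pvar_power prod_single_one sum_single_lookup)

lemma lookup_single_mult: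
  "lookup (single (m :: 'v \<Rightarrow>\<^sub>0 nat) (1::'k::field) * p) (m + n) = lookup p n"
proof -
  have "lookup (single m (1::'k) * p) (m + n)
      = (\<Sum>l. lookup (single m (1::'k)) l * (\<Sum>q. lookup p q when m + n = l + q))"
    by (simp add: lookup_mult)
  also have "\<dots> = (\<Sum>l. (\<Sum>q. lookup p q when m + n = l + q) when l = m)"
    by (rule Sum_any.cong) (auto simp: lookup_single when_def)
  also have "\<dots> = (\<Sum>q. lookup p q when n = q)" by simp
  finally show ?thesis by simp
qed

text \<open>Multiplication by a variable shifts exponent vectors injectively, so nothing cancels and
  supports can be compared monomial by monomial. On complexes this is the closed star of
  \<open>x\<close>.\<close>

lemma colon_pvar:
  assumes "x \<in> V"
  shows "colon (polys V) (face_ideal V N) (pvar x) = face_ideal V {s. insert x s \<in> N}"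
proof (intro equalityI subsetI)
  fix p :: "('a \<Rightarrow>\<^sub>0 nat) \<Rightarrow>\<^sub>0 'b"
  assume "p \<in> colon (polys V) (face_ideal V N) (pvar x)"
  hence p: "p \<in> polys V" "pvar x * p \<in> face_ideal V N" by (auto simp: colon_def)
  show "p \<in> face_ideal V {s. insert x s \<in> N}"
    unfolding face_ideal_def
  proof (intro CollectI ballI)
    fix m assume m: "m \<in> keys p"
    hence "single x 1 + m \<in> keys (pvar x * p)"
      by (simp add: pvar_def in_keys_iff lookup_single_mult)
    hence "keys (single x 1 + m) \<in> N" using p(2) unfolding face_ideal_def by blast
    thus "keys m \<subseteq> V \<and> keys m \<in> {s. insert x s \<in> N}"
      using p(1) m by (auto simp: keys_add_nat polys_def)
  qed
next
  fix p :: "('a \<Rightarrow>\<^sub>0 nat) \<Rightarrow>\<^sub>0 'b"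
  assume p: "p \<in> face_ideal V {s. insert x s \<in> N}"
  have "keys m \<subseteq> V \<and> keys m \<in> N" if "m \<in> keys (pvar x * p)" for m
  proof -
    obtain n where "m = single x 1 + n" "n \<in> keys p"
      using keys_mult[of "pvar x" p] \<open>m \<in> keys (pvar x * p)\<close> by (auto simp: pvar_def)
    thus ?thesis
      using p assms by (auto simp: face_ideal_def keys_add_nat)
  qed
  thus "p \<in> colon (polys V) (face_ideal V N) (pvar x)"
    using p by (auto simp: colon_def face_ideal_def polys_def)
qed

text \<open>A monomial that contains \<open>x\<close> is a multiple of the variable, and every other
  monomial was already in the old ideal. On complexes this is the deletion of
  \<open>x\<close>.\<close>

lemma add_gen_pvar:
  assumes "x \<in> V" "upset N"
  shows "add_gen (polys V) (face_ideal V N) (pvar x) = face_ideal V (N \<union> {s. x \<in> s})"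
    (is "?J = face_ideal V ?N")
proof
  have "upset ?N" using assms(2) unfolding upset_def by blast
  thus "?J \<subseteq> face_ideal V ?N"
    by (intro add_gen_minimal ideal_in_face_ideal)
      (use assms in \<open>auto simp: face_ideal_def pvar_def\<close>)
  show "face_ideal V ?N \<subseteq> ?J"
  proof
    fix p :: "('a \<Rightarrow>\<^sub>0 nat) \<Rightarrow>\<^sub>0 'b"
    assume p: "p \<in> face_ideal V ?N"
    have J: "ideal_in (polys V) ?J"
      by (rule ideal_in_add_gen[OF subring_polys ideal_in_face_ideal[OF assms(2)] pvar_in_polys[OF assms(1)]])
    show "p \<in> ?J"
    proof (rule mem_by_monomials)
      fix m assume m: "m \<in> keys p"
      show "single m (lookup p m) \<in> ?J"
      proof (cases "x \<in> keys m")
        case True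
        \<comment> \<open>Subtraction of exponents is truncated; it is exact here since
          \<open>x\<close> occurs in \<open>m\<close>.\<close>
        have "single x 1 + (m - single x 1) = m"
          by (rule poly_mapping_eqI)
            (use True in \<open>auto simp: lookup_add lookup_minus lookup_single when_def in_keys_iff\<close>)
        hence "single m (lookup p m) = 0 + pvar x * single (m - single x 1) (lookup p m)"
          by (simp add: pvar_def mult_single)
        moreover have "keys (m - single x 1) \<subseteq> keys m"
          by (auto simp: in_keys_iff lookup_minus)
        hence "single (m - single x 1) (lookup p m) \<in> polys V"
          using p m by (intro single_in_polys) (auto simp: face_ideal_def)
        ultimately show ?thesis
          using add_genI ideal_inD(2)[OF ideal_in_face_ideal[OF assms(2)]] by blast
      next
        case False
        hence "single m (lookup p m) \<in> face_ideal V N"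
          using p m by (auto simp: face_ideal_def)
        thus ?thesis by (rule add_gen_superset[OF subring_polys])
      qed
    qed (use ideal_inD[OF J] in auto)
  qed
qed

section \<open>Substitution homomorphisms\<close>

definition mono_subst :: "('v \<Rightarrow> ('w \<Rightarrow>\<^sub>0 nat) \<Rightarrow>\<^sub>0 'k::field) \<Rightarrow> ('v \<Rightarrow>\<^sub>0 nat) \<Rightarrow> ('w \<Rightarrow>\<^sub>0 nat) \<Rightarrow>\<^sub>0 'k" where
  "mono_subst \<sigma> m = (\<Prod>v\<in>keys m. \<sigma> v ^ lookup m v)"

definition poly_subst ::
  "('v \<Rightarrow> ('w \<Rightarrow>\<^sub>0 nat) \<Rightarrow>\<^sub>0 'k::field) \<Rightarrow> (('v \<Rightarrow>\<^sub>0 nat) \<Rightarrow>\<^sub>0 'k) \<Rightarrow> ('w \<Rightarrow>\<^sub>0 nat) \<Rightarrow>\<^sub>0 'k" where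
  "poly_subst \<sigma> p = (\<Sum>m\<in>keys p. single 0 (lookup p m) * mono_subst \<sigma> m)"

lemma mono_subst_superset:
  "finite A \<Longrightarrow> keys m \<subseteq> A \<Longrightarrow> mono_subst \<sigma> m = (\<Prod>v\<in>A. \<sigma> v ^ lookup m v)"
  unfolding mono_subst_def by (rule prod.mono_neutral_left) (auto simp: in_keys_iff)

lemma mono_subst_add: "mono_subst \<sigma> (m + n) = mono_subst \<sigma> m * mono_subst \<sigma> n"
proof -
  let ?A = "keys m \<union> keys n"
  have "finite ?A" "keys m \<subseteq> ?A" "keys n \<subseteq> ?A" "keys (m + n) \<subseteq> ?A"
    by (auto simp: keys_add_nat)
  thus ?thesis
    by (simp only: mono_subst_superset[of ?A] lookup_add power_add prod.distrib)
qed

lemma poly_subst_superset: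
  "finite A \<Longrightarrow> keys p \<subseteq> A \<Longrightarrow> poly_subst \<sigma> p = (\<Sum>m\<in>A. single 0 (lookup p m) * mono_subst \<sigma> m)"
  unfolding poly_subst_def by (rule sum.mono_neutral_left) (auto simp: in_keys_iff)

lemma poly_subst_add: "poly_subst \<sigma> (p + q) = poly_subst \<sigma> p + poly_subst \<sigma> q"
proof -
  let ?A = "keys p \<union> keys q"
  have "finite ?A" "keys p \<subseteq> ?A" "keys q \<subseteq> ?A" "keys (p + q) \<subseteq> ?A"
    using keys_add[of p q] by auto
  thus ?thesis
    by (simp only: poly_subst_superset[of ?A] lookup_add single_add distrib_right sum.distrib)
qed

lemma poly_subst_zero [simp]: "poly_subst \<sigma> 0 = 0"
  by (simp add: poly_subst_def)

lemma poly_subst_sum: "poly_subst \<sigma> (\<Sum>i\<in>A. f i) = (\<Sum>i\<in>A. poly_subst \<sigma> (f i))"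
  by (induction A rule: infinite_finite_induct) (auto simp: poly_subst_add)

lemma poly_subst_single: "poly_subst \<sigma> (single m c) = single 0 c * mono_subst \<sigma> m"
  by (simp add: poly_subst_def)

lemma poly_subst_mult:
  fixes \<sigma> :: "'v \<Rightarrow> ('w \<Rightarrow>\<^sub>0 nat) \<Rightarrow>\<^sub>0 'k::field"
  shows "poly_subst \<sigma> (p * q) = poly_subst \<sigma> p * poly_subst \<sigma> q"
proof -
  have monom: "poly_subst \<sigma> (single m a * single n b)
      = (single 0 a * mono_subst \<sigma> m) * (single 0 b * mono_subst \<sigma> n)" for m n a b
  proof -
    have "poly_subst \<sigma> (single m a * single n b) = single 0 (a * b) * (mono_subst \<sigma> m * mono_subst \<sigma> n)"
      by (simp only: mult_single poly_subst_single mono_subst_add)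
    also have "single 0 (a * b) = single 0 a * (single 0 b :: ('w \<Rightarrow>\<^sub>0 nat) \<Rightarrow>\<^sub>0 'k)"
      by (simp add: mult_single)
    finally show ?thesis by (simp only: mult_ac)
  qed
  have "poly_subst \<sigma> (p * q)
      = poly_subst \<sigma> ((\<Sum>m\<in>keys p. single m (lookup p m)) * (\<Sum>n\<in>keys q. single n (lookup q n)))"
    by (simp add: sum_single_lookup)
  also have "\<dots> = (\<Sum>m\<in>keys p. \<Sum>n\<in>keys q.
      (single 0 (lookup p m) * mono_subst \<sigma> m) * (single 0 (lookup q n) * mono_subst \<sigma> n))"
    unfolding sum_product poly_subst_sum
    by (intro sum.cong refl monom)
  also have "\<dots> = poly_subst \<sigma> p * poly_subst \<sigma> q"
    by (simp add: poly_subst_def sum_product)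
  finally show ?thesis .
qed

lemma poly_subst_pvar [simp]: "poly_subst \<sigma> (pvar v) = \<sigma> v"
  by (simp add: pvar_def poly_subst_single mono_subst_def)

lemma poly_subst_in_polys:
  assumes "\<And>v. v \<in> V \<Longrightarrow> \<sigma> v \<in> polys W" "p \<in> polys V"
  shows "poly_subst \<sigma> p \<in> polys W"
  using assms unfolding poly_subst_def mono_subst_def
  by (intro sum_in_polys polys_closed(4) const_in_polys prod_in_polys polys_closed(7)) (auto simp: polys_def)

lemma mult_cong_mod:
  assumes "ideal_in C I" "subring_set C" "a \<in> C" "d \<in> C" "a - b \<in> I" "c - d \<in> I"
  shows "a * c - b * d \<in> I"
proof -
  have "a * c - b * d = (c - d) * a + (a - b) * d" by (simp add: algebra_simps)
  also have "\<dots> \<in> I"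
    by (intro ideal_inD(3,4)[OF assms(1)] assms)
  finally show ?thesis .
qed

lemma power_cong_mod:
  assumes "ideal_in C I" "subring_set C" "a \<in> C" "b \<in> C" "a - b \<in> I"
  shows "a ^ k - b ^ k \<in> I"
proof (induction k)
  case (Suc k)
  thus ?case
    using mult_cong_mod[OF assms(1,2,3) subring_setD(7)[OF assms(2,4)] assms(5) Suc] by simp
qed (simp add: ideal_inD(2)[OF assms(1)])

lemma prod_cong_mod:
  assumes "ideal_in C I" "subring_set C" "finite A"
    and "\<And>i. i \<in> A \<Longrightarrow> a i \<in> C" "\<And>i. i \<in> A \<Longrightarrow> b i \<in> C" "\<And>i. i \<in> A \<Longrightarrow> a i - b i \<in> I"
  shows "(\<Prod>i\<in>A. a i) - (\<Prod>i\<in>A. b i) \<in> I"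
proof -
  have "(\<Prod>i\<in>A. a i) - (\<Prod>i\<in>A. b i) \<in> I \<and> (\<Prod>i\<in>A. b i) \<in> C"
    using assms(3-6)
  proof (induction A)
    case (insert x A)
    hence "(\<Prod>i\<in>A. a i) - (\<Prod>i\<in>A. b i) \<in> I" "(\<Prod>i\<in>A. b i) \<in> C" by auto
    thus ?case
      using mult_cong_mod[OF assms(1,2), of "a x" "prod b A" "b x" "prod a A"]
        subring_setD(4)[OF assms(2)] insert by simp
  qed (simp add: ideal_inD(2)[OF assms(1)] subring_setD(1)[OF assms(2)])
  thus ?thesis ..
qed

text \<open>This turns a substitution into a normal form: if it also sends the ideal to 0, then the
  ideal is exactly its kernel in \<open>polys V\<close>, and questions modulo the ideal become
  questions about polynomials.\<close>

lemma poly_subst_cong_mod: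
  assumes I: "ideal_in (polys V) I" and p: "p \<in> polys V"
    and "\<And>v. v \<in> V \<Longrightarrow> \<sigma> v \<in> polys V" "\<And>v. v \<in> V \<Longrightarrow> pvar v - \<sigma> v \<in> I"
  shows "p - poly_subst \<sigma> p \<in> I"
proof -
  have "p - poly_subst \<sigma> p
      = (\<Sum>m\<in>keys p. single m (lookup p m)) - (\<Sum>m\<in>keys p. single 0 (lookup p m) * mono_subst \<sigma> m)"
    by (simp add: sum_single_lookup poly_subst_def)
  also have "\<dots> = (\<Sum>m\<in>keys p. (single m 1 - mono_subst \<sigma> m) * single 0 (lookup p m))"
    unfolding sum_subtractf[symmetric]
    by (intro sum.cong refl) (simp add: algebra_simps mult_single)
  also have "\<dots> \<in> I"
  proof (intro ideal_in_sum[OF I] ideal_inD(4)[OF I] const_in_polys)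
    fix m assume "m \<in> keys p"
    hence m: "v \<in> V" if "v \<in> keys m" for v using p that by (auto simp: polys_def)
    show "single m 1 - mono_subst \<sigma> m \<in> I"
      unfolding single_eq_prod_pvar mono_subst_def
      by (intro prod_cong_mod[OF I subring_polys] power_cong_mod[OF I subring_polys])
        (auto intro: polys_closed(7) pvar_in_polys m assms)
  qed
  finally show ?thesis .
qed

section \<open>Primes generated by variables, in the form
  \<open>face_ideal V (hits X)\<close>\<close>

definition hits :: "'v set \<Rightarrow> 'v set set" where
  "hits X = {s. s \<inter> X \<noteq> {}}"

lemma upset_hits: "upset (hits X)"
  by (auto simp: upset_def hits_def)

lemma ideal_in_var: "ideal_in (polys V) (face_ideal V (hits X))"
  by (rule ideal_in_face_ideal[OF upset_hits])

lemma pvar_in_var_ideal: "v \<in> V \<Longrightarrow> v \<in> X \<Longrightarrow> pvar v \<in> face_ideal V (hits X)"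
  by (auto simp: face_ideal_def hits_def pvar_def)

lemma poly_subst_var_ideal:
  assumes "\<And>v. v \<in> X \<Longrightarrow> \<sigma> v = 0" "p \<in> face_ideal V (hits X)"
  shows "poly_subst \<sigma> p = 0"
  unfolding poly_subst_def
proof (rule sum.neutral, rule ballI)
  fix m assume "m \<in> keys p"
  then obtain v where "v \<in> keys m" "v \<in> X"
    using assms(2) by (auto simp: face_ideal_def hits_def)
  moreover have "\<sigma> v ^ lookup m v = 0"
    using assms(1) calculation by (simp add: in_keys_iff zero_power)
  ultimately have "mono_subst \<sigma> m = 0"
    unfolding mono_subst_def by (intro prod_zero) auto
  thus "single 0 (lookup p m) * mono_subst \<sigma> m = 0" by simp
qed

definition kill :: "'v set \<Rightarrow> (('v \<Rightarrow>\<^sub>0 nat) \<Rightarrow>\<^sub>0 'k::field) \<Rightarrow> ('v \<Rightarrow>\<^sub>0 nat) \<Rightarrow>\<^sub>0 'k" where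
  "kill X = poly_subst (\<lambda>v. if v \<in> X then 0 else pvar v)"

lemma kill_in_polys: "p \<in> polys V \<Longrightarrow> kill X p \<in> polys (V - X)"
  unfolding kill_def by (rule poly_subst_in_polys) (auto intro: pvar_in_polys polys_closed(2))

lemma kill_cong_mod: "p \<in> polys V \<Longrightarrow> p - kill X p \<in> face_ideal V (hits X)"
  unfolding kill_def
  by (rule poly_subst_cong_mod[OF ideal_in_var])
    (auto intro: pvar_in_polys polys_closed(2) pvar_in_var_ideal ideal_inD(2)[OF ideal_in_var])

lemma kill_eq_0_iff:
  assumes "p \<in> polys V"
  shows "kill X p = 0 \<longleftrightarrow> p \<in> face_ideal V (hits X)"
proof
  assume "kill X p = 0"
  thus "p \<in> face_ideal V (hits X)" using kill_cong_mod[OF assms, of X] by simp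
next
  assume "p \<in> face_ideal V (hits X)"
  thus "kill X p = 0" unfolding kill_def by (rule poly_subst_var_ideal[rotated]) simp
qed

text \<open>The ideal is the kernel of \<open>kill X\<close>, whose values are polynomials. The
  linear order on the variables orders the exponent vectors, and this excludes zero
  divisors.\<close>

lemma var_ideal_prime:
  fixes p q :: "('v::linorder \<Rightarrow>\<^sub>0 nat) \<Rightarrow>\<^sub>0 'k::field"
  assumes "p \<in> polys V" "q \<in> polys V" "p * q \<in> face_ideal V (hits X)"
  shows "p \<in> face_ideal V (hits X) \<or> q \<in> face_ideal V (hits X)"
proof -
  have "kill X p * kill X q = kill X (p * q)"
    by (simp add: kill_def poly_subst_mult)
  also have "\<dots> = 0"
    using assms kill_eq_0_iff polys_closed(4) by blast
  finally show ?thesis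
    using kill_eq_0_iff assms by auto
qed

section \<open>Algebraic relations and sums of variables\<close>

lemma ideal_in_add_gens:
  assumes "subring_set C" "ideal_in C I" "set fs \<subseteq> C"
  shows "ideal_in C (add_gens C I fs)"
  using assms(2,3)
proof (induction fs arbitrary: I)
  case (Cons f fs)
  thus ?case using ideal_in_add_gen[OF assms(1)] by simp
qed simp

lemma add_gens_superset:
  assumes "subring_set C"
  shows "I \<subseteq> add_gens C I fs"
proof (induction fs arbitrary: I)
  case (Cons f fs)
  thus ?case using add_gen_superset[OF assms] by (metis add_gens.simps(2) subset_iff)
qed simp

lemma set_subset_add_gens:
  assumes "subring_set C" "ideal_in C I" "set fs \<subseteq> C"
  shows "set fs \<subseteq> add_gens C I fs"
  using assms(2,3)
proof (induction fs arbitrary: I)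
  case (Cons f fs)
  have "f \<in> add_gen C I f"
    using mem_add_gen_self[OF assms(1) Cons.prems(1) subring_setD(1)[OF assms(1)], of f] by simp
  hence "f \<in> add_gens C I (f # fs)"
    using add_gens_superset[OF assms(1), of "add_gen C I f" fs] by auto
  moreover have "set fs \<subseteq> add_gens C I (f # fs)"
    using Cons ideal_in_add_gen[OF assms(1) Cons.prems(1)] by simp
  ultimately show ?case by simp
qed simp

lemma weakly_regular_iff:
  "weakly_regular C I fs \<longleftrightarrow>
     (\<forall>i<length fs. \<forall>z\<in>C. fs ! i * z \<in> add_gens C I (take i fs) \<longrightarrow> z \<in> add_gens C I (take i fs))"
  by (induction fs arbitrary: I) (simp_all add: All_less_Suc2)

text \<open>Every block has a variable outside \<open>X\<close>, so modulo (X) the sums are nonzero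
  linear forms in disjoint sets of variables. Solving the earlier forms for one variable each
  identifies the quotient with a polynomial ring, in which the next form stays nonzero.\<close>

lemma weakly_regular_block_sums:
  fixes W :: "'l \<Rightarrow> 'v::linorder set"
  assumes "distinct ls" and fin: "\<And>l. l \<in> set ls \<Longrightarrow> finite (W l)"
    and sub: "\<And>l. l \<in> set ls \<Longrightarrow> W l \<subseteq> V" and free: "\<And>l. l \<in> set ls \<Longrightarrow> \<not> W l \<subseteq> X"
    and disj: "\<And>l l'. l \<in> set ls \<Longrightarrow> l' \<in> set ls \<Longrightarrow> l \<noteq> l' \<Longrightarrow> W l \<inter> W l' = {}"
  shows "weakly_regular (polys V) (face_ideal V (hits X) :: (('v \<Rightarrow>\<^sub>0 nat) \<Rightarrow>\<^sub>0 'k::field) set)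
    (map (\<lambda>l. \<Sum>u\<in>W l. pvar u) ls)"
  unfolding weakly_regular_iff
proof (intro allI impI ballI)
  let ?s = "\<lambda>l. \<Sum>u\<in>W l. pvar u :: ('v \<Rightarrow>\<^sub>0 nat) \<Rightarrow>\<^sub>0 'k"
  let ?fs = "map ?s ls"
  define t :: "'l \<Rightarrow> ('v \<Rightarrow>\<^sub>0 nat) \<Rightarrow>\<^sub>0 'k" where "t l = (\<Sum>u\<in>W l - X. pvar u)" for l
  let ?I = "face_ideal V (hits X) :: (('v \<Rightarrow>\<^sub>0 nat) \<Rightarrow>\<^sub>0 'k) set"
  fix i z
  assume i: "i < length ?fs" and z: "z \<in> polys V"
    and mem: "?fs ! i * z \<in> add_gens (polys V) ?I (take i ?fs)"
  define J where "J = add_gens (polys V) ?I (take i ?fs)"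
  define L where "L = set (take i ls)"
  have L: "L \<subseteq> set ls" "finite L" by (auto simp: L_def dest: in_set_takeD)
  have li: "ls ! i \<in> set ls" using i by simp
  have "ls ! i \<notin> L"
    using \<open>distinct ls\<close> i by (auto simp: L_def in_set_conv_nth nth_eq_iff_index_eq)
  have "\<forall>l\<in>set ls. \<exists>u. u \<in> W l - X"
    using free by blast
  from bchoice[OF this] obtain r where r: "\<And>l. l \<in> set ls \<Longrightarrow> r l \<in> W l - X"
    by blast
  have s_in: "?s l \<in> polys V" "t l \<in> polys V" if "l \<in> set ls" for l
    using sub[OF that] by (auto intro!: sum_in_polys pvar_in_polys simp: t_def)
  have fs: "set (take i ?fs) \<subseteq> polys V"
    using s_in L by (auto simp: L_def take_map)
  have J: "ideal_in (polys V) J"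
    unfolding J_def by (rule ideal_in_add_gens[OF subring_polys ideal_in_var fs])
  have "?I \<subseteq> J"
    unfolding J_def by (rule add_gens_superset[OF subring_polys])
  have sJ: "?s l \<in> J" if "l \<in> L" for l
    using set_subset_add_gens[OF subring_polys ideal_in_var fs, of X] that
    by (auto simp: J_def L_def take_map)
  have s_split: "?s l = t l + (\<Sum>u\<in>W l \<inter> X. pvar u)" if "l \<in> set ls" for l
    unfolding t_def by (subst sum.Int_Diff[OF fin[OF that], of _ X]) (rule add.commute)
  have tJ: "t l \<in> J" if "l \<in> L" for l
  proof -
    have "(\<Sum>u\<in>W l \<inter> X. pvar u) \<in> J"
      using sub[of l] L that \<open>?I \<subseteq> J\<close> by (intro ideal_in_sum[OF J]) (blast intro: pvar_in_var_ideal)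
    from ideal_in_diff[OF subring_polys J sJ[OF that] this] show ?thesis
      using s_split[of l] L(1) that by auto
  qed
  \<comment> \<open>For an earlier block the representative \<open>r l\<close> is replaced by minus
    the sum of the other free variables, hence \<open>t l\<close> maps to 0. The blocks are
    disjoint, so at most one term of the inner sum is nonzero.\<close>
  define \<sigma> where "\<sigma> v = (if v \<in> X then 0 else pvar v - (\<Sum>l\<in>L. if v = r l then t l else 0))" for v
  have sigma_in: "\<sigma> v \<in> polys V" if "v \<in> V" for v
    unfolding \<sigma>_def using that s_in L
    by (auto intro!: polys_closed(3) pvar_in_polys sum_in_polys polys_closed(2))
  have sigma_cong: "pvar v - \<sigma> v \<in> J" if "v \<in> V" for v
    using pvar_in_var_ideal[OF that, of X] \<open>?I \<subseteq> J\<close> tJ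
    by (auto simp: \<sigma>_def intro!: ideal_in_sum[OF J] ideal_inD(2)[OF J])
  have sum_sigma: "poly_subst \<sigma> (?s l) = t l - (if l \<in> L then t l else 0)" if l: "l \<in> set ls" for l
  proof -
    have uniq: "r l' \<in> W l - X \<longleftrightarrow> l' = l" if "l' \<in> L" for l'
    proof (cases "l' = l")
      case False
      hence "W l' \<inter> W l = {}" "r l' \<in> W l'"
        using disj[of l' l] r[of l'] l that L(1) by auto
      thus ?thesis using False by blast
    qed (use r[OF l] in simp)
    have "poly_subst \<sigma> (?s l) = (\<Sum>u\<in>W l. \<sigma> u)"
      by (simp add: poly_subst_sum)
    also have "\<dots> = (\<Sum>u\<in>W l - X. \<sigma> u)"
      by (rule sum.mono_neutral_right) (auto simp: \<sigma>_def fin l)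
    also have "\<dots> = t l - (\<Sum>u\<in>W l - X. \<Sum>l'\<in>L. if u = r l' then t l' else 0)"
      by (simp add: t_def \<sigma>_def sum_subtractf)
    also have "(\<Sum>u\<in>W l - X. \<Sum>l'\<in>L. if u = r l' then t l' else 0)
        = (\<Sum>l'\<in>L. \<Sum>u\<in>W l - X. if u = r l' then t l' else 0)"
      by (rule sum.swap)
    also have "\<dots> = (\<Sum>l'\<in>L. if l' = l then t l' else 0)"
      by (rule sum.cong) (use uniq fin l in \<open>auto simp: sum.delta\<close>)
    also have "\<dots> = (if l \<in> L then t l else 0)"
      using L by (simp add: sum.delta)
    finally show ?thesis .
  qed
  \<comment> \<open>Together with \<open>sigma_cong\<close> this makes \<open>J\<close> the kernel
    of the substitution.\<close>
  have kernel: "poly_subst \<sigma> p = 0" if "p \<in> J" for p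
  proof -
    let ?K = "{p \<in> polys V. poly_subst \<sigma> p = 0}"
    have "ideal_in (polys V) ?K"
      by (auto simp: ideal_in_def poly_subst_add poly_subst_mult intro: polys_closed)
    moreover have "?I \<subseteq> ?K"
      using poly_subst_var_ideal[of X \<sigma>] ideal_inD(1)[OF ideal_in_var] by (auto simp: \<sigma>_def)
    moreover have "set (take i ?fs) \<subseteq> ?K"
      using sum_sigma s_in L by (auto simp: take_map L_def[symmetric])
    ultimately have "J \<subseteq> ?K"
      unfolding J_def by (rule add_gens_minimal)
    thus ?thesis using that by blast
  qed
  have "t (ls ! i) \<noteq> 0"
  proof
    assume "t (ls ! i) = 0"
    hence "lookup (t (ls ! i)) (single (r (ls ! i)) 1) = 0" by simp
    also have "lookup (t (ls ! i)) (single (r (ls ! i)) 1)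
        = (\<Sum>u\<in>W (ls ! i) - X. if u = r (ls ! i) then 1 else 0)"
      unfolding t_def lookup_sum
      by (intro sum.cong refl) (auto simp: pvar_def lookup_single when_def dest: arg_cong[of _ _ keys])
    also have "\<dots> = 1"
      using r[OF li] fin[OF li] by (simp add: sum.delta)
    finally show False by simp
  qed
  moreover have "poly_subst \<sigma> (?s (ls ! i)) * poly_subst \<sigma> z = 0"
    using kernel[of "?s (ls ! i) * z"] mem i by (simp add: J_def poly_subst_mult)
  ultimately have "poly_subst \<sigma> z = 0"
    using sum_sigma[OF li] \<open>ls ! i \<notin> L\<close> by simp
  thus "z \<in> add_gens (polys V) ?I (take i ?fs)"
    using poly_subst_cong_mod[OF J z sigma_in sigma_cong] by (simp add: J_def)
qed

section \<open>Algebraic dependence by counting monomials\<close>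

lemma linear_relation:
  fixes f :: "'i \<Rightarrow> ('v \<Rightarrow>\<^sub>0 nat) \<Rightarrow>\<^sub>0 'k::field"
  assumes "finite A" "finite B" "\<And>i. i \<in> A \<Longrightarrow> keys (f i) \<subseteq> B" "card B < card A"
  obtains c where "\<exists>i\<in>A. c i \<noteq> 0" "(\<Sum>i\<in>A. single 0 (c i) * f i) = 0"
proof (cases "inj_on f A")
  case True
  interpret vs: vector_space "\<lambda>c p. single 0 (c::'k) * (p :: ('v \<Rightarrow>\<^sub>0 nat) \<Rightarrow>\<^sub>0 'k)"
    by unfold_locales (auto simp: algebra_simps single_add mult_single)
  let ?S = "(\<lambda>b. single b (1::'k)) ` B"
  have span: "f i \<in> vs.span ?S" if "i \<in> A" for i
  proof -
    have "(\<Sum>m\<in>keys (f i). single 0 (lookup (f i) m) * single m 1) \<in> vs.span ?S"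
      using assms(3)[OF that] by (intro vs.span_sum vs.span_scale vs.span_base) auto
    thus ?thesis by (simp add: mult_single sum_single_lookup)
  qed
  have card: "card ?S < card (f ` A)"
    using card_image_le[OF assms(2), of "\<lambda>b. single b (1::'k)"] card_image[OF True] assms(4) by simp
  have "vs.dependent (f ` A)"
  proof (rule ccontr)
    assume "\<not> vs.dependent (f ` A)"
    moreover have "finite ?S" "f ` A \<subseteq> vs.span ?S"
      using assms(2) span by auto
    ultimately have "card (f ` A) \<le> card ?S"
      using vs.independent_span_bound by blast
    thus False using card by simp
  qed
  then obtain u where u: "\<exists>v\<in>f ` A. u v \<noteq> 0" "(\<Sum>v\<in>f ` A. single 0 (u v) * v) = 0"
    using vs.dependent_finite[of "f ` A"] assms(1) by auto
  thus ?thesis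
    using that[of "u \<circ> f"] by (auto simp: sum.reindex[OF True])
next
  case False
  then obtain i j where ij: "i \<in> A" "j \<in> A" "i \<noteq> j" "f i = f j"
    by (auto simp: inj_on_def)
  \<comment> \<open>\<open>dependent\<close> speaks of sets and would not see a repeated polynomial;
    two equal ones are related by the coefficients 1 and -1.\<close>
  define c where "c l = (if l = i then 1 else if l = j then - 1 else 0 :: 'k)" for l
  have "(\<Sum>l\<in>A. single 0 (c l) * f l) = (\<Sum>l\<in>{i, j}. single 0 (c l) * f l)"
    using ij assms(1) by (intro sum.mono_neutral_right) (auto simp: c_def)
  also have "\<dots> = 0"
    using ij by (simp add: c_def single_uminus)
  finally show ?thesis
    using ij(1) by (intro that[of c] bexI[of _ i]) (auto simp: c_def)
qed

text \<open>Every exponent is bounded separately, in place of the total degree, so that the number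
  of monomials is at most a plain power.\<close>

definition deg_bound :: "'v set \<Rightarrow> nat \<Rightarrow> ('v \<Rightarrow>\<^sub>0 nat) set" where
  "deg_bound F d = {m. keys m \<subseteq> F \<and> (\<forall>v. lookup m v \<le> d)}"

lemma deg_bound_finite_card:
  assumes "finite F"
  shows "finite (deg_bound F d) \<and> card (deg_bound F d) \<le> (d + 1) ^ card F"
proof -
  let ?h = "\<lambda>m. restrict (lookup m) F"
  have inj: "inj_on ?h (deg_bound F d)"
  proof (intro inj_onI poly_mapping_eqI)
    fix m n v assume mn: "m \<in> deg_bound F d" "n \<in> deg_bound F d" "?h m = ?h n"
    show "lookup m v = lookup n v"
    proof (cases "v \<in> F")
      case True
      thus ?thesis using fun_cong[OF mn(3), of v] by simp
    next
      case False
      hence "v \<notin> keys m" "v \<notin> keys n" using mn by (auto simp: deg_bound_def)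
      thus ?thesis by (simp add: in_keys_iff)
    qed
  qed
  have sub: "?h ` deg_bound F d \<subseteq> F \<rightarrow>\<^sub>E {..d}"
    by (auto simp: deg_bound_def)
  have "finite (F \<rightarrow>\<^sub>E {..d})"
    using assms by (intro finite_PiE) auto
  thus ?thesis
    using inj_on_finite[OF inj sub] card_inj_on_le[OF inj sub] assms by (simp add: card_PiE)
qed

lemma deg_bound_mono: "d \<le> e \<Longrightarrow> deg_bound F d \<subseteq> deg_bound F e"
  by (auto simp: deg_bound_def intro: order_trans)

lemma keys_mult_deg_bound:
  assumes "keys p \<subseteq> deg_bound F d" "keys q \<subseteq> deg_bound F e"
  shows "keys (p * q) \<subseteq> deg_bound F (d + e)"
proof
  fix m assume "m \<in> keys (p * q)"
  then obtain a b where "m = a + b" "a \<in> keys p" "b \<in> keys q"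
    using keys_mult[of p q] by blast
  thus "m \<in> deg_bound F (d + e)"
    using assms by (auto simp: deg_bound_def keys_add_nat lookup_add intro!: add_mono)
qed

lemma keys_power_deg_bound:
  fixes p :: "('v \<Rightarrow>\<^sub>0 nat) \<Rightarrow>\<^sub>0 'k::field"
  assumes "keys p \<subseteq> deg_bound F d"
  shows "keys (p ^ k) \<subseteq> deg_bound F (k * d)"
proof (induction k)
  case (Suc k)
  show ?case using keys_mult_deg_bound[OF assms Suc] by simp
qed (simp add: deg_bound_def)

lemma ex_deg_bound:
  assumes "p \<in> polys F"
  shows "\<exists>d. keys p \<subseteq> deg_bound F d"
proof (intro exI subsetI)
  fix m assume m: "m \<in> keys p"
  let ?d = "\<Sum>m\<in>keys p. \<Sum>v\<in>keys m. lookup m v"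
  have "lookup m v \<le> ?d" for v
  proof (cases "v \<in> keys m")
    case True
    have "lookup m v \<le> (\<Sum>v\<in>keys m. lookup m v)"
      using True by (intro member_le_sum) auto
    also have "\<dots> \<le> ?d"
      using m by (intro member_le_sum) auto
    finally show ?thesis .
  qed (simp add: in_keys_iff)
  thus "m \<in> deg_bound F ?d"
    using assms m by (auto simp: deg_bound_def polys_def)
qed

lemma ex_deg_bound_list:
  assumes "set fs \<subseteq> polys F"
  shows "\<exists>d. \<forall>f\<in>set fs. keys f \<subseteq> deg_bound F d"
  using assms
proof (induction fs)
  case (Cons f fs)
  then obtain d e where "\<forall>f\<in>set fs. keys f \<subseteq> deg_bound F d" "keys f \<subseteq> deg_bound F e"
    using ex_deg_bound[of f F] by auto
  thus ?case
    using deg_bound_mono[of d "max d e" F] deg_bound_mono[of e "max d e" F]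
    by (intro exI[of _ "max d e"]) auto
qed simp

fun list_power :: "'a::comm_ring_1 list \<Rightarrow> nat list \<Rightarrow> 'a" where
  "list_power (f # fs) (a # as) = f ^ a * list_power fs as"
| "list_power _ _ = 1"

lemma list_power_in_polys: "set fs \<subseteq> polys V \<Longrightarrow> list_power fs as \<in> polys V"
  by (induction fs as rule: list_power.induct) (auto intro: polys_closed)

lemma keys_list_power_deg_bound:
  assumes "\<forall>f\<in>set fs. keys (f :: ('v \<Rightarrow>\<^sub>0 nat) \<Rightarrow>\<^sub>0 'k::field) \<subseteq> deg_bound F d" "set as \<subseteq> {..N}"
  shows "keys (list_power fs as) \<subseteq> deg_bound F (length fs * (N * d))"
  using assms
proof (induction fs as rule: list_power.induct)
  case (1 f fs a as)
  have "keys (f ^ a) \<subseteq> deg_bound F (N * d)"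
    using keys_power_deg_bound[of f F d a] deg_bound_mono[of "a * d" "N * d" F] 1(2,3)
    by (auto intro!: mult_le_mono1)
  thus ?case
    using keys_mult_deg_bound[of "f ^ a" F "N * d" "list_power fs as"] 1 by simp
qed (auto simp: deg_bound_def)

text \<open>The right side counts products of \<open>r\<close> polynomials with exponents up to
  \<open>N\<close>; the left side bounds the number of monomials in \<open>d\<close> variables that
  can occur in them, when \<open>D\<close> bounds the exponents within each polynomial.\<close>

lemma ex_power_gt: "d < r \<Longrightarrow> \<exists>N::nat. (r * (N * D) + 1) ^ d < (N + 1) ^ r"
proof -
  assume "d < r"
  \<comment> \<open>With this \<open>N\<close> the factor \<open>(r * D + 1) ^ d\<close> split off
    below is \<open>N\<close> itself, and one more factor \<open>N + 1\<close> beats it.\<close>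
  define N where "N = (r * D + 1) ^ d"
  have "(r * (N * D) + 1) ^ d \<le> ((r * D + 1) * (N + 1)) ^ d"
    by (intro power_mono) (auto simp: algebra_simps)
  also have "\<dots> = N * (N + 1) ^ d"
    unfolding power_mult_distrib by (simp only: N_def)
  also have "\<dots> < (N + 1) ^ Suc d" by simp
  also have "\<dots> \<le> (N + 1) ^ r"
    using \<open>d < r\<close> by (intro power_increasing) auto
  finally show ?thesis by blast
qed

text \<open>Let \<open>a\<close> be the lowest exponent of the head that occurs. The terms with this
  exponent give a nontrivial combination in the tail, and all others are divisible by f^(a+1), so
  they go into the summand \<open>f * h\<close> of the nested form.\<close>

lemma nest_of_relation:
  fixes c :: "nat list \<Rightarrow> 'k::field" and fs :: "(('v \<Rightarrow>\<^sub>0 nat) \<Rightarrow>\<^sub>0 'k) list"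
  assumes "finite A" "\<And>as. as \<in> A \<Longrightarrow> length as = length fs" "\<exists>as\<in>A. c as \<noteq> 0" "set fs \<subseteq> polys V"
  shows "\<exists>k g. k \<noteq> 0 \<and> g \<in> nest (polys V) fs \<and>
    (\<Sum>as\<in>A. single 0 (c as) * list_power fs as) = single 0 k * g"
  using assms
proof (induction fs arbitrary: A c)
  case Nil
  hence "A = {[]}" by auto
  thus ?case using Nil by auto
next
  case (Cons f fs)
  \<comment> \<open>Zero coefficients are dropped so that the minimum below is attained by a term
    that really occurs.\<close>
  define A' where "A' = {as \<in> A. c as \<noteq> 0}"
  define a where "a = Min (hd ` A')"
  define B where "B = {bs. a # bs \<in> A'}"
  define D where "D = {as \<in> A'. a < hd as}"
  have fin: "finite A'" and ne: "A' \<noteq> {}"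
    using Cons.prems by (auto simp: A'_def)
  have len: "\<exists>b bs. as = b # bs \<and> length bs = length fs" if "as \<in> A'" for as
    using Cons.prems(2)[of as] that by (cases as) (auto simp: A'_def)
  have a_le: "a \<le> hd as" if "as \<in> A'" for as
    using fin that by (simp add: a_def)
  have "a \<in> hd ` A'"
    unfolding a_def using fin ne by (intro Min_in) auto
  then obtain bs0 where "a # bs0 \<in> A'"
    using len by force
  have "(#) a ` B \<subseteq> A'" by (auto simp: B_def)
  hence finB: "finite B"
    using finite_imageD[OF finite_subset[OF _ fin], of "(#) a" B] by simp
  have "\<exists>k g. k \<noteq> 0 \<and> g \<in> nest (polys V) fs \<and>
      (\<Sum>bs\<in>B. single 0 (c (a # bs)) * list_power fs bs) = single 0 k * g"
  proof (rule Cons.IH[OF finB])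
    show "length bs = length fs" if "bs \<in> B" for bs
      using len[of "a # bs"] that by (auto simp: B_def)
    show "\<exists>bs\<in>B. c (a # bs) \<noteq> 0"
      using \<open>a # bs0 \<in> A'\<close> by (auto simp: B_def A'_def)
  qed (use Cons.prems in auto)
  then obtain k g where kg: "k \<noteq> 0" "g \<in> nest (polys V) fs"
    "(\<Sum>bs\<in>B. single 0 (c (a # bs)) * list_power fs bs) = single 0 k * g" by blast
  define H where "H = (\<Sum>as\<in>D. single 0 (c as) * (f ^ (hd as - a - 1) * list_power fs (tl as)))"
  have H: "H \<in> polys V"
    unfolding H_def using Cons.prems(4)
    by (intro sum_in_polys polys_closed(4,7) const_in_polys list_power_in_polys) auto
  have "(\<Sum>as\<in>A. single 0 (c as) * list_power (f # fs) as)
      = (\<Sum>as\<in>A'. single 0 (c as) * list_power (f # fs) as)"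
    unfolding A'_def by (rule sum.mono_neutral_right) (use Cons.prems in auto)
  also have "A' = (#) a ` B \<union> D"
  proof (intro equalityI subsetI)
    fix as assume as: "as \<in> A'"
    then obtain b bs where b: "as = b # bs" using len by blast
    hence "a = b \<or> a < b" using a_le[OF as] by auto
    thus "as \<in> (#) a ` B \<union> D" using as b by (auto simp: B_def D_def)
  qed (auto simp: B_def D_def)
  also have "(\<Sum>as\<in>\<dots>. single 0 (c as) * list_power (f # fs) as)
      = (\<Sum>as\<in>(#) a ` B. single 0 (c as) * list_power (f # fs) as)
        + (\<Sum>as\<in>D. single 0 (c as) * list_power (f # fs) as)"
    by (rule sum.union_disjoint) (use fin finB in \<open>auto simp: D_def\<close>)
  also have "(\<Sum>as\<in>(#) a ` B. single 0 (c as) * list_power (f # fs) as) = f ^ a * (single 0 k * g)"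
    unfolding kg(3)[symmetric] sum_distrib_left by (simp add: sum.reindex mult_ac)
  also have "(\<Sum>as\<in>D. single 0 (c as) * list_power (f # fs) as) = f ^ a * (f * H)"
    unfolding H_def sum_distrib_left
  proof (rule sum.cong[OF refl])
    fix as assume as: "as \<in> D"
    then obtain b bs where b: "as = b # bs" "a < b"
      using len[of as] by (auto simp: D_def)
    from b(2) obtain e where e: "b = Suc (a + e)"
      using less_imp_Suc_add by blast
    show "single 0 (c as) * list_power (f # fs) as
        = f ^ a * (f * (single 0 (c as) * (f ^ (hd as - a - 1) * list_power fs (tl as))))"
      by (simp add: b(1) e power_add mult_ac)
  qed
  also have "f ^ a * (single 0 k * g) + f ^ a * (f * H)
      = single 0 k * (f ^ a * (g + f * (single 0 (1 / k) * H)))"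
  proof -
    \<comment> \<open>The constant \<open>k\<close> is a unit and is pulled out of the higher terms
      as well, since the nested form must end in 1.\<close>
    have "single 0 k * (single 0 (1 / k) :: ('v \<Rightarrow>\<^sub>0 nat) \<Rightarrow>\<^sub>0 'k) = 1"
      using kg(1) by (simp add: mult_single)
    hence "H = single 0 k * (single 0 (1 / k) * H)"
      by (simp add: mult.assoc[symmetric])
    thus ?thesis by (metis (no_types, lifting) distrib_left mult.left_commute)
  qed
  finally have "(\<Sum>as\<in>A. single 0 (c as) * list_power (f # fs) as)
      = single 0 k * (f ^ a * (g + f * (single 0 (1 / k) * H)))" .
  moreover have "f ^ a * (g + f * (single 0 (1 / k) * H)) \<in> nest (polys V) (f # fs)"
    using kg(2) polys_closed(4)[OF const_in_polys H, of "1 / k"] by auto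
  ultimately show ?case using kg(1) by blast
qed

lemma kill_mult: "kill X (p * q) = kill X p * kill X q"
  by (simp add: kill_def poly_subst_mult)

lemma kill_sum: "kill X (\<Sum>i\<in>A. f i) = (\<Sum>i\<in>A. kill X (f i))"
  by (simp add: kill_def poly_subst_sum)

lemma kill_const: "kill X (single 0 b) = single 0 b"
  by (simp add: kill_def poly_subst_single mono_subst_def)

lemma kill_list_power: "kill X (list_power fs as) = list_power (map (kill X) fs) as"
proof -
  have 1: "kill X 1 = 1"
    by (simp add: kill_def poly_subst_def mono_subst_def)
  have "kill X (f ^ a) = kill X f ^ a" for f :: "('a \<Rightarrow>\<^sub>0 nat) \<Rightarrow>\<^sub>0 'b" and a
    by (induction a) (auto simp: 1 kill_mult)
  thus ?thesis
    by (induction fs as rule: list_power.induct) (auto simp: 1 kill_mult)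
qed

text \<open>Setting the variables in \<open>X\<close> to 0 leaves fewer variables than polynomials,
  so the images are algebraically dependent. The same combination of the original polynomials lies
  in the kernel (X) and is in nested form up to a unit.\<close>

lemma nest_meets_var_ideal:
  fixes fs :: "(('v \<Rightarrow>\<^sub>0 nat) \<Rightarrow>\<^sub>0 'k::field) list"
  assumes "finite V" "set fs \<subseteq> polys V" "card (V - X) < length fs"
  shows "\<exists>g\<in>nest (polys V) fs. g \<in> face_ideal V (hits X)"
proof -
  let ?F = "V - X" and ?gs = "map (kill X) fs" and ?r = "length fs"
  have gs: "set ?gs \<subseteq> polys ?F"
    using assms(2) kill_in_polys by auto
  then obtain D where D: "\<forall>f\<in>set ?gs. keys f \<subseteq> deg_bound ?F D"
    using ex_deg_bound_list by blast
  obtain N where N: "(?r * (N * D) + 1) ^ card ?F < (N + 1) ^ ?r"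
    using ex_power_gt[OF assms(3)] by blast
  define A where "A = {as. set as \<subseteq> {..N} \<and> length as = ?r}"
  have A: "finite A" "card A = (N + 1) ^ ?r"
    by (simp_all add: A_def finite_lists_length_eq card_lists_length_eq)
  let ?B = "deg_bound ?F (?r * (N * D))"
  have B: "finite ?B" "card ?B < card A"
    using deg_bound_finite_card[of ?F "?r * (N * D)"] assms(1) N A by auto
  have bound: "keys (list_power ?gs as) \<subseteq> ?B" if "as \<in> A" for as
    using keys_list_power_deg_bound[OF D, of as N] that by (auto simp: A_def)
  from linear_relation[of A ?B "list_power ?gs", OF A(1) B(1) bound B(2)] obtain c where
    c: "\<exists>as\<in>A. c as \<noteq> 0" "(\<Sum>as\<in>A. single 0 (c as) * list_power ?gs as) = 0" by blast
  obtain k g where kg: "k \<noteq> 0" "g \<in> nest (polys V) fs"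
    "(\<Sum>as\<in>A. single 0 (c as) * list_power fs as) = single 0 k * g"
    using nest_of_relation[OF A(1) _ c(1) assms(2)] by (auto simp: A_def)
  have "kill X (single 0 k * g) = (\<Sum>as\<in>A. single 0 (c as) * list_power ?gs as)"
    by (simp only: kg(3)[symmetric] kill_sum kill_mult kill_const kill_list_power)
  hence "single 0 k * kill X g = 0"
    using c(2) by (simp add: kill_mult kill_const)
  hence "single 0 (1 / k) * (single 0 k * kill X g) = 0" by simp
  hence "kill X g = 0"
    using kg(1) by (simp add: mult.assoc[symmetric] mult_single)
  moreover have "g \<in> polys V"
    using nest_subset[OF subring_polys assms(2)] kg(2) by blast
  ultimately show ?thesis
    using kill_eq_0_iff kg(2) by blast
qed

section \<open>The quotient by an edge ideal\<close>

lemma carrier_poly_ring: "carrier (poly_ring V) = polys V"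
  by (simp add: poly_ring_def polys_def)

lemma poly_ring_simps:
  "x \<otimes>\<^bsub>poly_ring V\<^esub> y = x * y" "x \<oplus>\<^bsub>poly_ring V\<^esub> y = x + y" "\<one>\<^bsub>poly_ring V\<^esub> = 1" "\<zero>\<^bsub>poly_ring V\<^esub> = 0"
  by (simp_all add: poly_ring_def)

lemma cring_poly_ring: "cring (poly_ring V)"
proof (rule cringI)
  show "abelian_group (poly_ring V)"
    by (rule abelian_groupI)
      (auto simp: carrier_poly_ring poly_ring_simps add_ac intro: polys_closed bexI[of _ "- x" for x])
  show "Group.comm_monoid (poly_ring V)"
    by (rule comm_monoidI) (auto simp: carrier_poly_ring poly_ring_simps mult_ac intro: polys_closed)
qed (simp add: poly_ring_simps distrib_right)

lemma ring_poly_ring: "ring (poly_ring V)"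
  using cring_poly_ring by (rule cring.axioms)

text \<open>The bridge between ideals of the ring record and plain sets of polynomials, on which the
  arithmetic of the ambient type is available.\<close>

lemma ideal_poly_ring_iff: "ideal I (poly_ring V) \<longleftrightarrow> ideal_in (polys V) I"
proof
  assume "ideal I (poly_ring V)"
  then interpret I: ideal I "poly_ring V" .
  show "ideal_in (polys V) I"
    unfolding ideal_in_def
    using I.Icarr additive_subgroup.zero_closed[OF I.additive_subgroup_axioms]
      additive_subgroup.a_closed[OF I.additive_subgroup_axioms] I.I_r_closed
    by (auto simp: carrier_poly_ring poly_ring_simps)
next
  assume I: "ideal_in (polys V) I"
  interpret P: abelian_group "poly_ring V :: (('a \<Rightarrow>\<^sub>0 nat) \<Rightarrow>\<^sub>0 'b) ring"
    by (rule ring.is_abelian_group[OF ring_poly_ring])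
  have "subgroup I (add_monoid (poly_ring V))"
  proof (rule group.subgroupI)
    show "Group.group (add_monoid (poly_ring V))"
      using abelian_group.a_group[OF ring.is_abelian_group[OF ring_poly_ring]] .
    show "inv\<^bsub>add_monoid (poly_ring V)\<^esub> a \<in> I" if "a \<in> I" for a
    proof -
      have "inv\<^bsub>add_monoid (poly_ring V)\<^esub> a = - a"
        using P.minus_equality[of "- a" a]
          ideal_inD(1)[OF I that] polys_closed(5)[OF ideal_inD(1)[OF I that]]
        by (simp add: a_inv_def carrier_poly_ring poly_ring_simps)
      thus ?thesis
        using ideal_in_diff[OF subring_polys I ideal_inD(2)[OF I] that] by simp
    qed
  qed (use ideal_inD[OF I] in \<open>auto simp: carrier_poly_ring poly_ring_simps\<close>)
  thus "ideal I (poly_ring V)"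
    using ideal_inD[OF I] by (intro idealI ring_poly_ring) (auto simp: carrier_poly_ring poly_ring_simps)
qed

section \<open>Edge ideals as Stanley-Reisner ideals of independence complexes\<close>

definition edge_sets :: "'v set set \<Rightarrow> 'v set set" where
  "edge_sets E = {s. \<exists>e\<in>E. e \<subseteq> s}"

lemma upset_edge_sets: "upset (edge_sets E)"
  unfolding upset_def edge_sets_def by (blast intro: subset_trans)

lemma keys_pvar_mult: "u \<noteq> v \<Longrightarrow> pvar u * pvar v = single (single u 1 + single v 1) 1"
  by (simp add: pvar_def mult_single)

lemma simple_graph_edgeD:
  assumes "simple_graph V E" "e \<in> E"
  obtains u v where "e = {u, v}" "u \<noteq> v" "u \<in> V" "v \<in> V"
proof -
  have "e \<subseteq> V" "card e = 2"
    using assms by (auto simp: simple_graph_def)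
  then obtain u v where "e = {u, v}" "u \<noteq> v"
    unfolding card_2_iff by blast
  thus ?thesis
    using \<open>e \<subseteq> V\<close> by (intro that[of u v]) simp_all
qed

text \<open>The ends of an edge are distinct, so a monomial whose support contains the edge is
  divisible by the corresponding generator. Afterwards membership is read off supports.\<close>

lemma edge_ideal_eq:
  assumes "simple_graph V E"
  shows "edge_ideal V E = (face_ideal V (edge_sets E) :: (('v \<Rightarrow>\<^sub>0 nat) \<Rightarrow>\<^sub>0 'k::field) set)"
    (is "_ = ?J")
proof
  let ?S = "{pvar u * pvar v :: ('v \<Rightarrow>\<^sub>0 nat) \<Rightarrow>\<^sub>0 'k | u v. {u, v} \<in> E}"
  have edge: "u \<noteq> v \<and> u \<in> V \<and> v \<in> V" if "{u, v} \<in> E" for u v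
    using assms that by (cases "u = v") (auto simp: simple_graph_def)
  have S: "?S \<subseteq> ?J"
  proof
    fix p assume "p \<in> ?S"
    then obtain u v where "p = pvar u * pvar v" "{u, v} \<in> E" by blast
    thus "p \<in> ?J"
      using edge[of u v]
      by (auto simp: face_ideal_def edge_sets_def keys_pvar_mult keys_add_nat intro!: bexI[of _ "{u, v}"])
  qed
  show "edge_ideal V E \<subseteq> ?J"
    unfolding edge_ideal_def
    using S by (intro ring.genideal_minimal[OF ring_poly_ring])
      (auto simp: ideal_poly_ring_iff ideal_in_face_ideal upset_edge_sets)
  have "?S \<subseteq> carrier (poly_ring V)"
    using S ideal_inD(1)[OF ideal_in_face_ideal[OF upset_edge_sets]] by (force simp: carrier_poly_ring)
  hence "ideal (edge_ideal V E :: (('v \<Rightarrow>\<^sub>0 nat) \<Rightarrow>\<^sub>0 'k) set) (poly_ring V)" and S': "?S \<subseteq> edge_ideal V E"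
    unfolding edge_ideal_def
    by (rule ring.genideal_ideal[OF ring_poly_ring], rule ring.genideal_self[OF ring_poly_ring])
  hence I: "ideal_in (polys V) (edge_ideal V E :: (('v \<Rightarrow>\<^sub>0 nat) \<Rightarrow>\<^sub>0 'k) set)"
    by (simp add: ideal_poly_ring_iff)
  show "?J \<subseteq> edge_ideal V E"
  proof
    fix p :: "('v \<Rightarrow>\<^sub>0 nat) \<Rightarrow>\<^sub>0 'k" assume p: "p \<in> ?J"
    show "p \<in> edge_ideal V E"
    proof (rule mem_by_monomials)
      fix m assume m: "m \<in> keys p"
      then obtain e where "e \<in> E" "e \<subseteq> keys m"
        using p by (auto simp: face_ideal_def edge_sets_def)
      then obtain u v where uv: "{u, v} \<in> E" "u \<noteq> v" "u \<in> keys m" "v \<in> keys m"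
        using assms by (elim simple_graph_edgeD) auto
      have "(single u 1 + single v 1) + (m - (single u 1 + single v 1)) = m"
        by (rule poly_mapping_eqI)
          (use uv in \<open>auto simp: lookup_add lookup_minus lookup_single when_def in_keys_iff\<close>)
      hence eq: "single m (lookup p m)
          = (pvar u * pvar v) * single (m - (single u 1 + single v 1)) (lookup p m)"
        using uv(2) by (simp add: keys_pvar_mult mult_single)
      have "keys (m - (single u 1 + single v 1)) \<subseteq> keys m"
        by (auto simp: in_keys_iff lookup_minus)
      hence rest: "single (m - (single u 1 + single v 1)) (lookup p m) \<in> polys V"
        using p m by (intro single_in_polys) (auto simp: face_ideal_def)
      have "(pvar u * pvar v :: ('v \<Rightarrow>\<^sub>0 nat) \<Rightarrow>\<^sub>0 'k) \<in> edge_ideal V E"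
        using uv(1) S' by blast
      from ideal_inD(4)[OF I this rest] show "single m (lookup p m) \<in> edge_ideal V E"
        by (simp only: eq)
    qed (use ideal_inD[OF I] in auto)
  qed
qed

text \<open>An ideal above the irrelevant ideal that is visible on monomials: it excludes 1, and
  every monomial of its members has degree at least 1.\<close>

definition no_const :: "'v set \<Rightarrow> (('v \<Rightarrow>\<^sub>0 nat) \<Rightarrow>\<^sub>0 'k::field) set" where
  "no_const V = face_ideal V {s. s \<noteq> {}}"

lemma ideal_in_no_const: "ideal_in (polys V) (no_const V)"
  unfolding no_const_def by (rule ideal_in_face_ideal) (auto simp: upset_def)

lemma irrelevant_ideal_subset: "irrelevant_ideal V \<subseteq> no_const V"
  unfolding irrelevant_ideal_def
  by (rule ring.genideal_minimal[OF ring_poly_ring])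
    (auto simp: ideal_poly_ring_iff ideal_in_no_const, auto simp: no_const_def face_ideal_def pvar_def dest: arg_cong[of _ _ keys])

lemma pvar_in_irrelevant_ideal: "v \<in> V \<Longrightarrow> pvar v \<in> irrelevant_ideal V"
  unfolding irrelevant_ideal_def
  by (rule ring.genideal_self[OF ring_poly_ring, THEN subsetD])
    (auto simp: carrier_poly_ring intro: pvar_in_polys)

lemma ideal_in_irrelevant_ideal: "ideal_in (polys V) (irrelevant_ideal V)"
  unfolding irrelevant_ideal_def ideal_poly_ring_iff[symmetric]
  by (rule ring.genideal_ideal[OF ring_poly_ring]) (auto simp: carrier_poly_ring intro: pvar_in_polys)

section \<open>Cosets and the quotient module\<close>

lemma coset_poly_ring: "I +>\<^bsub>poly_ring V\<^esub> x = {i + x | i. i \<in> I}"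
  by (auto simp: a_r_coset_def' poly_ring_simps)

lemma coset_eq_iff:
  assumes "ideal_in (polys V) I"
  shows "I +>\<^bsub>poly_ring V\<^esub> x = I +>\<^bsub>poly_ring V\<^esub> y \<longleftrightarrow> x - y \<in> I"
proof
  assume "I +>\<^bsub>poly_ring V\<^esub> x = I +>\<^bsub>poly_ring V\<^esub> y"
  moreover have "x \<in> I +>\<^bsub>poly_ring V\<^esub> x"
    using ideal_inD(2)[OF assms] by (force simp: coset_poly_ring)
  ultimately show "x - y \<in> I" by (auto simp: coset_poly_ring)
next
  have *: "I +>\<^bsub>poly_ring V\<^esub> x \<subseteq> I +>\<^bsub>poly_ring V\<^esub> y" if "x - y \<in> I" for x y
  proof
    fix z assume "z \<in> I +>\<^bsub>poly_ring V\<^esub> x"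
    then obtain i where "z = i + x" "i \<in> I" by (auto simp: coset_poly_ring)
    hence "z = (i + (x - y)) + y" "i + (x - y) \<in> I"
      using ideal_inD(3)[OF assms] that by auto
    thus "z \<in> I +>\<^bsub>poly_ring V\<^esub> y" unfolding coset_poly_ring by blast
  qed
  assume xy: "x - y \<in> I"
  hence "y - x \<in> I"
    using ideal_in_diff[OF subring_polys assms ideal_inD(2)[OF assms]] by fastforce
  thus "I +>\<^bsub>poly_ring V\<^esub> x = I +>\<^bsub>poly_ring V\<^esub> y" using * xy by blast
qed

lemma carrier_quotient: "carrier (poly_ring V Quot I) = (\<lambda>x. I +>\<^bsub>poly_ring V\<^esub> x) ` polys V"
  by (auto simp: FactRing_def A_RCOSETS_def' carrier_poly_ring)

lemma quotient_add:
  assumes "ideal_in (polys V) I" "x \<in> polys V" "y \<in> polys V"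
  shows "(I +>\<^bsub>poly_ring V\<^esub> x) \<oplus>\<^bsub>poly_ring V Quot I\<^esub> (I +>\<^bsub>poly_ring V\<^esub> y) = I +>\<^bsub>poly_ring V\<^esub> (x + y)"
  using ideal.a_rcos_sum[of I "poly_ring V" x y] assms
  by (simp add: FactRing_def ideal_poly_ring_iff carrier_poly_ring poly_ring_simps)

lemma quotient_mult:
  assumes "ideal_in (polys V) I" "x \<in> polys V" "y \<in> polys V"
  shows "(I +>\<^bsub>poly_ring V\<^esub> x) \<otimes>\<^bsub>poly_ring V Quot I\<^esub> (I +>\<^bsub>poly_ring V\<^esub> y) = I +>\<^bsub>poly_ring V\<^esub> (x * y)"
  using ideal.rcoset_mult_add[of I "poly_ring V" x y] assms
  by (simp add: FactRing_def ideal_poly_ring_iff carrier_poly_ring poly_ring_simps)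

lemma quotient_module_simps:
  "carrier (quotient_module R I) = carrier (R Quot I)"
  "add (quotient_module R I) = add (R Quot I)"
  "zero (quotient_module R I) = zero (R Quot I)"
  "f \<odot>\<^bsub>quotient_module R I\<^esub> X = (I +>\<^bsub>R\<^esub> f) \<otimes>\<^bsub>R Quot I\<^esub> X"
  by (simp_all add: quotient_module_def FactRing_def ring.defs module.defs)

lemma abelian_monoid_quotient_module:
  assumes "ideal_in (polys V) I"
  shows "abelian_monoid (quotient_module (poly_ring V) I)"
proof -
  interpret Q: abelian_group "poly_ring V Quot I"
    using ideal.quotient_is_ring[of I "poly_ring V"] assms
    by (intro ring.is_abelian_group) (simp add: ideal_poly_ring_iff)
  show ?thesis
    by (rule abelian_monoidI) (auto simp: quotient_module_simps Q.a_ac)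
qed

lemma finsum_quotient_module:
  fixes n :: nat
  assumes I: "ideal_in (polys V) I" and h: "\<And>i. i < n \<Longrightarrow> h i \<in> polys V"
    and g: "\<And>i. i < n \<Longrightarrow> g i = I +>\<^bsub>poly_ring V\<^esub> h i"
  shows "(\<Oplus>\<^bsub>quotient_module (poly_ring V) I\<^esub>i\<in>{..<n}. g i) = I +>\<^bsub>poly_ring V\<^esub> (\<Sum>i<n. h i)"
  using h g
proof (induction n)
  interpret abelian_monoid "quotient_module (poly_ring V) I"
    by (rule abelian_monoid_quotient_module[OF I])
  {
    case 0
    have "I +>\<^bsub>poly_ring V\<^esub> 0 = I" by (auto simp: coset_poly_ring)
    thus ?case by (simp add: quotient_module_simps) (simp add: FactRing_def)
  next
    case (Suc n)
    have "g i \<in> carrier (quotient_module (poly_ring V) I)" if "i < Suc n" for i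
      using Suc.prems that by (auto simp: quotient_module_simps carrier_quotient)
    hence "(\<Oplus>\<^bsub>quotient_module (poly_ring V) I\<^esub>i\<in>{..<Suc n}. g i)
        = g n \<oplus>\<^bsub>quotient_module (poly_ring V) I\<^esub> (\<Oplus>\<^bsub>quotient_module (poly_ring V) I\<^esub>i\<in>{..<n}. g i)"
      unfolding lessThan_Suc by (intro finsum_insert) auto
    thus ?case
      using Suc quotient_add[OF I, of "h n" "\<Sum>i<n. h i"] sum_in_polys[of "{..<n}" h V]
      by (simp add: quotient_module_simps add.commute)
  }
qed

lemma add_gens_eq:
  assumes "subring_set C"
  shows "add_gens C I fs = {i + (\<Sum>j<length fs. fs ! j * h j) | i h. i \<in> I \<and> h \<in> {..<length fs} \<rightarrow> C}"
proof (induction fs arbitrary: I)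
  case (Cons f fs)
  show ?case
  proof (intro equalityI subsetI)
    fix z assume "z \<in> add_gens C I (f # fs)"
    then obtain i h k where z: "z = (i + f * k) + (\<Sum>j<length fs. fs ! j * h j)"
      "i \<in> I" "k \<in> C" "h \<in> {..<length fs} \<rightarrow> C"
      by (auto simp: Cons add_gen_def)
    define h' where "h' j = (case j of 0 \<Rightarrow> k | Suc j \<Rightarrow> h j)" for j
    have "h' \<in> {..<length (f # fs)} \<rightarrow> C"
      using z(3,4) by (auto simp: h'_def split: nat.split)
    moreover have "z = i + (\<Sum>j<length (f # fs). (f # fs) ! j * h' j)"
      by (simp add: z(1) sum.lessThan_Suc_shift h'_def add.assoc del: sum.lessThan_Suc)
    ultimately show "z \<in> {i + (\<Sum>j<length (f # fs). (f # fs) ! j * h j) | i h.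
        i \<in> I \<and> h \<in> {..<length (f # fs)} \<rightarrow> C}"
      using z(2) by blast
  next
    fix z assume "z \<in> {i + (\<Sum>j<length (f # fs). (f # fs) ! j * h j) | i h.
        i \<in> I \<and> h \<in> {..<length (f # fs)} \<rightarrow> C}"
    then obtain i h where z: "z = i + (\<Sum>j<length (f # fs). (f # fs) ! j * h j)"
      "i \<in> I" "h \<in> {..<length (f # fs)} \<rightarrow> C" by blast
    have "z = (i + f * h 0) + (\<Sum>j<length fs. fs ! j * (h \<circ> Suc) j)"
      by (simp add: z(1) sum.lessThan_Suc_shift add.assoc del: sum.lessThan_Suc)
    moreover have "h \<circ> Suc \<in> {..<length fs} \<rightarrow> C" using z(3) by auto
    moreover have "i + f * h 0 \<in> add_gen C I f"
      using z by (intro add_genI[OF refl]) auto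
    ultimately show "z \<in> add_gens C I (f # fs)"
      unfolding add_gens.simps Cons by blast
  qed
qed auto

text \<open>Coset representatives turn a combination in the quotient module into one of polynomials,
  up to an element of \<open>I\<close>; \<open>add_gens_eq\<close> has the same shape.\<close>

lemma list_times_module_quotient:
  assumes I: "ideal_in (polys V) I" and fs: "set fs \<subseteq> polys V" and x: "x \<in> polys V"
  shows "I +>\<^bsub>poly_ring V\<^esub> x \<in> list_times_module fs (quotient_module (poly_ring V) I)
    \<longleftrightarrow> x \<in> add_gens (polys V) I fs"
proof -
  let ?M = "quotient_module (poly_ring V) I"
  have prod: "fs ! j * h j \<in> polys V" if "j < length fs" "h \<in> {..<length fs} \<rightarrow> polys V" for j h
    using fs that by (intro polys_closed(4)) auto
  have sm: "fs ! j \<odot>\<^bsub>?M\<^esub> (I +>\<^bsub>poly_ring V\<^esub> h j) = I +>\<^bsub>poly_ring V\<^esub> (fs ! j * h j)"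
    if "j < length fs" "h \<in> {..<length fs} \<rightarrow> polys V" for j h
    using fs that by (auto simp: quotient_module_simps intro!: quotient_mult[OF I])
  show ?thesis
  proof
    assume "I +>\<^bsub>poly_ring V\<^esub> x \<in> list_times_module fs ?M"
    then obtain z where z: "I +>\<^bsub>poly_ring V\<^esub> x = (\<Oplus>\<^bsub>?M\<^esub>i\<in>{..<length fs}. fs ! i \<odot>\<^bsub>?M\<^esub> z i)"
      "z \<in> {..<length fs} \<rightarrow> carrier ?M"
      by (auto simp: list_times_module_def)
    have "\<forall>i\<in>{..<length fs}. \<exists>y. y \<in> polys V \<and> z i = I +>\<^bsub>poly_ring V\<^esub> y"
      using z(2) by (fastforce simp: quotient_module_simps carrier_quotient)
    from bchoice[OF this] obtain h where
      h: "\<And>i. i < length fs \<Longrightarrow> h i \<in> polys V \<and> z i = I +>\<^bsub>poly_ring V\<^esub> h i" by auto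
    have h': "h \<in> {..<length fs} \<rightarrow> polys V" using h by auto
    have "I +>\<^bsub>poly_ring V\<^esub> x = I +>\<^bsub>poly_ring V\<^esub> (\<Sum>i<length fs. fs ! i * h i)"
      unfolding z(1) by (rule finsum_quotient_module[OF I prod[OF _ h']]) (simp_all add: h sm[OF _ h'])
    hence "x - (\<Sum>i<length fs. fs ! i * h i) \<in> I"
      using coset_eq_iff[OF I] by blast
    moreover have "x = (x - (\<Sum>i<length fs. fs ! i * h i)) + (\<Sum>i<length fs. fs ! i * h i)" by simp
    ultimately show "x \<in> add_gens (polys V) I fs"
      unfolding add_gens_eq[OF subring_polys] using h' by blast
  next
    assume "x \<in> add_gens (polys V) I fs"
    then obtain i h where h: "x = i + (\<Sum>j<length fs. fs ! j * h j)" "i \<in> I"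
      "h \<in> {..<length fs} \<rightarrow> polys V"
      unfolding add_gens_eq[OF subring_polys] by blast
    have "I +>\<^bsub>poly_ring V\<^esub> x = I +>\<^bsub>poly_ring V\<^esub> (\<Sum>j<length fs. fs ! j * h j)"
      using h coset_eq_iff[OF I] by simp
    also have "\<dots> = (\<Oplus>\<^bsub>?M\<^esub>j\<in>{..<length fs}. fs ! j \<odot>\<^bsub>?M\<^esub> (I +>\<^bsub>poly_ring V\<^esub> h j))"
      by (rule finsum_quotient_module[OF I prod[OF _ h(3)], symmetric]) (simp_all add: sm[OF _ h(3)])
    finally show "I +>\<^bsub>poly_ring V\<^esub> x \<in> list_times_module fs ?M"
      unfolding list_times_module_def using h(3)
      by (auto simp: quotient_module_simps carrier_quotient
          intro!: exI[of _ "\<lambda>j. I +>\<^bsub>poly_ring V\<^esub> h j"])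
  qed
qed

lemma list_times_module_subset:
  assumes I: "ideal_in (polys V) I" and fs: "set fs \<subseteq> polys V"
  shows "list_times_module fs (quotient_module (poly_ring V) I) \<subseteq> carrier (quotient_module (poly_ring V) I)"
proof -
  let ?M = "quotient_module (poly_ring V) I"
  interpret abelian_monoid ?M
    by (rule abelian_monoid_quotient_module[OF I])
  have "f \<odot>\<^bsub>?M\<^esub> X \<in> carrier ?M" if "f \<in> polys V" "X \<in> carrier ?M" for f X
    using that by (auto simp: quotient_module_simps carrier_quotient quotient_mult[OF I]
        intro!: imageI polys_closed(4))
  hence "(\<lambda>i. fs ! i \<odot>\<^bsub>?M\<^esub> z i) \<in> {..<length fs} \<rightarrow> carrier ?M"
    if "z \<in> {..<length fs} \<rightarrow> carrier ?M" for z
    using fs that by (simp add: Pi_iff subset_iff)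
  from finsum_closed[OF this] show ?thesis
    unfolding list_times_module_def by auto
qed

text \<open>From here on the depth concerns ideals of polynomials only: the submodules in question
  correspond to ideals above \<open>I\<close>, and such an ideal is proper exactly when 1 is
  missing.\<close>

lemma regular_sequence_quotient_iff:
  assumes I: "ideal_in (polys V) I"
  shows "regular_sequence (poly_ring V) (quotient_module (poly_ring V) I) fs \<longleftrightarrow>
    set fs \<subseteq> polys V \<and> weakly_regular (polys V) I fs \<and> 1 \<notin> add_gens (polys V) I fs"
proof (cases "set fs \<subseteq> polys V")
  case fs: True
  let ?M = "quotient_module (poly_ring V) I" and ?c = "\<lambda>x. I +>\<^bsub>poly_ring V\<^esub> x"
  have take: "set (take i fs) \<subseteq> polys V" for i
    using fs by (meson set_take_subset subset_trans)
  have "(\<forall>z\<in>carrier ?M. fs ! i \<odot>\<^bsub>?M\<^esub> z \<in> list_times_module (take i fs) ?M \<longrightarrow>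
          z \<in> list_times_module (take i fs) ?M) \<longleftrightarrow>
      (\<forall>z\<in>polys V. fs ! i * z \<in> add_gens (polys V) I (take i fs) \<longrightarrow> z \<in> add_gens (polys V) I (take i fs))"
    if "i < length fs" for i
  proof -
    have fi: "fs ! i \<in> polys V" using fs that by auto
    have "fs ! i \<odot>\<^bsub>?M\<^esub> ?c x = ?c (fs ! i * x)" if "x \<in> polys V" for x
      using fi that by (simp add: quotient_module_simps quotient_mult[OF I])
    thus ?thesis
      using fi by (simp add: quotient_module_simps(1) carrier_quotient
          list_times_module_quotient[OF I take] polys_closed(4))
  qed
  moreover have "list_times_module fs ?M \<noteq> carrier ?M \<longleftrightarrow> 1 \<notin> add_gens (polys V) I fs"
  proof -
    have "list_times_module fs ?M = carrier ?M \<longleftrightarrow> (\<forall>x\<in>polys V. ?c x \<in> list_times_module fs ?M)"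
      using list_times_module_subset[OF I fs] by (auto simp: quotient_module_simps(1) carrier_quotient)
    also have "\<dots> \<longleftrightarrow> (\<forall>x\<in>polys V. x \<in> add_gens (polys V) I fs)"
      using list_times_module_quotient[OF I fs] by simp
    also have "\<dots> \<longleftrightarrow> 1 \<in> add_gens (polys V) I fs"
      using ideal_in_eq_whole[OF subring_polys ideal_in_add_gens[OF subring_polys I fs]]
        polys_closed(1) by blast
    finally show ?thesis by simp
  qed
  ultimately show ?thesis
    using fs unfolding regular_sequence_def weakly_regular_iff carrier_poly_ring by simp
qed (simp add: regular_sequence_def carrier_poly_ring)

section \<open>Depth and dimension of graphs\<close>

definition independent_set :: "'v set set \<Rightarrow> 'v set \<Rightarrow> bool" where
  "independent_set E F \<longleftrightarrow> (\<forall>e\<in>E. \<not> e \<subseteq> F)"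

definition dominating :: "'v set \<Rightarrow> 'v set set \<Rightarrow> 'v set \<Rightarrow> bool" where
  "dominating V E F \<longleftrightarrow> (\<forall>v\<in>V - F. \<exists>u\<in>F. {u, v} \<in> E)"

section \<open>Upper bound for the depth\<close>

definition total_deg :: "('v \<Rightarrow>\<^sub>0 nat) \<Rightarrow> nat" where
  "total_deg m = (\<Sum>v\<in>keys m. lookup m v)"

lemma total_deg_add: "total_deg (m + n) = total_deg m + total_deg n"
proof -
  have *: "total_deg k = (\<Sum>v\<in>keys m \<union> keys n. lookup k v)" if "keys k \<subseteq> keys m \<union> keys n" for k
    unfolding total_deg_def using that by (intro sum.mono_neutral_left) (auto simp: in_keys_iff)
  show ?thesis
    by (simp add: * keys_add_nat lookup_add sum.distrib)
qed

lemma keys_power_total_deg: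
  assumes "f \<in> no_const V" "m \<in> keys (f ^ k)"
  shows "k \<le> total_deg m"
  using assms(2)
proof (induction k arbitrary: m)
  case (Suc k)
  then obtain a b where ab: "m = a + b" "a \<in> keys f" "b \<in> keys (f ^ k)"
    using keys_mult[of f "f ^ k"] by auto
  have "keys a \<noteq> {}"
    using assms(1) ab(2) by (auto simp: no_const_def face_ideal_def)
  then obtain v where v: "v \<in> keys a" by blast
  have "1 \<le> lookup a v" using v by (simp add: in_keys_iff)
  also have "\<dots> \<le> total_deg a"
    unfolding total_deg_def using v by (intro member_le_sum) auto
  finally show ?case
    using Suc.IH[OF ab(3)] by (simp add: ab(1) total_deg_add)
qed simp

text \<open>Let \<open>w\<close> be the product of the variables in \<open>F\<close>; then \<open>I : w\<close> is the prime generated by the other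
  variables. If the sequence were longer than \<open>card F\<close>, its \<open>k\<close>-th powers would satisfy an algebraic relation
  modulo this prime, and regularity would put \<open>w\<close> into the ideal generated by \<open>I\<close> and these powers. For
  \<open>k > card F\<close> this is impossible by degree.\<close>

lemma length_regular_le_card:
  assumes G: "simple_graph V E" and F: "F \<subseteq> V" "independent_set E F" "dominating V E F"
    and fs: "set fs \<subseteq> no_const V"
    and reg: "weakly_regular (polys V) (face_ideal V (edge_sets E)) (fs :: (('v \<Rightarrow>\<^sub>0 nat) \<Rightarrow>\<^sub>0 'k::field) list)"
  shows "length fs \<le> card F"
proof (rule ccontr)
  assume "\<not> length fs \<le> card F"
  let ?I = "face_ideal V (edge_sets E) :: (('v \<Rightarrow>\<^sub>0 nat) \<Rightarrow>\<^sub>0 'k) set"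
  have I: "ideal_in (polys V) ?I"
    by (rule ideal_in_face_ideal[OF upset_edge_sets])
  have "finite V" "finite F"
    using G F(1) finite_subset by (auto simp: simple_graph_def)
  define k where "k = card F + 1"
  let ?gs = "map (\<lambda>f. f ^ k) fs"
  have fsC: "set fs \<subseteq> polys V"
    using fs ideal_inD(1)[OF ideal_in_no_const] by blast
  hence gsC: "set ?gs \<subseteq> polys V"
    using polys_closed(7) by auto
  have "V - (V - F) = F" using F(1) by blast
  hence "card (V - (V - F)) < length ?gs"
    using \<open>\<not> length fs \<le> card F\<close> by simp
  from nest_meets_var_ideal[OF \<open>finite V\<close> gsC this] obtain g where
    g: "g \<in> nest (polys V) ?gs" "g \<in> face_ideal V (hits (V - F))" by blast
  define mF :: "'v \<Rightarrow>\<^sub>0 nat" where "mF = (\<Sum>v\<in>F. single v 1)"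
  have lookup_mF: "lookup mF v = (if v \<in> F then 1 else 0)" for v
    using \<open>finite F\<close> by (simp add: mF_def lookup_sum lookup_single when_def sum.delta')
  hence keys_mF: "keys mF = F"
    by (auto simp: in_keys_iff split: if_splits)
  define w where "w = single mF (1::'k)"
  have "w \<in> polys V"
    unfolding w_def by (rule single_in_polys) (simp add: keys_mF F(1))
  \<comment> \<open>Every monomial of \<open>g\<close> contains a variable outside \<open>F\<close>,
    and domination gives this vertex a neighbour in \<open>F\<close>, the support of
    \<open>w\<close>: the product contains an edge.\<close>
  have "w * g \<in> ?I"
    unfolding face_ideal_def
  proof (intro CollectI ballI)
    fix m assume "m \<in> keys (w * g)"
    then obtain n where n: "m = mF + n" "n \<in> keys g"
      using keys_mult[of w g] by (auto simp: w_def)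
    then obtain v where v: "v \<in> keys n" "v \<in> V - F" "keys n \<subseteq> V"
      using g(2) by (auto simp: face_ideal_def hits_def)
    then obtain u where "u \<in> F" "{u, v} \<in> E"
      using F(3) by (auto simp: dominating_def)
    thus "keys m \<subseteq> V \<and> keys m \<in> edge_sets E"
      using v F(1) by (auto simp: n(1) keys_add_nat keys_mF edge_sets_def intro!: bexI[of _ "{u, v}"])
  qed
  have "w \<in> add_gens (polys V) ?I ?gs"
    by (rule nest_collapse[OF subring_polys I gsC weakly_regular_powers[OF subring_polys I fsC reg]
          \<open>w \<in> polys V\<close> g(1) \<open>w * g \<in> ?I\<close>])
  \<comment> \<open>The ideal spanned by the nonface monomials and all monomials of degree at least
    \<open>k\<close>. It contains \<open>?I\<close> and the \<open>k\<close>-th powers, but not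
    \<open>w\<close>, whose support is independent and whose degree is
    \<open>card F = k - 1\<close>.\<close>
  moreover define J where "J = {p :: ('v \<Rightarrow>\<^sub>0 nat) \<Rightarrow>\<^sub>0 'k.
    p \<in> polys V \<and> (\<forall>m\<in>keys p. keys m \<in> edge_sets E \<or> k \<le> total_deg m)}"
  have "ideal_in (polys V) J"
    unfolding ideal_in_def
  proof (intro conjI ballI)
    fix x r :: "('v \<Rightarrow>\<^sub>0 nat) \<Rightarrow>\<^sub>0 'k" assume x: "x \<in> J" and r: "r \<in> polys V"
    have "keys m \<in> edge_sets E \<or> k \<le> total_deg m" if mk: "m \<in> keys (x * r)" for m
    proof -
      obtain a b where "m = a + b" "a \<in> keys x" "b \<in> keys r"
        using keys_mult[of x r] mk by blast
      moreover from this have "keys a \<in> edge_sets E \<or> k \<le> total_deg a"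
        using x by (simp add: J_def)
      moreover have "keys a \<subseteq> keys (a + b)" by (simp add: keys_add_nat)
      ultimately show ?thesis
        using upset_edge_sets[of E] unfolding upset_def total_deg_add by (metis trans_le_add1 total_deg_add)
    qed
    thus "x * r \<in> J" using x r polys_closed(4) by (auto simp: J_def)
  next
    fix x y assume "x \<in> J" "y \<in> J"
    thus "x + y \<in> J"
      using keys_add[of x y] polys_closed(6) by (auto simp: J_def)
  qed (auto simp: J_def polys_closed)
  moreover have "?I \<subseteq> J"
    using ideal_inD(1)[OF I] by (auto simp: J_def face_ideal_def)
  moreover have "set ?gs \<subseteq> J"
    using gsC keys_power_total_deg fs by (fastforce simp: J_def)
  ultimately have "w \<in> J"
    using add_gens_minimal by blast
  moreover have "total_deg mF = card F"
    by (simp add: total_deg_def keys_mF lookup_mF)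
  ultimately show False
    using F(2) by (simp add: J_def w_def keys_mF edge_sets_def independent_set_def k_def)
qed

lemma graph_depth_eq:
  assumes "simple_graph V E"
  shows "graph_depth (K :: 'k::field itself) V E = Sup {enat (length fs) | fs.
    set fs \<subseteq> irrelevant_ideal V \<and>
    weakly_regular (polys V) (face_ideal V (edge_sets E) :: (('v \<Rightarrow>\<^sub>0 nat) \<Rightarrow>\<^sub>0 'k) set) fs \<and>
    1 \<notin> add_gens (polys V) (face_ideal V (edge_sets E)) fs}"
proof -
  have "set fs \<subseteq> irrelevant_ideal V \<Longrightarrow> set fs \<subseteq> polys V" for fs :: "(('v \<Rightarrow>\<^sub>0 nat) \<Rightarrow>\<^sub>0 'k) list"
    using ideal_inD(1)[OF ideal_in_irrelevant_ideal] by blast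
  thus ?thesis
    unfolding graph_depth_def Let_def module_depth_def edge_ideal_eq[OF assms]
      regular_sequence_quotient_iff[OF ideal_in_face_ideal[OF upset_edge_sets]]
    by (intro arg_cong[of _ _ Sup]) blast
qed

lemma graph_depth_le:
  assumes "simple_graph V E" "F \<subseteq> V" "independent_set E F" "dominating V E F"
  shows "graph_depth K V E \<le> enat (card F)"
  unfolding graph_depth_eq[OF assms(1)]
proof (rule Sup_least, safe)
  fix fs assume "set fs \<subseteq> irrelevant_ideal V" "weakly_regular (polys V) (face_ideal V (edge_sets E)) fs"
  thus "enat (length fs) \<le> enat (card F)"
    using length_regular_le_card[OF assms] irrelevant_ideal_subset by (metis enat_ord_simps(1) subset_trans)
qed

section \<open>Lower bound for the depth\<close>

definition closed_nbhd :: "'v set set \<Rightarrow> 'v \<Rightarrow> 'v set" where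
  "closed_nbhd E l = insert l {v. {l, v} \<in> E}"

text \<open>Splitting \<open>R / I\<close> along a vertex \<open>x\<close> by \<open>(I : x)\<close> and \<open>I + (x)\<close> puts either the neighbours of
  \<open>x\<close> or \<open>x\<close> itself into the set \<open>X\<close> of variables that are zero; \<open>S\<close> collects the vertices for which
  the first option was taken and \<open>T\<close> those still to be treated.\<close>

lemma weakly_regular_nbhd_sums_aux:
  fixes V :: "'v::linorder set"
  assumes G: "simple_graph V E" and ls: "distinct ls" "set ls \<subseteq> V"
    and disj: "\<And>l l'. l \<in> set ls \<Longrightarrow> l' \<in> set ls \<Longrightarrow> l \<noteq> l' \<Longrightarrow> closed_nbhd E l \<inter> closed_nbhd E l' = {}"
    and "finite T" "T \<subseteq> V" "T \<inter> set ls = {}" "X \<subseteq> V" "S \<inter> X = {}"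
    and "\<And>s v. s \<in> S \<Longrightarrow> {s, v} \<in> E \<Longrightarrow> v \<in> X"
    and "\<And>l. l \<in> set ls \<Longrightarrow> l \<in> X \<Longrightarrow> \<exists>s\<in>S. {l, s} \<in> E"
    and "V \<subseteq> X \<union> S \<union> T \<union> set ls"
  shows "weakly_regular (polys V) (face_ideal V (hits X \<union> edge_sets E) :: (('v \<Rightarrow>\<^sub>0 nat) \<Rightarrow>\<^sub>0 'k::field) set)
    (map (\<lambda>l. \<Sum>u\<in>closed_nbhd E l. pvar u) ls)"
  using assms(5-12)
proof (induction T arbitrary: X S rule: finite_induct)
  case empty
  \<comment> \<open>An edge that avoids \<open>X\<close> cannot meet \<open>S\<close>, whose
    neighbours all lie in \<open>X\<close>, so both ends are in \<open>ls\<close>; then their closed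
    neighbourhoods would overlap. Hence the ideal has become the variable prime (X).\<close>
  have edge: "e \<inter> X \<noteq> {}" if eE: "e \<in> E" for e
  proof (rule ccontr)
    assume e: "\<not> e \<inter> X \<noteq> {}"
    obtain a b where ab: "e = {a, b}" "a \<noteq> b" "a \<in> V" "b \<in> V"
      using simple_graph_edgeD[OF G eE] .
    hence E: "{a, b} \<in> E" "{b, a} \<in> E"
      using eE by (simp_all add: insert_commute)
    hence "a \<in> set ls" "b \<in> set ls"
      using e ab empty.prems(5,7) by blast+
    moreover have "b \<in> closed_nbhd E a \<inter> closed_nbhd E b"
      using E by (simp add: closed_nbhd_def)
    ultimately show False using disj[of a b] ab(2) by blast
  qed
  have "hits X \<union> edge_sets E = hits X"
    using edge by (fastforce simp: edge_sets_def hits_def)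
  moreover have "weakly_regular (polys V) (face_ideal V (hits X) :: (('v \<Rightarrow>\<^sub>0 nat) \<Rightarrow>\<^sub>0 'k::field) set)
    (map (\<lambda>l. \<Sum>u\<in>closed_nbhd E l. pvar u) ls)"
  proof (rule weakly_regular_block_sums[OF ls(1)])
    fix l assume l: "l \<in> set ls"
    show sub: "closed_nbhd E l \<subseteq> V"
      using l ls(2) G by (auto simp: closed_nbhd_def simple_graph_def)
    show "finite (closed_nbhd E l)"
      using sub G by (auto simp: simple_graph_def intro: finite_subset)
    \<comment> \<open>If \<open>l\<close> itself lies in \<open>X\<close>, it has a neighbour in
      \<open>S\<close>, and \<open>S\<close> is disjoint from \<open>X\<close>.\<close>
    show "\<not> closed_nbhd E l \<subseteq> X"
    proof
      assume X: "closed_nbhd E l \<subseteq> X"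
      hence "l \<in> X" by (simp add: closed_nbhd_def)
      then obtain s where "s \<in> S" "{l, s} \<in> E" using empty.prems(6)[OF l] by blast
      thus False using X empty.prems(4) by (auto simp: closed_nbhd_def)
    qed
  qed (use disj in auto)
  ultimately show ?case by simp
next
  case (insert x T)
  let ?fs = "map (\<lambda>l. \<Sum>u\<in>closed_nbhd E l. pvar u) ls :: (('v \<Rightarrow>\<^sub>0 nat) \<Rightarrow>\<^sub>0 'k) list"
  let ?N = "hits X \<union> edge_sets E"
  show ?case
  proof (cases "x \<in> X \<or> x \<in> S")
    case True
    show ?thesis
      by (rule insert.IH) (use insert.prems True in auto)
  next
    case False
    have x: "x \<in> V" "x \<notin> set ls" using insert.prems by auto
    have nx: "{x, x} \<notin> E" using G by (auto simp: simple_graph_def)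
    have up: "upset ?N"
      using upset_hits[of X] upset_edge_sets[of E] by (auto simp: upset_def)
    let ?X = "X \<union> {v. {x, v} \<in> E}"
    have "{s. Set.insert x s \<in> ?N} = hits ?X \<union> edge_sets E"
    proof (intro equalityI subsetI)
      fix s assume "s \<in> {s. Set.insert x s \<in> ?N}"
      then consider "s \<inter> X \<noteq> {}" | e where "e \<in> E" "e \<subseteq> Set.insert x s"
        using False by (auto simp: hits_def edge_sets_def)
      thus "s \<in> hits ?X \<union> edge_sets E"
      proof cases
        case 2
        show ?thesis
        proof (cases "x \<in> e")
          case True
          obtain a b where "e = {a, b}" "a \<noteq> b" using simple_graph_edgeD[OF G 2(1)] .
          then obtain y where "e = {x, y}" "y \<noteq> x" using True by auto
          thus ?thesis using 2 by (auto simp: hits_def)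
        next
          case False
          thus ?thesis using 2 by (auto simp: edge_sets_def)
        qed
      qed (auto simp: hits_def)
    next
      fix s assume "s \<in> hits ?X \<union> edge_sets E"
      thus "s \<in> {s. Set.insert x s \<in> ?N}"
        by (auto simp: hits_def edge_sets_def intro: bexI[of _ "{x, _}"])
    qed
    moreover have "weakly_regular (polys V) (face_ideal V (hits ?X \<union> edge_sets E)) ?fs"
    proof (rule insert.IH[where S = "Set.insert x S"])
      show "?X \<subseteq> V" using insert.prems(3) G by (auto simp: simple_graph_def)
      show "Set.insert x S \<inter> ?X = {}"
        using False insert.prems(4,5) nx by (auto simp: insert_commute)
      show "\<exists>s\<in>Set.insert x S. {l, s} \<in> E" if "l \<in> set ls" "l \<in> ?X" for l
      proof (cases "l \<in> X")
        case False
        hence "{l, x} \<in> E" using that(2) by (simp add: insert_commute)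
        thus ?thesis by blast
      qed (use insert.prems(6)[OF that(1)] in blast)
    qed (use insert.prems in auto)
    ultimately have 1: "weakly_regular (polys V) (colon (polys V) (face_ideal V ?N) (pvar x)) ?fs"
      by (simp add: colon_pvar[OF x(1)])
    have "?N \<union> {s. x \<in> s} = hits (Set.insert x X) \<union> edge_sets E"
      by (auto simp: hits_def)
    moreover have "weakly_regular (polys V) (face_ideal V (hits (Set.insert x X) \<union> edge_sets E)) ?fs"
      by (rule insert.IH[where S = S]) (use insert.prems False x in auto)
    ultimately have 2: "weakly_regular (polys V) (add_gen (polys V) (face_ideal V ?N) (pvar x)) ?fs"
      by (simp add: add_gen_pvar[OF x(1) up])
    have "set ?fs \<subseteq> polys V"
      using ls(2) G by (auto simp: closed_nbhd_def simple_graph_def intro!: sum_in_polys pvar_in_polys)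
    thus ?thesis
      using weakly_regular_colon[OF subring_polys ideal_in_face_ideal[OF up] pvar_in_polys[OF x(1)] _ 1 2]
      by blast
  qed
qed

text \<open>The regular sequence consists of the sums of variables over the closed neighbourhoods.
  The auxiliary lemma is entered with nothing decided: \<open>X\<close> and \<open>S\<close> are
  empty, and \<open>T\<close> holds the vertices outside \<open>L\<close>.\<close>

lemma graph_depth_ge:
  fixes V :: "'v::linorder set"
  assumes G: "simple_graph V E" and L: "L \<subseteq> V"
    and disj: "\<And>l l'. l \<in> L \<Longrightarrow> l' \<in> L \<Longrightarrow> l \<noteq> l' \<Longrightarrow> closed_nbhd E l \<inter> closed_nbhd E l' = {}"
  shows "enat (card L) \<le> graph_depth (K :: 'k::field itself) V E"
proof -
  have "finite V" using G by (simp add: simple_graph_def)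
  hence "finite L" using L finite_subset by blast
  then obtain ls where ls: "set ls = L" "distinct ls"
    using finite_distinct_list by blast
  let ?fs = "map (\<lambda>l. \<Sum>u\<in>closed_nbhd E l. pvar u) ls :: (('v \<Rightarrow>\<^sub>0 nat) \<Rightarrow>\<^sub>0 'k) list"
  let ?I = "face_ideal V (edge_sets E) :: (('v \<Rightarrow>\<^sub>0 nat) \<Rightarrow>\<^sub>0 'k) set"
  have "hits {} = ({} :: 'v set set)" by (simp add: hits_def)
  moreover have "weakly_regular (polys V)
      (face_ideal V (hits {} \<union> edge_sets E) :: (('v \<Rightarrow>\<^sub>0 nat) \<Rightarrow>\<^sub>0 'k) set) ?fs"
    by (rule weakly_regular_nbhd_sums_aux[OF G ls(2), where T = "V - L" and S = "{}"])
      (use ls L disj \<open>finite V\<close> in auto)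
  ultimately have reg: "weakly_regular (polys V) ?I ?fs" by simp
  have nb: "closed_nbhd E l \<subseteq> V" if "l \<in> L" for l
    using that L G by (auto simp: closed_nbhd_def simple_graph_def)
  have irr: "set ?fs \<subseteq> irrelevant_ideal V"
    using nb ls(1) by (auto intro!: ideal_in_sum[OF ideal_in_irrelevant_ideal] pvar_in_irrelevant_ideal)
  have "{} \<notin> E" using G by (auto simp: simple_graph_def)
  hence "?I \<subseteq> no_const V"
    by (auto simp: face_ideal_def no_const_def edge_sets_def)
  hence "add_gens (polys V) ?I ?fs \<subseteq> no_const V"
    using irr irrelevant_ideal_subset by (intro add_gens_minimal[OF ideal_in_no_const]) blast+
  moreover have "(1 :: ('v \<Rightarrow>\<^sub>0 nat) \<Rightarrow>\<^sub>0 'k) \<notin> no_const V"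
    by (simp add: no_const_def face_ideal_def)
  ultimately have "1 \<notin> add_gens (polys V) ?I ?fs" by blast
  hence "enat (length ?fs) \<le> graph_depth K V E"
    unfolding graph_depth_eq[OF G] using irr reg by (intro Sup_upper) blast
  thus ?thesis
    using ls by (simp add: distinct_card[symmetric])
qed

section \<open>Krull dimension\<close>

definition prime_in :: "'a::comm_ring_1 set \<Rightarrow> 'a set \<Rightarrow> bool" where
  "prime_in C P \<longleftrightarrow> ideal_in C P \<and> 1 \<notin> P \<and> (\<forall>x\<in>C. \<forall>y\<in>C. x * y \<in> P \<longrightarrow> x \<in> P \<or> y \<in> P)"

lemma prime_in_power:
  assumes "subring_set C" "prime_in C P" "f \<in> C" "f ^ k \<in> P"
  shows "f \<in> P"
  using assms(4)
proof (induction k)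
  case (Suc k)
  thus ?case
    using assms(2,3) subring_setD(7)[OF assms(1,3)] by (auto simp: prime_in_def)
qed (use assms(2) in \<open>simp add: prime_in_def\<close>)

text \<open>If the nested element lay in \<open>P 0\<close>, primeness would cancel the power of the
  head, which is outside \<open>P 0\<close>; modulo \<open>P 1\<close>, which contains the head,
  only the inner nested element remains. The descent would put 1 into the last prime.\<close>

lemma nest_prime_chain:
  assumes "subring_set C" "\<And>i. i \<le> length fs \<Longrightarrow> prime_in C (P i)"
    and "\<And>i. i < length fs \<Longrightarrow> P i \<subseteq> P (Suc i)"
    and "\<And>i. i < length fs \<Longrightarrow> fs ! i \<in> P (Suc i) - P i"
    and "g \<in> nest C fs"
  shows "g \<notin> P 0"
  using assms(2-5)
proof (induction fs arbitrary: P g)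
  case Nil
  thus ?case by (auto simp: prime_in_def)
next
  case (Cons f fs)
  have P0: "prime_in C (P 0)" and P1: "prime_in C (P 1)"
    using Cons.prems(1)[of 0] Cons.prems(1)[of 1] by auto
  have f: "f \<in> P 1" "f \<notin> P 0"
    using Cons.prems(3)[of 0] by auto
  note I1 = ideal_inD[of C "P 1"]
  have I: "ideal_in C (P 1)" using P1 by (simp add: prime_in_def)
  hence fC: "f \<in> C" using f I1 by blast
  have fs: "set fs \<subseteq> C"
  proof
    fix h assume "h \<in> set fs"
    then obtain i where i: "i < length fs" "h = fs ! i" by (auto simp: in_set_conv_nth)
    have "h \<in> P (Suc (Suc i))" "ideal_in C (P (Suc (Suc i)))"
      using Cons.prems(3)[of "Suc i"] Cons.prems(1)[of "Suc (Suc i)"] i by (auto simp: prime_in_def)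
    thus "h \<in> C" using ideal_inD(1) by blast
  qed
  obtain a g' h where g: "g = f ^ a * (g' + f * h)" "g' \<in> nest C fs" "h \<in> C"
    using Cons.prems(4) by auto
  have g'C: "g' \<in> C" using nest_subset[OF assms(1) fs] g(2) by blast
  have "g' \<notin> P (Suc 0)"
  proof (rule Cons.IH[OF _ _ _ g(2)])
    show "prime_in C (P (Suc i))" if "i \<le> length fs" for i
      using Cons.prems(1)[of "Suc i"] that by simp
    show "P (Suc i) \<subseteq> P (Suc (Suc i))" if "i < length fs" for i
      using Cons.prems(2)[of "Suc i"] that by simp
    show "fs ! i \<in> P (Suc (Suc i)) - P (Suc i)" if "i < length fs" for i
      using Cons.prems(3)[of "Suc i"] that by simp
  qed
  hence "g' \<notin> P 1" by simp
  show ?case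
  proof
    assume "g \<in> P 0"
    moreover have "f ^ a \<in> C" "g' + f * h \<in> C"
      by (rule subring_setD(7)[OF assms(1) fC], rule subring_setD(6)[OF assms(1) g'C subring_setD(4)[OF assms(1) fC g(3)]])
    ultimately have "f ^ a \<in> P 0 \<or> g' + f * h \<in> P 0"
      using P0 unfolding g(1) prime_in_def by blast
    hence "g' + f * h \<in> P 1"
      using prime_in_power[OF assms(1) P0 fC] f(2) Cons.prems(2)[of 0] by auto
    hence "(g' + f * h) - f * h \<in> P 1"
      by (rule ideal_in_diff[OF assms(1) I _ ideal_inD(4)[OF I f(1) g(3)]])
    thus False using \<open>g' \<notin> P 1\<close> by simp
  qed
qed

lemma var_ideal_least:
  fixes J :: "(('v \<Rightarrow>\<^sub>0 nat) \<Rightarrow>\<^sub>0 'k::field) set"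
  assumes J: "ideal_in (polys V) J" and X: "\<And>v. v \<in> V \<Longrightarrow> v \<in> X \<Longrightarrow> pvar v \<in> J"
  shows "face_ideal V (hits X) \<subseteq> J"
proof
  fix p :: "('v \<Rightarrow>\<^sub>0 nat) \<Rightarrow>\<^sub>0 'k" assume p: "p \<in> face_ideal V (hits X)"
  have "p \<in> polys V" using p ideal_inD(1)[OF ideal_in_var] by blast
  have "pvar v - (if v \<in> X then 0 else pvar v) \<in> J" if "v \<in> V" for v
    using X[OF that] ideal_inD(2)[OF J] by simp
  hence "p - kill X p \<in> J"
    unfolding kill_def using \<open>p \<in> polys V\<close>
    by (intro poly_subst_cong_mod[OF J]) (auto intro: pvar_in_polys polys_closed(2))
  thus "p \<in> J" using kill_eq_0_iff[OF \<open>p \<in> polys V\<close>, of X] p by simp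
qed

text \<open>The last conclusion recovers \<open>P\<close> from its contraction, so a strict chain in
  the quotient contracts to a strict chain of ideals of polynomials.\<close>

lemma primeideal_contraction:
  fixes I :: "(('v \<Rightarrow>\<^sub>0 nat) \<Rightarrow>\<^sub>0 'k::field) set"
  assumes I: "ideal_in (polys V) I" and P: "primeideal P (poly_ring V Quot I)"
  defines "Q \<equiv> {x \<in> polys V. I +>\<^bsub>poly_ring V\<^esub> x \<in> P}"
  shows "prime_in (polys V) Q" "I \<subseteq> Q" "P = (\<lambda>x. I +>\<^bsub>poly_ring V\<^esub> x) ` Q"
proof -
  interpret P: primeideal P "poly_ring V Quot I" by (rule P)
  let ?c = "\<lambda>x. I +>\<^bsub>poly_ring V\<^esub> x"
  have c: "?c x \<in> carrier (poly_ring V Quot I)" if "x \<in> polys V" for x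
    using that by (simp add: carrier_quotient)
  have zero: "\<zero>\<^bsub>poly_ring V Quot I\<^esub> = I" and one: "\<one>\<^bsub>poly_ring V Quot I\<^esub> = ?c 1"
    by (simp_all add: FactRing_def poly_ring_simps)
  have cI: "?c x = I" if "x \<in> I" for x
    using coset_eq_iff[OF I, of x 0] that by (simp add: coset_poly_ring)
  have "I \<in> P"
    using additive_subgroup.zero_closed[OF P.additive_subgroup_axioms] zero by simp
  thus "I \<subseteq> Q"
    using cI ideal_inD(1)[OF I] by (auto simp: Q_def)
  have "ideal_in (polys V) Q"
    unfolding ideal_in_def
  proof (intro conjI ballI)
    show "Q \<subseteq> polys V" by (auto simp: Q_def)
    show "0 \<in> Q" using \<open>I \<subseteq> Q\<close> ideal_inD(2)[OF I] by blast
  next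
    fix x y assume "x \<in> Q" "y \<in> Q"
    thus "x + y \<in> Q"
      using additive_subgroup.a_closed[OF P.additive_subgroup_axioms, of "?c x" "?c y"]
        quotient_add[OF I, of x y] polys_closed(6)[of x V y] by (simp add: Q_def)
  next
    fix x r :: "('v \<Rightarrow>\<^sub>0 nat) \<Rightarrow>\<^sub>0 'k" assume "x \<in> Q" "r \<in> polys V"
    thus "x * r \<in> Q"
      using P.I_r_closed[of "?c x" "?c r"] c quotient_mult[OF I, of x r] polys_closed(4)[of x V r]
      by (simp add: Q_def)
  qed
  moreover have "1 \<notin> Q"
    using P.one_imp_carrier P.I_notcarr by (auto simp: Q_def one)
  moreover have "x \<in> Q \<or> y \<in> Q" if "x \<in> polys V" "y \<in> polys V" "x * y \<in> Q" for x y
    using P.I_prime[OF c[OF that(1)] c[OF that(2)]] that quotient_mult[OF I that(1,2)]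
    by (simp add: Q_def)
  ultimately show "prime_in (polys V) Q"
    by (auto simp: prime_in_def)
  show "P = ?c ` Q"
    using P.Icarr by (fastforce simp: Q_def carrier_quotient)
qed

text \<open>Since \<open>Q\<close> contains \<open>I\<close>, membership does not depend on the
  representative. The second claim keeps chains strict when they pass to the quotient.\<close>

lemma primeideal_extension:
  assumes I: "ideal_in (polys V) I" and Q: "prime_in (polys V) Q" "I \<subseteq> Q"
  shows "primeideal ((\<lambda>x. I +>\<^bsub>poly_ring V\<^esub> x) ` Q) (poly_ring V Quot I)"
    and "x \<in> polys V \<Longrightarrow> I +>\<^bsub>poly_ring V\<^esub> x \<in> (\<lambda>x. I +>\<^bsub>poly_ring V\<^esub> x) ` Q \<longleftrightarrow> x \<in> Q"
proof -
  let ?c = "\<lambda>x. I +>\<^bsub>poly_ring V\<^esub> x"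
  have QI: "ideal_in (polys V) Q" using Q(1) by (simp add: prime_in_def)
  show mem: "?c x \<in> ?c ` Q \<longleftrightarrow> x \<in> Q" if "x \<in> polys V" for x
  proof
    assume "?c x \<in> ?c ` Q"
    then obtain y where y: "y \<in> Q" "x - y \<in> I" using coset_eq_iff[OF I] by blast
    have "(x - y) + y \<in> Q" using ideal_inD(3)[OF QI] y Q(2) by blast
    thus "x \<in> Q" by simp
  qed auto
  show "primeideal (?c ` Q) (poly_ring V Quot I)"
  proof (rule primeidealI)
    show "ideal (?c ` Q) (poly_ring V Quot I)"
      using ring.ring_ideal_imp_quot_ideal[OF ring_poly_ring, of I V Q] I QI by (simp add: ideal_poly_ring_iff)
    show "cring (poly_ring V Quot I)"
      using I by (intro ideal.quotient_is_cring[OF _ cring_poly_ring]) (simp add: ideal_poly_ring_iff)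
    have "?c 1 \<notin> ?c ` Q" "?c 1 \<in> carrier (poly_ring V Quot I)"
      using mem[OF polys_closed(1)] Q(1) polys_closed(1) by (auto simp: prime_in_def carrier_quotient)
    thus "carrier (poly_ring V Quot I) \<noteq> ?c ` Q" by blast
  next
    fix a b assume ab: "a \<in> carrier (poly_ring V Quot I)" "b \<in> carrier (poly_ring V Quot I)"
      "a \<otimes>\<^bsub>poly_ring V Quot I\<^esub> b \<in> ?c ` Q"
    then obtain x y where "a = ?c x" "b = ?c y" "x \<in> polys V" "y \<in> polys V"
      by (auto simp: carrier_quotient)
    thus "a \<in> ?c ` Q \<or> b \<in> ?c ` Q"
      using ab(3) mem quotient_mult[OF I, of x y] polys_closed(4)[of x V y] Q(1)
      by (auto simp: prime_in_def)
  qed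
qed

text \<open>For a chain \<open>Q 0\<close>, ..., \<open>Q n\<close> let \<open>X\<close> be the set
  of variables in \<open>Q 0\<close>. The other vertices are independent, since this prime contains
  every edge product, so at most \<open>d\<close> variables remain. If n > d, elements picked from
  the steps of the chain have a nested combination in (X), hence in \<open>Q 0\<close>, against
  \<open>nest_prime_chain\<close>.\<close>

lemma graph_dim_le:
  fixes V :: "'v set"
  assumes G: "simple_graph V E" and d: "\<And>F. F \<subseteq> V \<Longrightarrow> independent_set E F \<Longrightarrow> card F \<le> d"
  shows "graph_dim (K :: 'k::field itself) V E \<le> enat d"
proof -
  let ?I = "face_ideal V (edge_sets E) :: (('v \<Rightarrow>\<^sub>0 nat) \<Rightarrow>\<^sub>0 'k) set"
  have I: "ideal_in (polys V) ?I"
    by (rule ideal_in_face_ideal[OF upset_edge_sets])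
  have chain: "n \<le> d" if P: "\<And>i. i \<le> n \<Longrightarrow> primeideal (P i) (poly_ring V Quot ?I)"
    "\<And>i. i < n \<Longrightarrow> P i \<subset> P (Suc i)" for n :: nat and P
  proof (rule ccontr)
    assume "\<not> n \<le> d"
    define Q where "Q i = {x \<in> polys V. ?I +>\<^bsub>poly_ring V\<^esub> x \<in> P i}" for i
    have Q: "prime_in (polys V) (Q i)" "?I \<subseteq> Q i" "P i = (\<lambda>x. ?I +>\<^bsub>poly_ring V\<^esub> x) ` Q i"
      if "i \<le> n" for i
      using primeideal_contraction[OF I P(1)[OF that]] by (simp_all add: Q_def)
    have mono: "Q i \<subseteq> Q (Suc i)" if "i < n" for i
      using P(2)[OF that] by (auto simp: Q_def)
    have "\<forall>i\<in>{..<n}. \<exists>f. f \<in> Q (Suc i) - Q i"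
    proof
      fix i assume "i \<in> {..<n}"
      hence "P i = (\<lambda>x. ?I +>\<^bsub>poly_ring V\<^esub> x) ` Q i"
        "P (Suc i) = (\<lambda>x. ?I +>\<^bsub>poly_ring V\<^esub> x) ` Q (Suc i)" "P i \<subset> P (Suc i)"
        using Q(3)[of i] Q(3)[of "Suc i"] P(2)[of i] by auto
      hence "\<not> Q (Suc i) \<subseteq> Q i"
        using image_mono[of "Q (Suc i)" "Q i" "\<lambda>x. ?I +>\<^bsub>poly_ring V\<^esub> x"] by (simp add: less_le_not_le) blast
      thus "\<exists>f. f \<in> Q (Suc i) - Q i" by blast
    qed
    from bchoice[OF this] obtain f where f: "\<And>i. i < n \<Longrightarrow> f i \<in> Q (Suc i) - Q i"
      by auto
    define X where "X = {v \<in> V. pvar v \<in> Q 0}"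
    have Q0: "ideal_in (polys V) (Q 0)" using Q(1)[of 0] by (simp add: prime_in_def)
    have "independent_set E (V - X)"
      unfolding independent_set_def
    proof (intro ballI notI)
      fix e assume e: "e \<in> E" "e \<subseteq> V - X"
      obtain u v where uv: "e = {u, v}" "u \<noteq> v" "u \<in> V" "v \<in> V"
        using simple_graph_edgeD[OF G e(1)] .
      have "pvar u * pvar v \<in> ?I"
        using e(1) uv by (auto simp: face_ideal_def edge_sets_def keys_pvar_mult keys_add_nat
            intro!: bexI[of _ "{u, v}"])
      hence "pvar u * pvar v \<in> Q 0" using Q(2)[of 0] by blast
      moreover have "pvar u \<in> (polys V :: (('v \<Rightarrow>\<^sub>0 nat) \<Rightarrow>\<^sub>0 'k) set)"
        "pvar v \<in> (polys V :: (('v \<Rightarrow>\<^sub>0 nat) \<Rightarrow>\<^sub>0 'k) set)"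
        by (intro pvar_in_polys uv)+
      ultimately have "pvar u \<in> Q 0 \<or> pvar v \<in> Q 0"
        using Q(1)[of 0] by (simp add: prime_in_def)
      thus False using e(2) uv by (auto simp: X_def)
    qed
    hence "card (V - X) < n"
      using d[of "V - X"] \<open>\<not> n \<le> d\<close> by auto
    moreover have "set (map f [0..<n]) \<subseteq> polys V"
      using f by (fastforce simp: Q_def)
    ultimately obtain g where g: "g \<in> nest (polys V) (map f [0..<n])" "g \<in> face_ideal V (hits X)"
      using nest_meets_var_ideal[of V "map f [0..<n]" X] G by (auto simp: simple_graph_def)
    have "face_ideal V (hits X) \<subseteq> Q 0"
      by (rule var_ideal_least[OF Q0]) (auto simp: X_def)
    moreover have "g \<notin> Q 0"
      by (rule nest_prime_chain[OF subring_polys _ _ _ g(1)]) (use Q(1) mono f in auto)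
    ultimately show False using g(2) by blast
  qed
  show ?thesis
    unfolding graph_dim_def Let_def krull_dim_def edge_ideal_eq[OF G]
  proof (rule Sup_least, clarify)
    fix n and P :: "nat \<Rightarrow> (('v \<Rightarrow>\<^sub>0 nat) \<Rightarrow>\<^sub>0 'k) set set"
    assume "\<forall>i\<le>n. primeideal (P i) (poly_ring V Quot ?I)" "\<forall>i<n. P i \<subset> P (Suc i)"
    thus "enat n \<le> enat d" using chain[of n P] by simp
  qed
qed

lemma prime_in_var_ideal:
  fixes V :: "'v::linorder set"
  shows "prime_in (polys V) (face_ideal V (hits X))"
proof -
  have "1 \<notin> face_ideal V (hits X)" by (simp add: face_ideal_def hits_def)
  thus ?thesis
    unfolding prime_in_def using ideal_in_var var_ideal_prime by blast
qed

text \<open>The complement of \<open>F\<close> is a vertex cover, so its variables generate a prime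
  above the edge ideal. Adding the vertices of \<open>F\<close> one by one gives the chain.\<close>

lemma graph_dim_ge:
  fixes V :: "'v::linorder set"
  assumes G: "simple_graph V E" and F: "F \<subseteq> V" "independent_set E F"
  shows "enat (card F) \<le> graph_dim (K :: 'k::field itself) V E"
proof -
  let ?I = "face_ideal V (edge_sets E) :: (('v \<Rightarrow>\<^sub>0 nat) \<Rightarrow>\<^sub>0 'k) set"
  have I: "ideal_in (polys V) ?I"
    by (rule ideal_in_face_ideal[OF upset_edge_sets])
  have "finite F" using G F(1) finite_subset by (auto simp: simple_graph_def)
  then obtain xs where xs: "set xs = F" "distinct xs"
    using finite_distinct_list by blast
  hence len: "length xs = card F" using distinct_card by fastforce
  define X where "X i = (V - F) \<union> set (take i xs)" for i
  define Q where "Q i = (face_ideal V (hits (X i)) :: (('v \<Rightarrow>\<^sub>0 nat) \<Rightarrow>\<^sub>0 'k) set)" for i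
  have Q: "prime_in (polys V) (Q i)" for i
    unfolding Q_def by (rule prime_in_var_ideal)
  have IQ: "?I \<subseteq> Q i" for i
  proof -
    have "e \<inter> (V - F) \<noteq> {}" if "e \<in> E" for e
      using that G F(2) by (fastforce simp: independent_set_def simple_graph_def)
    thus ?thesis
      by (fastforce simp: Q_def face_ideal_def hits_def edge_sets_def X_def)
  qed
  let ?P = "\<lambda>i. (\<lambda>x. ?I +>\<^bsub>poly_ring V\<^esub> x) ` Q i"
  have "?P i \<subset> ?P (Suc i)" if "i < card F" for i
  proof -
    have i: "i < length xs" using that len by simp
    have v: "xs ! i \<in> F" using i xs(1) nth_mem by blast
    hence vV: "xs ! i \<in> V" using F(1) by blast
    have "X i \<subseteq> X (Suc i)" "xs ! i \<in> X (Suc i)"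
      using i by (auto simp: X_def take_Suc_conv_app_nth)
    hence "hits (X i) \<subseteq> hits (X (Suc i))" "pvar (xs ! i) \<in> Q (Suc i)"
      using vV by (auto simp: Q_def face_ideal_def hits_def pvar_def)
    hence "Q i \<subseteq> Q (Suc i)" "pvar (xs ! i) \<in> Q (Suc i)"
      unfolding Q_def face_ideal_def by blast+
    moreover have "xs ! i \<notin> X i"
      using v i xs(2) by (auto simp: X_def in_set_conv_nth nth_eq_iff_index_eq)
    hence "pvar (xs ! i) \<notin> Q i"
      by (auto simp: Q_def face_ideal_def hits_def pvar_def)
    hence "?I +>\<^bsub>poly_ring V\<^esub> pvar (xs ! i) \<notin> ?P i"
      using primeideal_extension(2)[OF I Q IQ pvar_in_polys[OF vV]] by simp
    ultimately show ?thesis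
      using image_mono[of "Q i" "Q (Suc i)"] imageI[of "pvar (xs ! i)" "Q (Suc i)"] by (metis psubsetI)
  qed
  hence "(\<forall>i\<le>card F. primeideal (?P i) (poly_ring V Quot ?I)) \<and> (\<forall>i<card F. ?P i \<subset> ?P (Suc i))"
    using primeideal_extension(1)[OF I Q IQ] by simp
  hence "\<exists>P :: nat \<Rightarrow> (('v \<Rightarrow>\<^sub>0 nat) \<Rightarrow>\<^sub>0 'k) set set.
      (\<forall>i\<le>card F. primeideal (P i) (poly_ring V Quot ?I)) \<and> (\<forall>i<card F. P i \<subset> P (Suc i))"
    by (rule exI[of _ ?P])
  thus ?thesis
    unfolding graph_dim_def Let_def krull_dim_def edge_ideal_eq[OF G]
    by (intro Sup_upper CollectI exI[of _ "card F"] conjI refl)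
qed

section \<open>Bounds for the attained pairs\<close>

text \<open>Counting through a relation: several witnesses per element are allowed as long as no two
  elements share one, so no function has to be written down.\<close>

lemma card_le_rel:
  assumes "finite B" "\<And>x. x \<in> A \<Longrightarrow> \<exists>y\<in>B. R x y"
    and "\<And>x x' y. x \<in> A \<Longrightarrow> x' \<in> A \<Longrightarrow> R x y \<Longrightarrow> R x' y \<Longrightarrow> x = x'"
  shows "card A \<le> card B"
proof -
  have "\<forall>x\<in>A. \<exists>y. y \<in> B \<and> R x y" using assms(2) by blast
  from bchoice[OF this] obtain h where h: "\<And>x. x \<in> A \<Longrightarrow> h x \<in> B \<and> R x (h x)" by blast
  have "inj_on h A"
    by (rule inj_onI) (metis h assms(3))
  thus ?thesis
    using h by (intro card_inj_on_le[OF _ _ assms(1)]) auto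
qed

lemma ex_maximum_independent:
  assumes G: "simple_graph V E"
  obtains A where "A \<subseteq> V" "independent_set E A" "dominating V E A"
    "\<forall>F. F \<subseteq> V \<longrightarrow> independent_set E F \<longrightarrow> card F \<le> card A"
proof -
  have fin: "finite V" using G by (simp add: simple_graph_def)
  let ?P = "\<lambda>F. F \<subseteq> V \<and> independent_set E F"
  have "{} \<notin> E" using G by (auto simp: simple_graph_def)
  hence "?P {}" by (auto simp: independent_set_def)
  moreover have "\<forall>F. ?P F \<longrightarrow> card F < card V + 1"
    using fin card_mono by (metis Suc_eq_plus1 less_Suc_eq_le)
  ultimately obtain A where A: "?P A" "\<And>F. ?P F \<Longrightarrow> card F \<le> card A"
    using ex_has_greatest_nat[of ?P "{}" card "card V + 1"] by blast
  have "dominating V E A"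
    unfolding dominating_def
  proof
    fix v assume v: "v \<in> V - A"
    have "card (insert v A) = card A + 1"
      using v A(1) fin finite_subset by (metis DiffD2 Suc_eq_plus1 card_insert_disjoint)
    hence "\<not> ?P (insert v A)"
      using A(2)[of "insert v A"] by auto
    then obtain e where e: "e \<in> E" "e \<subseteq> insert v A"
      using v A(1) by (auto simp: independent_set_def)
    moreover have "\<not> e \<subseteq> A" using e(1) A(1) by (auto simp: independent_set_def)
    moreover obtain x y where "e = {x, y}" "x \<noteq> y"
      using simple_graph_edgeD[OF G e(1)] .
    ultimately show "\<exists>u\<in>A. {u, v} \<in> E"
      by (auto simp: insert_commute)
  qed
  thus thesis using A by (intro that) auto
qed

lemma graph_dim_eqI:
  fixes V :: "'v::linorder set"
  assumes "simple_graph V E" "A \<subseteq> V" "independent_set E A"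
    and "\<And>F. F \<subseteq> V \<Longrightarrow> independent_set E F \<Longrightarrow> card F \<le> card A"
  shows "graph_dim K V E = enat (card A)"
  using graph_dim_le[OF assms(1,4)] graph_dim_ge[OF assms(1-3)] by (intro antisym) auto

text \<open>A maximum independent set is in particular maximal, so its size bounds the depth from
  above and equals the dimension.\<close>

lemma graph_depth_le_dim:
  fixes V :: "'v::linorder set"
  assumes G: "simple_graph V E"
  obtains a b where "graph_depth K V E = enat a" "graph_dim K V E = enat b" "a \<le> b" "b \<le> card V"
proof -
  obtain A where A: "A \<subseteq> V" "independent_set E A" "dominating V E A"
    "\<forall>F. F \<subseteq> V \<longrightarrow> independent_set E F \<longrightarrow> card F \<le> card A"
    using ex_maximum_independent[OF G] .
  have "card A \<le> card V"
    using A(1) G by (intro card_mono) (auto simp: simple_graph_def)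
  moreover obtain a where "graph_depth K V E = enat a" "a \<le> card A"
    using graph_depth_le[OF G A(1-3), of K] by (metis enat_ile enat_ord_simps(1))
  moreover have "graph_dim K V E = enat (card A)"
    using graph_dim_eqI[OF G A(1,2)] A(4) by blast
  ultimately show thesis using that by blast
qed

section \<open>Pairs attained by all graphs\<close>

lemma Graph_depth_dim_subset:
  "Graph_depth_dim K n \<subseteq> map_prod enat enat ` {(a, b). a \<le> b \<and> b \<le> n}"
proof
  fix q assume "q \<in> Graph_depth_dim K n"
  then obtain V E where VE: "q = (graph_depth K V E, graph_dim K V E)"
    "simple_graph (V :: nat set) E" "card V = n"
    by (auto simp: Graph_depth_dim_def)
  then obtain a b where "graph_depth K V E = enat a" "graph_dim K V E = enat b" "a \<le> b" "b \<le> n"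
    using graph_depth_le_dim by metis
  thus "q \<in> map_prod enat enat ` {(a, b). a \<le> b \<and> b \<le> n}"
    using VE(1) by (intro image_eqI[of _ _ "(a, b)"]) auto
qed

text \<open>The witness consists of \<open>a - 1\<close> isolated vertices and of the join of a complete graph on
  \<open>n - b\<close> vertices with \<open>b - a + 1\<close> independent ones.\<close>

lemma Graph_depth_dim_mem:
  assumes "1 \<le> a" "a \<le> b" "b < n"
  shows "(enat a, enat b) \<in> Graph_depth_dim K n"
proof -
  define V where "V = {..<n}"
  define E where "E = {{i, j} | i j. i < n - b \<and> i < j \<and> j \<le> n - a}"
  have E_iff: "{i, j} \<in> E \<longleftrightarrow> i \<noteq> j \<and> min i j < n - b \<and> max i j \<le> n - a" for i j
  proof
    assume r: "i \<noteq> j \<and> min i j < n - b \<and> max i j \<le> n - a"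
    show "{i, j} \<in> E"
    proof (cases "i < j")
      case True
      thus ?thesis using r unfolding E_def by (auto simp: min_def max_def)
    next
      case False
      hence "{j, i} \<in> E" using r unfolding E_def
        by (intro CollectI exI[of _ j] exI[of _ i]) (auto simp: min_def max_def)
      thus ?thesis by (simp add: insert_commute)
    qed
  qed (auto simp: E_def doubleton_eq_iff)
  have G: "simple_graph V E"
    using assms by (auto simp: simple_graph_def V_def E_def)
  have "graph_depth K V E = enat a"
  proof (rule antisym)
    \<comment> \<open>Vertex 0 belongs to the clique because \<open>b < n\<close>; it dominates the
      join, and the vertices above \<open>n - a\<close> are isolated.\<close>
    let ?F = "insert 0 {n - a + 1..<n}"
    have "card ?F = a" using assms by simp
    moreover have "graph_depth K V E \<le> enat (card ?F)"
    proof (rule graph_depth_le[OF G])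
      show "?F \<subseteq> V" using assms by (auto simp: V_def)
      show "independent_set E ?F" using assms by (auto simp: independent_set_def E_def)
      show "dominating V E ?F"
        unfolding dominating_def
      proof
        fix v assume v: "v \<in> V - ?F"
        hence "{0, v} \<in> E" using assms by (auto simp: V_def E_iff)
        thus "\<exists>u\<in>?F. {u, v} \<in> E" by blast
      qed
    qed
    ultimately show "graph_depth K V E \<le> enat a" by simp
    \<comment> \<open>The isolated vertices together with one vertex of the join,
      \<open>n - a\<close>.\<close>
    let ?L = "{n - a..<n}"
    have nb: "closed_nbhd E l = {l}" if "n - a < l" for l
      using that by (auto simp: closed_nbhd_def E_iff)
    have nb': "closed_nbhd E (n - a) \<subseteq> {..n - a}"
      by (auto simp: closed_nbhd_def E_iff)
    have "enat (card ?L) \<le> graph_depth K V E"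
    proof (rule graph_depth_ge[OF G])
      fix l l' assume l: "l \<in> ?L" "l' \<in> ?L" "l \<noteq> l'"
      hence "n - a < l \<or> l = n - a" "n - a < l' \<or> l' = n - a" by auto
      thus "closed_nbhd E l \<inter> closed_nbhd E l' = {}"
        using nb[of l] nb[of l'] nb' l(3) by (elim disjE) auto
    qed (auto simp: V_def)
    thus "enat a \<le> graph_depth K V E" using assms by simp
  qed
  moreover have "graph_dim K V E = enat (card {n - b..<n})"
  proof (rule graph_dim_eqI[OF G])
    show "{n - b..<n} \<subseteq> V" by (auto simp: V_def)
    show "independent_set E {n - b..<n}" by (auto simp: independent_set_def E_def)
    fix F assume F: "F \<subseteq> V" "independent_set E F"
    show "card F \<le> card {n - b..<n}"
    proof (cases "F \<subseteq> {n - b..<n}")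
      case False
      then obtain x where x: "x \<in> F" "x < n - b" using F(1) by (fastforce simp: V_def)
      \<comment> \<open>An independent set that meets the clique contains no other vertex of the
        join, so it has at most \<open>a\<close> elements.\<close>
      have "F \<subseteq> insert x {n - a + 1..<n}"
      proof
        fix y assume y: "y \<in> F"
        have "{x, y} \<notin> E" using F(2) x(1) y by (auto simp: independent_set_def)
        thus "y \<in> insert x {n - a + 1..<n}"
          using x y F(1) assms by (fastforce simp: E_iff V_def)
      qed
      hence "card F \<le> card (insert x {n - a + 1..<n})" by (intro card_mono) auto
      also have "\<dots> \<le> Suc (card {n - a + 1..<n})" by (rule card_insert_le_m1) auto
      finally show ?thesis using assms by simp
    qed (rule card_mono, simp)
  qed
  moreover have "card {n - b..<n} = b" using assms by simp
  ultimately show ?thesis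
    unfolding Graph_depth_dim_def using G by (force simp: V_def)
qed

section \<open>Matchings and the bounds for Cameron-Walker graphs\<close>

lemma finite_matching_cards:
  assumes "finite E"
  shows "finite {card M | M. matching E M}" "finite {card M | M. induced_matching E M}"
proof -
  have "{card M | M. matching E M} \<subseteq> card ` Pow E" "{card M | M. induced_matching E M} \<subseteq> card ` Pow E"
    by (auto simp: matching_def induced_matching_def)
  thus "finite {card M | M. matching E M}" "finite {card M | M. induced_matching E M}"
    using assms by (meson finite_Pow_iff finite_imageI finite_subset)+
qed

lemma card_matching_Union:
  assumes "simple_graph V E" "matching E M"
  shows "card (\<Union>M) = 2 * card M"
proof -
  have card2: "card e = 2" if "e \<in> M" for e
    using that assms by (auto simp: simple_graph_def matching_def)
  have "card (\<Union>M) = (\<Sum>e\<in>M. card e)"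
  proof (rule card_Union_disjoint)
    show "pairwise disjnt M"
      using assms(2) by (auto simp: matching_def pairwise_def disjnt_def)
    show "finite e" if "e \<in> M" for e
      using card2[OF that] by (metis card.infinite zero_neq_numeral)
  qed
  thus ?thesis using card2 by simp
qed

text \<open>A maximum matching that is induced has no augmenting path. Hence one endpoint of each of its edges
  sees every unmatched vertex that the edge sees, and these endpoints form a maximal independent set.\<close>

lemma cameron_walker_independent_sets:
  assumes cw: "cameron_walker V E"
  obtains \<mu> Z W where "Z \<subseteq> V" "independent_set E Z" "dominating V E Z" "card Z = \<mu>"
    "W \<subseteq> V" "independent_set E W" "card W + 2 * \<mu> = card V"
    "\<forall>F. F \<subseteq> V \<longrightarrow> independent_set E F \<longrightarrow> card F + \<mu> \<le> card V"
proof -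
  have G: "simple_graph V E" and conn: "connected_graph V E"
    and eq: "matching_number E = induced_matching_number E" and "\<not> is_star V E"
    using cw by (auto simp: cameron_walker_def)
  have finV: "finite V" and sub: "\<And>e. e \<in> E \<Longrightarrow> e \<subseteq> V" and c2: "\<And>e. e \<in> E \<Longrightarrow> card e = 2"
    using G by (auto simp: simple_graph_def)
  have finE: "finite E"
    using finV sub by (intro finite_subset[of E "Pow V"]) auto
  note fin = finite_matching_cards[OF finE]
  have "induced_matching_number E \<in> {card M | M. induced_matching E M}"
    unfolding induced_matching_number_def
    by (rule Max_in[OF fin(2)]) (auto simp: induced_matching_def matching_def intro!: exI[of _ "{}"])
  then obtain M where M: "induced_matching E M" "card M = induced_matching_number E" by auto
  have max: "card M' \<le> card M" if "matching E M'" for M'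
    unfolding M(2) eq[symmetric] matching_number_def
    by (rule Max_ge[OF fin(1)]) (use that in blast)
  have mM: "matching E M" using M(1) by (simp add: induced_matching_def)
  have ME: "M \<subseteq> E" and disj: "\<And>e f. e \<in> M \<Longrightarrow> f \<in> M \<Longrightarrow> e \<noteq> f \<Longrightarrow> e \<inter> f = {}"
    using mM by (auto simp: matching_def)
  have ind: "\<not> (g \<inter> e \<noteq> {} \<and> g \<inter> f \<noteq> {})" if "e \<in> M" "f \<in> M" "e \<noteq> f" "g \<in> E" for e f g
    using M(1) that by (auto simp: induced_matching_def)
  have finM: "finite M" using ME finE finite_subset by blast
  define W where "W = V - \<Union>M"
  have UM: "\<Union>M \<subseteq> V" using ME sub by blast
  have cardW: "card W + 2 * card M = card V"
    using card_matching_Union[OF G mM] card_Diff_subset[OF finite_subset[OF UM finV] UM]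
      card_mono[OF finV UM] by (simp add: W_def)
  have W: "independent_set E W"
    unfolding independent_set_def
  proof (intro ballI notI)
    fix e assume e: "e \<in> E" "e \<subseteq> W"
    have "e \<noteq> {}" using c2[OF e(1)] by auto
    have "e \<inter> f = {}" if "f \<in> M" for f using e(2) that by (auto simp: W_def)
    hence "matching E (insert e M)" "e \<notin> M"
      using mM e(1) \<open>e \<noteq> {}\<close> by (auto simp: matching_def Int_commute)
    thus False using max[of "insert e M"] finM by simp
  qed
  \<comment> \<open>For distinct \<open>w\<close> and \<open>w'\<close> the path from
    \<open>w\<close> over \<open>x\<close> and \<open>y\<close> to \<open>w'\<close> augments
    \<open>M\<close>: replacing the middle edge by the two outer ones gives a larger
    matching.\<close>
  have aug: "w = w'" if xy: "{x, y} \<in> M" and "x \<noteq> y" and "w \<in> W" "w' \<in> W" "{x, w} \<in> E" "{y, w'} \<in> E" for x y w w'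
  proof (rule ccontr)
    assume "w \<noteq> w'"
    let ?N = "M - {{x, y}}"
    have xw: "x \<in> \<Union>M" "y \<in> \<Union>M" using xy by blast+
    have w: "w \<notin> \<Union>M" "w' \<notin> \<Union>M" using that by (auto simp: W_def)
    have ne: "x \<noteq> w" "y \<noteq> w'" "x \<noteq> w'" "y \<noteq> w" using xw w by blast+
    have N: "x \<notin> f" "y \<notin> f" "w \<notin> f" "w' \<notin> f" if "f \<in> ?N" for f
      using disj[OF xy, of f] that w by auto
    have "matching E (insert {x, w} (insert {y, w'} ?N))"
      using mM that N ne \<open>w \<noteq> w'\<close> unfolding matching_def by (auto simp: insert_commute)
    moreover have "{x, w} \<notin> insert {y, w'} ?N" "{y, w'} \<notin> ?N"
      using N[of "{x, w}"] N[of "{y, w'}"] ne \<open>x \<noteq> y\<close> \<open>w \<noteq> w'\<close> by (auto simp: doubleton_eq_iff)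
    moreover have "card ?N + 1 = card M"
      using card_Suc_Diff1[OF finM xy] by simp
    ultimately show False
      using max[of "insert {x, w} (insert {y, w'} ?N)"] finM by simp
  qed
  have "\<forall>e\<in>M. \<exists>z. z \<in> e \<and> (\<forall>w\<in>W. \<forall>u\<in>e. {u, w} \<in> E \<longrightarrow> {z, w} \<in> E)"
  proof
    fix e assume e: "e \<in> M"
    then obtain x y where xy: "e = {x, y}" "x \<noteq> y" using simple_graph_edgeD[OF G] ME by (metis subsetD)
    show "\<exists>z. z \<in> e \<and> (\<forall>w\<in>W. \<forall>u\<in>e. {u, w} \<in> E \<longrightarrow> {z, w} \<in> E)"
    \<comment> \<open>If some unmatched vertex is seen by \<open>y\<close> but not by
      \<open>x\<close>, then by \<open>aug\<close> no unmatched vertex is seen by \<open>x\<close>,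
      and \<open>y\<close> is chosen; otherwise \<open>x\<close> is.\<close>
    proof (cases "\<exists>w\<in>W. {y, w} \<in> E \<and> {x, w} \<notin> E")
      case True
      then obtain w where w: "w \<in> W" "{y, w} \<in> E" "{x, w} \<notin> E" by blast
      have "{y, w'} \<in> E" if "w' \<in> W" "{x, w'} \<in> E" for w'
        using aug[of x y w' w] e xy that w by auto
      thus ?thesis using xy by blast
    next
      case False
      thus ?thesis using xy by blast
    qed
  qed
  from bchoice[OF this] obtain z where z: "\<And>e. e \<in> M \<Longrightarrow> z e \<in> e"
    "\<And>e w u. e \<in> M \<Longrightarrow> w \<in> W \<Longrightarrow> u \<in> e \<Longrightarrow> {u, w} \<in> E \<Longrightarrow> {z e, w} \<in> E" by blast
  have inj: "inj_on z M"
    by (rule inj_onI) (metis disj disjoint_iff z(1))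
  \<comment> \<open>By connectedness an isolated vertex is the whole graph, which is excluded
    because a single vertex counts as a star.\<close>
  have no_isolated: "\<exists>u. {v, u} \<in> E" if v: "v \<in> V" for v
  proof (rule ccontr)
    assume no: "\<nexists>u. {v, u} \<in> E"
    have "u = v" if u: "u \<in> V" for u
    proof (rule ccontr)
      assume "u \<noteq> v"
      have "(v, u) \<in> {(x, y). {x, y} \<in> E}\<^sup>*"
        using conn u v by (auto simp: connected_graph_def)
      thus False using \<open>u \<noteq> v\<close> no by (auto elim: converse_rtranclE)
    qed
    hence "V = {v}" using v by blast
    moreover from this have "E = {}"
    proof -
      have False if "e \<in> E" for e
        using sub[OF that] c2[OF that] card_mono[of "{v}" e] \<open>V = {v}\<close> by simp
      thus ?thesis by blast
    qed
    ultimately show False using \<open>\<not> is_star V E\<close> by (auto simp: is_star_def)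
  qed
  show thesis
  proof (rule that[of "z ` M" "card M" W])
    show "z ` M \<subseteq> V" using z(1) UM by blast
    show "card (z ` M) = card M" using inj by (rule card_image)
    show "W \<subseteq> V" by (auto simp: W_def)
    show "independent_set E W" by (rule W)
    show "card W + 2 * card M = card V" by (rule cardW)
    \<comment> \<open>Distinct chosen endpoints belong to different edges of \<open>M\<close>, which
      no edge joins since \<open>M\<close> is induced.\<close>
    show "independent_set E (z ` M)"
      unfolding independent_set_def
    proof (intro ballI notI)
      fix g assume g: "g \<in> E" "g \<subseteq> z ` M"
      obtain a b where ab: "g = {a, b}" "a \<noteq> b" using simple_graph_edgeD[OF G g(1)] .
      then obtain e f where "e \<in> M" "f \<in> M" "a = z e" "b = z f" using g(2) by auto
      thus False using ind[of e f g] g(1) ab z(1) by auto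
    qed
    show "dominating V E (z ` M)"
      unfolding dominating_def
    proof
      fix v assume v: "v \<in> V - z ` M"
      show "\<exists>u\<in>z ` M. {u, v} \<in> E"
      proof (cases "v \<in> \<Union>M")
        case True
        then obtain e where e: "e \<in> M" "v \<in> e" by blast
        have eE: "e \<in> E" using e(1) ME by blast
        obtain x y where xy: "e = {x, y}" using simple_graph_edgeD[OF G eE] by blast
        have "z e \<noteq> v" using e(1) v by blast
        moreover have "z e = x \<or> z e = y" "v = x \<or> v = y"
          using e(2) z(1)[OF e(1)] unfolding xy by simp_all
        ultimately have "{z e, v} = {x, y}" by (elim disjE) (simp_all add: insert_commute)
        hence "{z e, v} = e" by (simp only: xy)
        hence "{z e, v} \<in> E" using eE by simp
        thus ?thesis using e(1) by blast
      next
        case False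
        hence vW: "v \<in> W" using v by (auto simp: W_def)
        obtain u where u: "{v, u} \<in> E" using no_isolated v by blast
        hence "u \<notin> W" using W vW by (auto simp: independent_set_def)
        moreover have "u \<in> V" using sub[OF u] by simp
        ultimately obtain e where "e \<in> M" "u \<in> e" by (auto simp: W_def)
        hence "{z e, v} \<in> E" using z(2)[of e v u] vW u by (simp add: insert_commute)
        thus ?thesis using \<open>e \<in> M\<close> by blast
      qed
    qed
    show "\<forall>F. F \<subseteq> V \<longrightarrow> independent_set E F \<longrightarrow> card F + card M \<le> card V"
    proof (intro allI impI)
      fix F assume F: "F \<subseteq> V" "independent_set E F"
      \<comment> \<open>Each edge of \<open>M\<close> has an end outside the independent set
        \<open>F\<close>, and disjoint edges have distinct ends.\<close>
      have "card M \<le> card (V - F)"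
      proof (rule card_le_rel[where R = "\<lambda>e v. v \<in> e"])
        show "finite (V - F)" using finV by simp
        show "\<exists>v\<in>V - F. v \<in> e" if "e \<in> M" for e
          using that F(2) ME sub by (fastforce simp: independent_set_def)
        show "e = f" if "e \<in> M" "f \<in> M" "v \<in> e" "v \<in> f" for e f v
          using disj[of e f] that by blast
      qed
      moreover have "card (V - F) = card V - card F" "card F \<le> card V"
        using F(1) finV by (simp_all add: card_Diff_subset finite_subset card_mono)
      ultimately show "card F + card M \<le> card V" by simp
    qed
  qed
qed

text \<open>The matching number \<mu> satisfies a \<le> \<mu> \<le> b, card W \<le> b and b + \<mu>
  \<le> n. The last condition on the pair comes from n = card W + 2 \<mu> \<le> 3 b.\<close>

lemma CW_depth_dim_subset:
  "CW_depth_dim K n \<subseteq> map_prod enat enat ` {(a, b). a \<le> b \<and> a + b \<le> n \<and> n \<le> 3 * b}"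
proof
  fix q assume "q \<in> CW_depth_dim K n"
  then obtain V E where VE: "q = (graph_depth K V E, graph_dim K V E)"
    "cameron_walker (V :: nat set) E" "card V = n"
    by (auto simp: CW_depth_dim_def)
  have G: "simple_graph V E" using VE(2) by (simp add: cameron_walker_def)
  obtain \<mu> Z W where ZW: "Z \<subseteq> V" "independent_set E Z" "dominating V E Z" "card Z = \<mu>"
    "W \<subseteq> V" "independent_set E W" "card W + 2 * \<mu> = card V"
    "\<forall>F. F \<subseteq> V \<longrightarrow> independent_set E F \<longrightarrow> card F + \<mu> \<le> card V"
    using cameron_walker_independent_sets[OF VE(2)] .
  obtain a b where ab: "graph_depth K V E = enat a" "graph_dim K V E = enat b" "a \<le> b"
    using graph_depth_le_dim[OF G] .
  have "a \<le> \<mu>" using graph_depth_le[OF G ZW(1-3), of K] ZW(4) ab(1) by simp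
  moreover have "\<mu> \<le> b" "card W \<le> b"
    using graph_dim_ge[OF G ZW(1,2), of K] graph_dim_ge[OF G ZW(5,6), of K] ZW(4) ab(2) by simp_all
  moreover have "b + \<mu> \<le> n"
  proof -
    have "card F \<le> n - \<mu>" if "F \<subseteq> V" "independent_set E F" for F
    proof -
      have "card F + \<mu> \<le> card V" using ZW(8) that by blast
      thus ?thesis using VE(3) by simp
    qed
    hence "graph_dim K V E \<le> enat (n - \<mu>)"
      by (rule graph_dim_le[OF G])
    thus ?thesis using ab(2) ZW(7) VE(3) by simp
  qed
  ultimately have "a \<le> b \<and> a + b \<le> n \<and> n \<le> 3 * b"
    using ab(3) ZW(7) VE(3) by linarith
  thus "q \<in> map_prod enat enat ` {(a, b). a \<le> b \<and> a + b \<le> n \<and> n \<le> 3 * b}"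
    using VE(1) ab(1,2) by (intro image_eqI[of _ _ "(a, b)"]) auto
qed

section \<open>A family of Cameron--Walker graphs\<close>

text \<open>The relation \<open>R\<close> covers the edges by \<open>card M\<close> families of
  pairwise meeting edges. A matching takes at most one edge from each, so none is larger than the
  induced matching \<open>M\<close>.\<close>

lemma matching_numbers_eqI:
  assumes "finite E" "induced_matching E M" "\<And>e. e \<in> E \<Longrightarrow> \<exists>f\<in>M. R e f"
    and "\<And>e e' f. e \<in> E \<Longrightarrow> e' \<in> E \<Longrightarrow> R e f \<Longrightarrow> R e' f \<Longrightarrow> e \<inter> e' \<noteq> {}"
  shows "matching_number E = induced_matching_number E"
proof -
  note fin = finite_matching_cards[OF assms(1)]
  have M: "matching E M" using assms(2) by (simp add: induced_matching_def)
  have "finite M" using M assms(1) finite_subset by (auto simp: matching_def)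
  have le: "card M' \<le> card M" if "matching E M'" for M'
  proof (rule card_le_rel[OF \<open>finite M\<close>, where R = R])
    show "\<exists>f\<in>M. R e f" if "e \<in> M'" for e
      using assms(3) \<open>matching E M'\<close> that by (auto simp: matching_def)
    show "e = e'" if "e \<in> M'" "e' \<in> M'" "R e f" "R e' f" for e e' f
      using assms(4)[of e e' f] \<open>matching E M'\<close> that unfolding matching_def by blast
  qed
  have "matching_number E = card M"
    unfolding matching_number_def by (rule Max_eqI[OF fin(1)]) (use le M in auto)
  moreover have "induced_matching_number E = card M"
    unfolding induced_matching_number_def
    by (rule Max_eqI[OF fin(2)]) (use le assms(2) in \<open>auto simp: induced_matching_def\<close>)
  ultimately show ?thesis by simp
qed

text \<open>The hubs and the centre and apices are the two sides of the bipartite graph: every hub is joined to the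
  centre, every apex to hub 0 only. Hub 0 has a single leaf, so taking this leaf, all other hubs and all
  apices gives a small maximal independent set.\<close>

datatype cw_vertex = Centre | Hub nat | Apex nat | Leaf nat | TriA nat | TriB nat

text \<open>The sets of pairs range over graphs on the natural numbers, so the vertices are encoded
  there by the injection \<open>to_nat\<close>.\<close>

instance cw_vertex :: countable
  by countable_datatype

abbreviation "cz \<equiv> to_nat Centre"
abbreviation "cu i \<equiv> to_nat (Hub i)"
abbreviation "cv i \<equiv> to_nat (Apex i)"
abbreviation "cl i \<equiv> to_nat (Leaf i)"
abbreviation "cx i \<equiv> to_nat (TriA i)"
abbreviation "cy i \<equiv> to_nat (TriB i)"

definition cw_V :: "nat \<Rightarrow> nat \<Rightarrow> nat \<Rightarrow> nat \<Rightarrow> nat set" where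
  "cw_V m p s t = {cz} \<union> (\<lambda>i. cu i) ` {..<m} \<union> (\<lambda>i. cv i) ` {..<p} \<union> (\<lambda>i. cl i) ` {..<s}
     \<union> (\<lambda>i. cx i) ` {..<t} \<union> (\<lambda>i. cy i) ` {..<t}"

text \<open>The truncation \<open>min k (m - 1)\<close> puts leaf \<open>k\<close> on hub
  \<open>k\<close> and all surplus leaves on the last hub; \<open>min k (p - 1)\<close> does the
  same for triangles and apices. So \<open>s\<close> and \<open>t\<close> can grow beyond
  \<open>m\<close> and \<open>p\<close>, and hub 0 keeps a single leaf once there are two
  hubs.\<close>

definition cw_E :: "nat \<Rightarrow> nat \<Rightarrow> nat \<Rightarrow> nat \<Rightarrow> nat set set" where
  "cw_E m p s t = (\<lambda>i. {cz, cu i}) ` {..<m} \<union> (\<lambda>j. {cu 0, cv j}) ` {..<p}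
     \<union> (\<lambda>k. {cu (min k (m - 1)), cl k}) ` {..<s} \<union> (\<lambda>k. {cv (min k (p - 1)), cx k}) ` {..<t}
     \<union> (\<lambda>k. {cv (min k (p - 1)), cy k}) ` {..<t} \<union> (\<lambda>k. {cx k, cy k}) ` {..<t}"

lemma cw_E_cases:
  assumes "e \<in> cw_E m p s t"
  obtains (centre) i where "e = {cz, cu i}" "i < m"
    | (apex) j where "e = {cu 0, cv j}" "j < p"
    | (leaf) k where "e = {cu (min k (m - 1)), cl k}" "k < s"
    | (tri1) k where "e = {cv (min k (p - 1)), cx k}" "k < t"
    | (tri2) k where "e = {cv (min k (p - 1)), cy k}" "k < t"
    | (tri3) k where "e = {cx k, cy k}" "k < t"
  using assms unfolding cw_E_def by blast

lemma cw_E_intros: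
  "i < m \<Longrightarrow> {cz, cu i} \<in> cw_E m p s t"
  "j < p \<Longrightarrow> {cu 0, cv j} \<in> cw_E m p s t"
  "k < s \<Longrightarrow> {cu (min k (m - 1)), cl k} \<in> cw_E m p s t"
  "l < t \<Longrightarrow> {cv (min l (p - 1)), cx l} \<in> cw_E m p s t"
  "l < t \<Longrightarrow> {cv (min l (p - 1)), cy l} \<in> cw_E m p s t"
  "l < t \<Longrightarrow> {cx l, cy l} \<in> cw_E m p s t"
  unfolding cw_E_def by blast+

lemma cw_nbhd:
  "{cl k, v} \<in> cw_E m p s t \<longleftrightarrow> k < s \<and> v = cu (min k (m - 1))"
  "{cy k, v} \<in> cw_E m p s t \<longleftrightarrow> k < t \<and> (v = cv (min k (p - 1)) \<or> v = cx k)"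
  by (auto simp: cw_E_def image_iff doubleton_eq_iff)

text \<open>Every hub gets a leaf and every apex a triangle. A second hub is required so that the
  small maximal independent set, which omits hub 0, still dominates the centre and the surplus
  leaves.\<close>

context
  fixes m p s t :: nat
  assumes size: "2 \<le> m" "1 \<le> p" "m \<le> s" "p \<le> t"
begin

abbreviation (input) "V \<equiv> cw_V m p s t"
abbreviation (input) "E \<equiv> cw_E m p s t"

lemma cw_simple: "simple_graph V E"
proof -
  have "e \<subseteq> V \<and> card e = 2" if "e \<in> E" for e
    using that size by (elim cw_E_cases[where m = m]) (auto simp: cw_V_def)
  moreover have "finite V" by (simp add: cw_V_def)
  ultimately show ?thesis by (simp add: simple_graph_def)
qed

lemma card_cw_V: "card V = 1 + m + p + s + 2 * t"
proof -
  have "card ((\<lambda>i. cu i) ` {..<m}) = m" "card ((\<lambda>i. cv i) ` {..<p}) = p" "card ((\<lambda>i. cl i) ` {..<s}) = s"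
    "card ((\<lambda>i. cx i) ` {..<t}) = t" "card ((\<lambda>i. cy i) ` {..<t}) = t"
    by (simp_all add: card_image inj_on_def)
  thus ?thesis
    unfolding cw_V_def by (subst card_Un_disjoint, simp, simp, force)+ simp
qed

lemma cw_connected: "connected_graph V E"
proof -
  let ?R = "{(x, y). {x, y} \<in> E}"
  have "sym (?R\<^sup>*)"
    by (intro sym_rtrancl) (auto simp: sym_def insert_commute)
  have step: "(x, cz) \<in> ?R\<^sup>*" if "{y, x} \<in> E" "(y, cz) \<in> ?R\<^sup>*" for x y
    using that by (intro converse_rtrancl_into_rtrancl[OF _ that(2)]) (simp add: insert_commute)
  have u: "(cu i, cz) \<in> ?R\<^sup>*" if "i < m" for i
    using step[OF cw_E_intros(1)[OF that]] by simp
  have v: "(cv j, cz) \<in> ?R\<^sup>*" if "j < p" for j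
    using step[OF cw_E_intros(2)[OF that] u] size by simp
  have l: "(cl k, cz) \<in> ?R\<^sup>*" if "k < s" for k
    using step[OF cw_E_intros(3)[OF that] u] size by simp
  have x: "(cx k, cz) \<in> ?R\<^sup>*" if "k < t" for k
    using step[OF cw_E_intros(4)[OF that] v] size by simp
  have y: "(cy k, cz) \<in> ?R\<^sup>*" if "k < t" for k
    using step[OF cw_E_intros(5)[OF that] v] size by simp
  have to_cz: "(a, cz) \<in> ?R\<^sup>*" if "a \<in> V" for a
    using that u v l x y unfolding cw_V_def by blast
  have "(a, b) \<in> ?R\<^sup>*" if "a \<in> V" "b \<in> V" for a b
    using to_cz[OF that(1)] symD[OF \<open>sym (?R\<^sup>*)\<close> to_cz[OF that(2)]] by (rule rtrancl_trans)
  moreover have "V \<noteq> {}" by (simp add: cw_V_def)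
  ultimately show ?thesis unfolding connected_graph_def by blast
qed

text \<open>The matching takes one leaf edge per hub and the edge opposite the apex in each
  triangle. Every edge contains a hub or lies in a triangle, and edges at one hub, like edges of one
  triangle, meet.\<close>

lemma cw_matching_numbers: "matching_number E = induced_matching_number E"
proof (rule matching_numbers_eqI[where M = "(\<lambda>i. {cu i, cl i}) ` {..<m} \<union> (\<lambda>k. {cx k, cy k}) ` {..<t}"
      and R = "\<lambda>e f. (\<exists>i<m. f = {cu i, cl i} \<and> cu i \<in> e)
        \<or> (\<exists>k<t. f = {cx k, cy k} \<and> e \<subseteq> {cv (min k (p - 1)), cx k, cy k})"])
  show "finite E" by (simp add: cw_E_def)
  let ?M = "(\<lambda>i. {cu i, cl i}) ` {..<m} \<union> (\<lambda>k. {cx k, cy k}) ` {..<t}"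
  let ?R = "\<lambda>e f. (\<exists>i<m. f = {cu i, cl i} \<and> cu i \<in> e)
        \<or> (\<exists>k<t. f = {cx k, cy k} \<and> e \<subseteq> {cv (min k (p - 1)), cx k, cy k})"
  have "{cu i, cl i} \<in> E" if "i < m" for i
    using cw_E_intros(3)[of i s m p t] that size by (simp add: min_def split: if_splits)
  hence sub: "?M \<subseteq> E" using cw_E_intros(6) by blast
  have disj: "e \<inter> f = {}" if "e \<in> ?M" "f \<in> ?M" "e \<noteq> f" for e f
    using that by auto
  have ind: "\<not> (g \<inter> e \<noteq> {} \<and> g \<inter> f \<noteq> {})" if "e \<in> ?M" "f \<in> ?M" "e \<noteq> f" "g \<in> E" for e f g
  proof -
    have uu: "i = j" if "g \<inter> {cu i, cl i} \<noteq> {}" "g \<inter> {cu j, cl j} \<noteq> {}"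
      "i < m" "j < m" for i j
      using \<open>g \<in> E\<close> that by (cases rule: cw_E_cases) (auto simp: min_def split: if_splits)
    have ux: "g \<inter> {cu i, cl i} = {} \<or> g \<inter> {cx k, cy k} = {}" for i k
      using \<open>g \<in> E\<close> by (cases rule: cw_E_cases) auto
    have xx: "k = l" if "g \<inter> {cx k, cy k} \<noteq> {}" "g \<inter> {cx l, cy l} \<noteq> {}" for k l
      using \<open>g \<in> E\<close> that by (cases rule: cw_E_cases) auto
    from that(1) have e: "(\<exists>i<m. e = {cu i, cl i}) \<or> (\<exists>k. e = {cx k, cy k})" by blast
    from that(2) have f: "(\<exists>i<m. f = {cu i, cl i}) \<or> (\<exists>k. f = {cx k, cy k})" by blast
    show ?thesis
    proof
      assume g: "g \<inter> e \<noteq> {} \<and> g \<inter> f \<noteq> {}"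
      from e f show False
      proof (elim disjE exE conjE)
        fix i j assume "i < m" "e = {cu i, cl i}" "j < m" "f = {cu j, cl j}"
        thus False using uu[of i j] g \<open>e \<noteq> f\<close> by simp
      next
        fix i k assume "e = {cu i, cl i}" "f = {cx k, cy k}"
        thus False using ux[of i k] g by blast
      next
        fix k i assume "e = {cx k, cy k}" "f = {cu i, cl i}"
        thus False using ux[of i k] g by blast
      next
        fix k l assume "e = {cx k, cy k}" "f = {cx l, cy l}"
        thus False using xx[of k l] g \<open>e \<noteq> f\<close> by simp
      qed
    qed
  qed
  show "induced_matching E ?M"
    unfolding induced_matching_def matching_def by (intro conjI ballI impI sub disj ind)
  show "\<exists>f\<in>?M. ?R e f" if "e \<in> E" for e
    using that
  proof (cases rule: cw_E_cases)
    case (centre i)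
    thus ?thesis by (intro bexI[of _ "{cu i, cl i}"]) auto
  next
    case (apex j)
    thus ?thesis using size by (intro bexI[of _ "{cu 0, cl 0}"]) auto
  next
    case (leaf k)
    thus ?thesis using size by (intro bexI[of _ "{cu (min k (m - 1)), cl (min k (m - 1))}"]) auto
  next
    case (tri1 k)
    thus ?thesis by (intro bexI[of _ "{cx k, cy k}"]) auto
  next
    case (tri2 k)
    thus ?thesis by (intro bexI[of _ "{cx k, cy k}"]) auto
  next
    case (tri3 k)
    thus ?thesis by (intro bexI[of _ "{cx k, cy k}"]) auto
  qed
  show "e \<inter> e' \<noteq> {}" if e: "e \<in> E" "e' \<in> E" and R: "?R e f" "?R e' f" for e e' f
  proof -
    have c2: "card e = 2" "card e' = 2"
      using e cw_simple by (auto simp: simple_graph_def)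
    from R consider i where "cu i \<in> e" "cu i \<in> e'"
      | k where "e \<subseteq> {cv (min k (p - 1)), cx k, cy k}" "e' \<subseteq> {cv (min k (p - 1)), cx k, cy k}"
      by (fastforce simp: doubleton_eq_iff)
    thus ?thesis
    proof cases
      case 2
      hence "card (e \<union> e') \<le> card {cv (min k (p - 1)), cx k, cy k}"
        by (intro card_mono) auto
      moreover have "finite e" "finite e'"
        using c2 by (metis card.infinite zero_neq_numeral)+
      ultimately show ?thesis
        using card_Un_disjoint[of e e'] c2 by auto
    qed auto
  qed
qed

lemma cw_cameron_walker: "cameron_walker V E"
proof -
  have "\<not> is_star V E"
  proof
    assume "is_star V E"
    then obtain c where c: "\<And>e. e \<in> E \<Longrightarrow> c \<in> e" by (auto simp: is_star_def)
    have "{cz, cu 0} \<in> E" "{cx 0, cy 0} \<in> E"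
      using size by (auto intro!: cw_E_intros)
    from c[OF this(1)] c[OF this(2)] show False by auto
  qed
  moreover have "\<not> is_star_triangle V E"
  proof
    assume "is_star_triangle V E"
    then obtain c T where T: "\<forall>d\<in>T. card d = 3 \<and> c \<in> d" "E = {e. card e = 2 \<and> (\<exists>d\<in>T. e \<subseteq> d)}"
      unfolding is_star_triangle_def by (elim exE conjE) (rule that)
    \<comment> \<open>Leaf 0 has degree 1, so its edge lies in no triangle.\<close>
    have "{cl 0, cu 0} \<in> E"
      using size by (simp add: cw_nbhd)
    then obtain d where d: "d \<in> T" "{cl 0, cu 0} \<subseteq> d" using T(2) by blast
    have "\<not> d \<subseteq> {cl 0, cu 0}"
      using card_mono[of "{cl 0, cu 0}" d] T(1) d(1) by auto
    then obtain w where w: "w \<in> d" "w \<noteq> cl 0" "w \<noteq> cu 0" by blast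
    have "{cl 0, w} \<in> E"
      using w d by (subst T(2)) auto
    thus False using w by (simp add: cw_nbhd)
  qed
  ultimately show ?thesis
    using cw_simple cw_connected cw_matching_numbers by (simp add: cameron_walker_def)
qed

lemma cw_depth: "graph_depth K V E = enat (m + p)"
proof (rule antisym)
  let ?F = "insert (cl 0) ((\<lambda>i. cu i) ` {1..<m} \<union> (\<lambda>j. cv j) ` {..<p})"
  have "card ((\<lambda>i. cu i) ` {1..<m} \<union> (\<lambda>j. cv j) ` {..<p}) = (m - 1) + p"
    by (subst card_Un_disjoint) (auto simp: card_image inj_on_def)
  hence "card ?F = m + p"
    using size by (subst card_insert_disjoint) auto
  moreover have "graph_depth K V E \<le> enat (card ?F)"
  proof (rule graph_depth_le[OF cw_simple])
    show "?F \<subseteq> V" using size by (auto simp: cw_V_def)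
    show "independent_set E ?F"
      unfolding independent_set_def
    proof (intro ballI notI)
      fix e assume "e \<in> E" "e \<subseteq> ?F"
      thus False using size by (cases rule: cw_E_cases) auto
    qed
    show "dominating V E ?F"
      unfolding dominating_def
    proof
      fix v assume v: "v \<in> V - ?F"
      then consider "v = cz" | "v = cu 0" | k where "v = cl k" "k < s" "0 < k"
        | k where "v = cx k" "k < t" | k where "v = cy k" "k < t"
        unfolding cw_V_def by (fastforce simp: image_iff)
      thus "\<exists>u\<in>?F. {u, v} \<in> E"
      proof cases
        case 1
        have "{cu 1, cz} \<in> E" using cw_E_intros(1)[of 1 m p s t] size by (simp add: insert_commute)
        moreover have "cu 1 \<in> ?F" using size by auto
        ultimately show ?thesis using 1 by blast
      next
        case 2
        have "{cl 0, cu 0} \<in> E" using size by (simp add: cw_nbhd)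
        thus ?thesis using 2 by blast
      next
        case (3 k)
        have "min k (m - 1) \<in> {1..<m}" using 3 size by auto
        hence "cu (min k (m - 1)) \<in> ?F" by blast
        thus ?thesis using 3 cw_E_intros(3) by blast
      next
        case (4 k)
        have "cv (min k (p - 1)) \<in> ?F" using 4 size by auto
        thus ?thesis using 4 cw_E_intros(4) by blast
      next
        case (5 k)
        have "cv (min k (p - 1)) \<in> ?F" using 5 size by auto
        thus ?thesis using 5 cw_E_intros(5) by blast
      qed
    qed
  qed
  ultimately show "graph_depth K V E \<le> enat (m + p)" by simp
  \<comment> \<open>One leaf per hub and one triangle vertex per apex: their closed neighbourhoods
    are disjoint edges and triangles.\<close>
  let ?L = "(\<lambda>i. cl i) ` {..<m} \<union> (\<lambda>j. cy j) ` {..<p}"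
  have "card ?L = m + p"
    by (subst card_Un_disjoint) (auto simp: card_image inj_on_def)
  moreover have "enat (card ?L) \<le> graph_depth K V E"
  proof (rule graph_depth_ge[OF cw_simple])
    show "?L \<subseteq> V" using size by (auto simp: cw_V_def)
    have "closed_nbhd E (cl i) = {cl i, cu i}" if "i < m" for i
      using that size by (auto simp: closed_nbhd_def cw_nbhd)
    moreover have "closed_nbhd E (cy j) = {cy j, cx j, cv j}" if "j < p" for j
      using that size by (auto simp: closed_nbhd_def cw_nbhd)
    ultimately show "closed_nbhd E l \<inter> closed_nbhd E l' = {}" if "l \<in> ?L" "l' \<in> ?L" "l \<noteq> l'" for l l'
      using that by auto
  qed
  ultimately show "enat (m + p) \<le> graph_depth K V E" by simp
qed

text \<open>The vertices are covered by 1 + s + t cliques: the centre, each leaf (with hub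
  \<open>k\<close> if its index \<open>k\<close> is below \<open>m\<close>), and each pair
  \<open>cx k\<close>, \<open>cy k\<close> (with apex \<open>k\<close> if \<open>k\<close> is below
  \<open>p\<close>). An independent set meets each clique at most once, and \<open>?A\<close> meets
  them all.\<close>

lemma cw_dim: "graph_dim K V E = enat (1 + s + t)"
proof -
  let ?A = "insert cz ((\<lambda>i. cl i) ` {..<s} \<union> (\<lambda>j. cy j) ` {..<t})"
  have "card ((\<lambda>i. cl i) ` {..<s} \<union> (\<lambda>j. cy j) ` {..<t}) = s + t"
    by (subst card_Un_disjoint) (auto simp: card_image inj_on_def)
  hence card: "card ?A = 1 + s + t"
    by (subst card_insert_disjoint) auto
  have "graph_dim K V E = enat (card ?A)"
  proof (rule graph_dim_eqI[OF cw_simple])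
    show "?A \<subseteq> V" by (auto simp: cw_V_def)
    show "independent_set E ?A"
      unfolding independent_set_def
    proof (intro ballI notI)
      fix e assume "e \<in> E" "e \<subseteq> ?A"
      thus False by (cases rule: cw_E_cases) auto
    qed
    fix F assume F: "F \<subseteq> V" "independent_set E F"
    let ?R = "\<lambda>w a. w = a \<or> (\<exists>i<m. w = cu i \<and> a = cl i)
      \<or> (\<exists>j<p. w = cv j \<and> a = cy j) \<or> (\<exists>k<t. w = cx k \<and> a = cy k)"
    show "card F \<le> card ?A"
    proof (rule card_le_rel[where R = ?R])
      show "\<exists>a\<in>?A. ?R w a" if "w \<in> F" for w
      proof -
        have "w \<in> V" using that F(1) by blast
        thus ?thesis using size unfolding cw_V_def by (fastforce simp: image_iff)
      qed
      fix w w' a assume w: "w \<in> F" "w' \<in> F" "?R w a" "?R w' a"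
      have E: "{cu i, cl i} \<in> E" "{cl i, cu i} \<in> E" if "i < m" for i
        using that size by (simp_all add: cw_nbhd insert_commute[of "cu i"])
      have E': "{cv j, cy j} \<in> E" "{cy j, cv j} \<in> E" "{cv j, cx j} \<in> E" "{cx j, cv j} \<in> E" if "j < p" for j
        using that size cw_E_intros(4)[of j t p m s]
        by (simp_all add: cw_nbhd insert_commute[of "cv j"])
      have E'': "{cx j, cy j} \<in> E" "{cy j, cx j} \<in> E" if "j < t" for j
        using that by (simp_all add: cw_nbhd insert_commute[of "cx j"])
      have "{w, w'} \<notin> E" using F(2) w(1,2) by (auto simp: independent_set_def)
      thus "w = w'"
        using w(3,4) E E' E'' by auto
    qed simp
  qed
  thus ?thesis using card by simp
qed

lemma cw_mem: "(enat (m + p), enat (1 + s + t)) \<in> CW_depth_dim K (1 + m + p + s + 2 * t)"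
  unfolding CW_depth_dim_def using cw_cameron_walker card_cw_V cw_depth[of K] cw_dim[of K]
  by (intro CollectI exI[of _ V] exI[of _ E]) simp

end

text \<open>Depth, dimension and number of vertices force t = n - a - b and s = 2b + a - n - 1 and
  leave \<open>p\<close> free; it takes the least value compatible with p \<ge> 1 and m \<le> s. The
  first two hypotheses then give m \<ge> 2, the last two p \<le> t.\<close>

lemma CW_depth_dim_mem:
  assumes "3 \<le> a" "n + 3 \<le> a + 2 * b" "a + 1 \<le> b" "a + b + 1 \<le> n"
  shows "(enat a, enat b) \<in> CW_depth_dim K n"
proof -
  define p where "p = max 1 (n + 1 - 2 * b)"
  define m where "m = a - p"
  define s where "s = 2 * b + a - n - 1"
  define t where "t = n - b - a"
  have "2 \<le> m" "1 \<le> p" "m \<le> s" "p \<le> t"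
    using assms by (auto simp: p_def m_def s_def t_def max_def)
  from cw_mem[OF this, of K] have "(enat (m + p), enat (1 + s + t)) \<in> CW_depth_dim K (1 + m + p + s + 2 * t)" .
  moreover have "m + p = a" "1 + s + t = b" "1 + m + p + s + 2 * t = n"
    using assms by (auto simp: p_def m_def s_def t_def max_def)
  ultimately show ?thesis by simp
qed

section \<open>Counting\<close>

lemma card_le_of_inj_image:
  assumes "inj f" "finite B" "f ` A \<subseteq> B"
  shows "card A \<le> card B"
  using card_mono[OF assms(2,3)] card_image[OF inj_on_subset[OF assms(1)], of A] by simp

lemma inj_map_prod_enat: "inj (map_prod enat enat)"
  by (intro prod.inj_map) (auto simp: inj_def)

lemma finite_CW_depth_dim: "finite (CW_depth_dim K n)"
proof -
  have "{(a, b). a \<le> b \<and> a + b \<le> n \<and> n \<le> 3 * b} \<subseteq> {..n} \<times> {..n}" by auto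
  hence "finite {(a, b). a \<le> b \<and> a + b \<le> n \<and> n \<le> 3 * b}"
    by (rule finite_subset) simp
  thus ?thesis
    using CW_depth_dim_subset finite_subset by blast
qed

lemma finite_Graph_depth_dim: "finite (Graph_depth_dim K n)"
proof -
  have "{(a, b). a \<le> b \<and> b \<le> n} \<subseteq> {..n} \<times> {..n}" by auto
  hence "finite {(a, b). a \<le> b \<and> b \<le> n}"
    by (rule finite_subset) simp
  thus ?thesis
    using Graph_depth_dim_subset finite_subset by blast
qed

lemma card_Graph_depth_dim_upper:
  "2 * card (Graph_depth_dim K n) \<le> (n + 1) * (n + 2)"
proof -
  have eq: "{(a, b). a \<le> b \<and> b \<le> n} = prod.swap ` (SIGMA b:{..n}. {..b})"
    by force
  have "finite {(a, b). a \<le> b \<and> b \<le> n}"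
    unfolding eq by (intro finite_imageI finite_SigmaI) auto
  hence "card (Graph_depth_dim K n) \<le> card (map_prod enat enat ` {(a, b). a \<le> b \<and> b \<le> n})"
    by (intro card_mono finite_imageI Graph_depth_dim_subset)
  also have "\<dots> \<le> card (SIGMA b:{..n}. {..b})"
    unfolding eq image_image by (intro card_image_le finite_SigmaI) auto
  also have "\<dots> = (\<Sum>b\<le>n. b + 1)" by (simp add: card_SigmaI)
  finally have "card (Graph_depth_dim K n) \<le> (\<Sum>b\<le>n. b + 1)" .
  moreover have "2 * (\<Sum>b\<le>n. b + 1) = (n + 1) * (n + 2)"
    by (induction n) auto
  ultimately show ?thesis by linarith
qed

text \<open>Compared with the upper bound only the pairs with a = 0 or b = n are left out, a linear
  number.\<close>

lemma card_Graph_depth_dim_lower: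
  "n * (n - 1) \<le> 2 * card (Graph_depth_dim K n)"
proof -
  let ?A = "SIGMA b:{..<n}. {1..b}"
  have "card ?A \<le> card (Graph_depth_dim K n)"
  proof (rule card_le_of_inj_image[OF _ finite_Graph_depth_dim])
    show "inj (map_prod enat enat \<circ> prod.swap)"
      by (intro inj_compose inj_map_prod_enat inj_swap)
    show "(map_prod enat enat \<circ> prod.swap) ` ?A \<subseteq> Graph_depth_dim K n"
      by (auto intro!: Graph_depth_dim_mem)
  qed
  moreover have "card ?A = (\<Sum>b<n. b)" by (simp add: card_SigmaI)
  moreover have "2 * (\<Sum>b<n. b) + n = n * n"
    by (induction n) auto
  ultimately show ?thesis by (simp add: diff_mult_distrib2)
qed

text \<open>The binding upper bound on \<open>a\<close> changes at b = 3k, from a \<le> b to a \<le>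
  6k - b. The two pieces have about 5k^2/2 and 9k^2/2 elements.\<close>

lemma card_CW_depth_dim_upper:
  "card (CW_depth_dim K (6 * k)) \<le> 7 * k\<^sup>2 + 5 * k + 1"
proof -
  let ?A = "SIGMA b:{2*k..3*k}. {..b}" and ?B = "SIGMA j:{1..3*k}. {..3*k - j}"
  let ?D = "{(a, b). a \<le> b \<and> a + b \<le> 6 * k \<and> 6 * k \<le> 3 * b}"
  have "?D \<subseteq> prod.swap ` ?A \<union> (\<lambda>(j, a). (a, 3 * k + j)) ` ?B"
  proof
    fix q assume "q \<in> ?D"
    then obtain a b where q: "q = (a, b)" "a \<le> b" "a + b \<le> 6 * k" "6 * k \<le> 3 * b" by blast
    show "q \<in> prod.swap ` ?A \<union> (\<lambda>(j, a). (a, 3 * k + j)) ` ?B"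
    proof (cases "b \<le> 3 * k")
      case True
      thus ?thesis using q by (intro UnI1 image_eqI[of _ _ "(b, a)"]) auto
    next
      case False
      thus ?thesis using q by (intro UnI2 image_eqI[of _ _ "(b - 3 * k, a)"]) auto
    qed
  qed
  hence "CW_depth_dim K (6 * k)
      \<subseteq> map_prod enat enat ` (prod.swap ` ?A) \<union> map_prod enat enat ` ((\<lambda>(j, a). (a, 3 * k + j)) ` ?B)"
    unfolding image_Un[symmetric] by (rule order_trans[OF CW_depth_dim_subset image_mono])
  hence "card (CW_depth_dim K (6 * k)) \<le> card (map_prod enat enat ` (prod.swap ` ?A)
      \<union> map_prod enat enat ` ((\<lambda>(j, a). (a, 3 * k + j)) ` ?B))"
    by (intro card_mono) auto
  also have "\<dots> \<le> card (map_prod enat enat ` (prod.swap ` ?A))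
      + card (map_prod enat enat ` ((\<lambda>(j, a). (a, 3 * k + j)) ` ?B))"
    by (rule card_Un_le)
  also have "\<dots> \<le> card ?A + card ?B"
    unfolding image_image by (intro add_mono card_image_le finite_SigmaI) auto
  also have "card ?A = (\<Sum>b=2*k..3*k. b + 1)" by (simp add: card_SigmaI)
  also have "\<dots> = (\<Sum>i\<le>k. 2 * k + i + 1)"
    by (rule sum.reindex_bij_witness[of _ "\<lambda>i. 2 * k + i" "\<lambda>b. b - 2 * k"]) auto
  also have "card ?B = (\<Sum>j=1..3*k. 3 * k - j + 1)" by (simp add: card_SigmaI)
  also have "\<dots> = (\<Sum>l=1..3*k. l)"
    by (rule sum.reindex_bij_witness[of _ "\<lambda>l. 3 * k - l + 1" "\<lambda>j. 3 * k - j + 1"]) auto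
  finally have "card (CW_depth_dim K (6 * k)) \<le> (\<Sum>i\<le>k. 2 * k + i + 1) + (\<Sum>l=1..3*k. l)" .
  moreover have "2 * (\<Sum>l=1..n. l) = n * (n + 1)" for n :: nat
    by (induction n) auto
  from this[of "3 * k"] have "2 * (\<Sum>l=1..3*k. l) = 9 * k\<^sup>2 + 3 * k"
    by (simp add: power2_eq_square algebra_simps)
  moreover have "2 * (\<Sum>i\<le>n. c + i + 1) = (n + 1) * (2 * c + n + 2)" for n c :: nat
    by (induction n) (auto simp: algebra_simps)
  from this[of "2 * k" k] have "2 * (\<Sum>i\<le>k. 2 * k + i + 1) = 5 * k\<^sup>2 + 7 * k + 2"
    by (simp add: power2_eq_square algebra_simps)
  ultimately show ?thesis by linarith
qed

text \<open>The region again splits at b = 3k: for b = 2k + i the lower bound a \<ge> n + 3 - 2b is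
  binding, for b = 3k + j it is a \<ge> 3. The row lengths fall short of 3i and 3k - j by at most 3,
  and the 4k rows together lose at most 12k.\<close>

lemma card_CW_depth_dim_lower:
  "6 * k\<^sup>2 \<le> card (CW_depth_dim K (6 * k)) + 12 * k"
proof -
  let ?A = "SIGMA i:{1..k}. {2*k + 3 - 2*i..<2*k + i}" and ?B = "SIGMA j:{1..3*k}. {3..<3*k - j}"
  let ?f = "\<lambda>(i, a). (a, 2 * k + i)" and ?g = "\<lambda>(j, a). (a, 3 * k + j)"
  have add_const: "(\<Sum>i=1..n. f i + 3) = (\<Sum>i=1..n. f i) + 3 * n" for f :: "nat \<Rightarrow> nat" and n
    by (simp add: sum.distrib)
  have cards: "card (?f ` ?A) = (\<Sum>i=1..k. (2*k + i) - (2*k + 3 - 2*i))"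
    "card (?g ` ?B) = (\<Sum>j=1..3*k. 3*k - j - 3)"
    by (simp_all add: card_SigmaI card_image inj_on_def)
  have "card (?f ` ?A) + card (?g ` ?B) = card (?f ` ?A \<union> ?g ` ?B)"
    by (intro card_Un_disjoint[symmetric] finite_imageI finite_SigmaI) auto
  also have "\<dots> \<le> card (CW_depth_dim K (6 * k))"
  proof (rule card_le_of_inj_image[OF inj_map_prod_enat finite_CW_depth_dim])
    show "map_prod enat enat ` (?f ` ?A \<union> ?g ` ?B) \<subseteq> CW_depth_dim K (6 * k)"
      by (auto intro!: CW_depth_dim_mem)
  qed
  finally have "(\<Sum>i=1..k. (2*k + i) - (2*k + 3 - 2*i)) + (\<Sum>j=1..3*k. 3*k - j - 3)
      \<le> card (CW_depth_dim K (6 * k))"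
    unfolding cards .
  moreover have "(\<Sum>i=1..k. 3 * i) \<le> (\<Sum>i=1..k. ((2*k + i) - (2*k + 3 - 2*i)) + 3)"
    by (rule sum_mono) auto
  hence "(\<Sum>i=1..k. 3 * i) \<le> (\<Sum>i=1..k. (2*k + i) - (2*k + 3 - 2*i)) + 3 * k"
    unfolding add_const .
  \<comment> \<open>Only an inequality, since \<open>3*k - j - 3\<close> is truncated at 0 in the
    last rows.\<close>
  moreover have "(\<Sum>j=1..3*k. 3*k - j) \<le> (\<Sum>j=1..3*k. (3*k - j - 3) + 3)"
    by (rule sum_mono) auto
  hence "(\<Sum>j=1..3*k. 3*k - j) \<le> (\<Sum>j=1..3*k. 3*k - j - 3) + 3 * (3 * k)"
    unfolding add_const .
  moreover have "(\<Sum>j=1..3*k. 3*k - j) = (\<Sum>l<3*k. l)"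
    by (rule sum.reindex_bij_witness[of _ "\<lambda>l. 3 * k - l" "\<lambda>j. 3 * k - j"]) auto
  moreover have "2 * (\<Sum>l<n. l) + n = n\<^sup>2" for n :: nat
    by (induction n) (auto simp: power2_eq_square)
  from this[of "3 * k"] have "2 * (\<Sum>l<3*k. l) + 3 * k = 9 * k\<^sup>2"
    by (simp add: power2_eq_square)
  moreover have "2 * (\<Sum>i=1..k. 3 * i) = 3 * k\<^sup>2 + 3 * k"
    by (induction k) (auto simp: power2_eq_square)
  ultimately show ?thesis by linarith
qed

theorem theorem3p10:
  fixes K :: "'k::field itself"
  assumes "convergent (\<lambda>n. real (card (CW_depth_dim K n)) / real (card (Graph_depth_dim K n)))"
  shows "1 / 3 \<le> lim (\<lambda>n. real (card (CW_depth_dim K n)) / real (card (Graph_depth_dim K n))) \<and> lim (\<lambda>n. real (card (CW_depth_dim K n)) / real (card (Graph_depth_dim K n))) \<le> 4 / 9"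
proof -
  define r where "r n = real (card (CW_depth_dim K n)) / real (card (Graph_depth_dim K n))" for n
  have "r \<longlonglongrightarrow> lim r"
    using assms by (simp add: convergent_LIMSEQ_iff r_def[abs_def])
  moreover have "strict_mono (\<lambda>k. 6 * k :: nat)" by (simp add: strict_mono_def)
  ultimately have lim: "(\<lambda>k. r (6 * k)) \<longlonglongrightarrow> lim r"
    using LIMSEQ_subseq_LIMSEQ[of r "lim r" "\<lambda>k. 6 * k"] by (simp add: comp_def)
  have num: "6 * x\<^sup>2 - 12 * x \<le> real (card (CW_depth_dim K (6 * k)))"
    "real (card (CW_depth_dim K (6 * k))) \<le> 7 * x\<^sup>2 + 5 * x + 1"
    and den: "18 * x\<^sup>2 - 3 * x \<le> real (card (Graph_depth_dim K (6 * k)))"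
    "real (card (Graph_depth_dim K (6 * k))) \<le> 18 * x\<^sup>2 + 9 * x + 1"
    if "x = real k" "k \<ge> 1" for x k
  proof -
    have "real (6 * k\<^sup>2) \<le> real (card (CW_depth_dim K (6 * k)) + 12 * k)"
      using card_CW_depth_dim_lower of_nat_mono by blast
    thus "6 * x\<^sup>2 - 12 * x \<le> real (card (CW_depth_dim K (6 * k)))" by (simp add: that(1))
    have "real (card (CW_depth_dim K (6 * k))) \<le> real (7 * k\<^sup>2 + 5 * k + 1)"
      using card_CW_depth_dim_upper of_nat_mono by blast
    thus "real (card (CW_depth_dim K (6 * k))) \<le> 7 * x\<^sup>2 + 5 * x + 1" by (simp add: that(1))
    have "real (6 * k * (6 * k - 1)) \<le> real (2 * card (Graph_depth_dim K (6 * k)))"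
      using card_Graph_depth_dim_lower of_nat_mono by blast
    thus "18 * x\<^sup>2 - 3 * x \<le> real (card (Graph_depth_dim K (6 * k)))"
      using that(2) by (simp add: that(1) of_nat_diff power2_eq_square algebra_simps)
    have "real (2 * card (Graph_depth_dim K (6 * k))) \<le> real ((6 * k + 1) * (6 * k + 2))"
      using card_Graph_depth_dim_upper of_nat_mono by blast
    thus "real (card (Graph_depth_dim K (6 * k))) \<le> 18 * x\<^sup>2 + 9 * x + 1"
      by (simp add: that(1) power2_eq_square algebra_simps)
  qed
  have pos: "real (card (Graph_depth_dim K (6 * k))) > 0" if "k \<ge> 1" for k
  proof -
    have "3 * real k < 18 * (real k)\<^sup>2"
      using that by (simp add: power2_eq_square)
    thus ?thesis using den(1)[OF refl that] by linarith
  qed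
  \<comment> \<open>The leading terms agree exactly. With the constant 2 the error term takes off 36
    k, more than the 12 k missing in the numerator and the 3 k from a third of the
    denominator.\<close>
  have lower: "1 / 3 - 2 / real k \<le> r (6 * k)" if "k \<ge> 1" for k
  proof -
    let ?x = "real k" and ?d = "real (card (Graph_depth_dim K (6 * k)))"
    have x: "?x \<ge> 1" using that by simp
    \<comment> \<open>The factor is negative for small \<open>k\<close>; splitting the product lets
      each part use the bound for \<open>?d\<close> in its own direction.\<close>
    have "(1 / 3 - 2 / ?x) * ?d = ?d / 3 - 2 * (?d / ?x)"
      by (simp add: algebra_simps)
    also have "\<dots> \<le> (18 * ?x\<^sup>2 + 9 * ?x + 1) / 3 - 2 * ((18 * ?x\<^sup>2 - 3 * ?x) / ?x)"
      using den[OF refl that] x by (intro diff_mono mult_left_mono divide_right_mono) auto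
    also have "(18 * ?x\<^sup>2 - 3 * ?x) / ?x = 18 * ?x - 3"
      using x by (simp add: power2_eq_square field_simps)
    also have "(18 * ?x\<^sup>2 + 9 * ?x + 1) / 3 - 2 * (18 * ?x - 3) = 6 * ?x\<^sup>2 - 33 * ?x + 19 / 3"
      by (simp add: field_simps)
    finally have "(1 / 3 - 2 / ?x) * ?d \<le> real (card (CW_depth_dim K (6 * k)))"
      using num(1)[OF refl that] x by linarith
    thus ?thesis
      using pos[OF that] by (simp add: r_def le_divide_eq)
  qed
  \<comment> \<open>The leading coefficients to compare are 7 and 8; the spare square beats the
    linear terms once k \<ge> 8.\<close>
  have upper: "r (6 * k) \<le> 4 / 9" if "k \<ge> 8" for k
  proof -
    let ?x = "real k"
    have "8 * ?x \<le> ?x\<^sup>2" using that by (simp add: power2_eq_square)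
    moreover have "?x \<ge> 8" using that by simp
    ultimately have "7 * ?x\<^sup>2 + 5 * ?x + 1 \<le> 4 / 9 * (18 * ?x\<^sup>2 - 3 * ?x)" by (simp add: algebra_simps)
    also have "\<dots> \<le> 4 / 9 * real (card (Graph_depth_dim K (6 * k)))"
      using den(1)[OF refl, of k] that by simp
    finally show ?thesis
      using num(2)[OF refl, of k] pos[of k] that by (simp add: r_def divide_le_eq)
  qed
  have "(\<lambda>k. 1 / 3 - 2 / real k) \<longlonglongrightarrow> 1 / 3 - 0"
    using tendsto_mult_right_zero[OF lim_1_over_n, of 2] by (intro tendsto_diff tendsto_const) simp
  hence "1 / 3 \<le> lim r"
    using lim lower by (intro LIMSEQ_le[of "\<lambda>k. 1 / 3 - 2 / real k" "1 / 3" "\<lambda>k. r (6 * k)"]) auto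
  moreover have "lim r \<le> 4 / 9"
    using upper by (intro LIMSEQ_le_const2[OF lim]) auto
  ultimately show ?thesis by (simp add: r_def[abs_def])
qed

end
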